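(* Let $0\le m\le n$ be integers, let $F,G$ be a pair of dual random functions ($F:\{0,1\}^n\to\{0,1\}^m$, $G=F^\perp:\{0,1\}^n\to\{0,1\}^{n-m}$), let $r:\mathbb R\to\mathbb R$ be an arbitrary function, let $A$ be an $n$-qubit space, and let $\rho_{Z^AE}$ and $\rho_{X^AB}$ be normalized states that correspond to each other through a tripartite state $\rho_{ABE}$ in the standard form. Then the following three inequalities are equivalent; that is, if any one of them is true, then all of them are true. (1) (Leftover hashing lemma for privacy amplification using $F=G^\perp$) $${\rm E}_F\,Q^{{\rm PA},F}(\rho_{Z^AE})\le r\big(H_{\rm min}(Z^A|E)_\rho\big).$$ (2) (Coding theorem for error correction using $G=F^\perp$) $${\rm E}_G\,Q^{{\rm EC},G}(\rho_{X^AB})\le r\big(n-H_{\rm max}(X^A|B)_\rho\big).$$ (3) (Coding theorem for data compression using $G=F^\perp$) $${\rm E}_G\,Q^{{\rm DC},G}(\rho_{X^AB})\le r\big(n-H_{\rm max}(X^A|B)_\rho\big).$$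
   Context: All Hilbert spaces are finite-dimensional; logarithms are base 2. A normalized state is a positive semidefinite operator of trace 1. $A=(\mathbb C^2)^{\otimes n}$ has the $z$ basis $\{|z\rangle\}_{z\in\{0,1\}^n}$ (computational basis, eigenbasis of the Pauli $\sigma_Z$'s) and the $x$ basis $\{|\tilde x\rangle\}_{x\in\{0,1\}^n}$, the product eigenbasis of the Pauli $\sigma_X$'s ($\sigma_X|\tilde x_i\rangle=(-1)^{x_i}|\tilde x_i\rangle$ on each qubit). States: for a state $\rho_{ABE}$ with marginals $\rho_{AE}={\rm Tr}_B\rho_{ABE}$ and $\rho_{AB}={\rm Tr}_E\rho_{ABE}$, the states after measuring $A$ in the $z$ basis, respectively the $x$ basis, are $\rho_{Z^AE}=\sum_z(|z\rangle\langle z|_A\otimes I_E)\rho_{AE}(|z\rangle\langle z|_A\otimes I_E)=\sum_z|z\rangle\langle z|_A\otimes\rho^z_E$ and $\rho_{X^AB}=\sum_x(|\tilde x\rangle\langle\tilde x|_A\otimes I_B)\rho_{AB}(|\tilde x\rangle\langle\tilde x|_A\otimes I_B)=\sum_x|\tilde x\rangle\langle\tilde x|_A\otimes\tilde\rho^x_B$. The state $\rho_{ABE}$ is in the standard form if it is pure and satisfies $\rho_{AE}=\rho_{Z^AE}$ or $\rho_{AB}=\rho_{X^AB}$. States $\rho_{Z^AE}$ and $\rho_{X^AB}$ correspond to each other if both arise in this way from one $\rho_{ABE}$ in the standard form. Given either one, the other is obtained by purifying it to $\rho_{ABE}$, tracing out the unneeded one of $B,E$, and measuring $A$ in the other basis.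 Entropies: $H_{\rm min}(U|V)_\rho=-\log\min\{{\rm Tr}(\sigma):\sigma_V\ge0,\ \rho_{UV}\le I_U\otimes\sigma_V\}$ and $H_{\rm max}(U|V)_\rho=\max_{\sigma_V\ge0,{\rm Tr}\sigma=1}\log\big(|\mathcal U|\,\|\sqrt{\rho_{UV}}\sqrt{|\mathcal U|^{-1}I_U\otimes\sigma_V}\|_1^2\big)$, with $|\mathcal U|$ the alphabet size of $U$. $H_{\rm min}(Z^A|E)_\rho$ and $H_{\rm max}(X^A|B)_\rho$ are these quantities for $\rho_{Z^AE}$ and $\rho_{X^AB}$ with $U=A$ (alphabet $\{0,1\}^n$). Indices: for linear $f:\{0,1\}^n\to\{0,1\}^m$ put $\rho^f_{KE}=\sum_k|k\rangle\langle k|_K\otimes\sum_{z\in f^{-1}(k)}\rho^z_E$ and $Q^{{\rm PA},f}(\rho_{Z^AE})={\rm Tr}(\rho_{Z^AE})-2^{H_{\rm max}(K|E)_{\rho^f}-m}$ (privacy amplification; alphabet of $K$ is $\{0,1\}^m$). Error correction with quantum side information: given $x$ and $\tilde\rho^x_B$, the receiver computes $s=g(x)$, measures $B$ by a POVM $M^s=\{M^{s,e}\}_{e\in\{0,1\}^n}$, outputs $y=x+e$, and fails if $y\ne0$ (the codeword sent being $0$): $Q^{{\rm EC},g}(\rho_{X^AB})=\min_{\{M^s\}}\sum_x\sum_{e:\,x+e\ne0}{\rm Tr}(\tilde\rho^xM^{g(x),e})$. Data compression with quantum side information: the decoder receives $s=g(x)$ and $\tilde\rho^x_B$, measures $B$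 by a POVM $M^s$, outputs $x'=e$, and fails if $x'\ne x$: $Q^{{\rm DC},g}(\rho_{X^AB})=\min_{\{M^s\}}\sum_x\sum_{e\ne x}{\rm Tr}(\tilde\rho^xM^{g(x),e})$. The minima are over all families of POVMs indexed by $s\in\{0,1\}^{n-m}$. Duality: linear surjective $f:\{0,1\}^n\to\{0,1\}^m$, $g:\{0,1\}^n\to\{0,1\}^{n-m}$, given by full-rank matrices over $\mathbb F_2$ of sizes $m\times n$ and $(n-m)\times n$, are dual ($f\perp g$) if $fg^T=0$. A random function $F$ is a random variable with values in a finite set of functions, and ${\rm E}_F\,h(F)=\sum_f\Pr[F=f]\,h(f)$. A pair of random functions $F,G$ is dual ($G=F^\perp$, $F=G^\perp$) if they are chosen from sets $\{f_1,f_2,\dots\}$ and $\{g_1,g_2,\dots\}$ of the same size with $f_i\perp g_i$ and $\Pr[F=f_i]=\Pr[G=g_i]$ for all $i$. *)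

theory Defs
  imports
    "HOL-Probability.Probability"
    "HOL-Library.Type_Length"
    "HOL-Library.Z2"
    "Jordan_Normal_Form.Matrix"
begin

section \<open>Bit strings and linear functions over the field with two elements\<close>

text \<open>
  The type \<open>'n bits\<close> is the set of bit strings of length \<open>LENGTH('n)\<close>.  Every natural number,
  including 0, is the length of some type of class \<open>len0\<close>, and the type is finite, so that
  it can index an orthonormal basis.
\<close>

typedef (overloaded) 'n bits = "carrier_vec LENGTH('n::len0) :: bit Matrix.vec set"
  morphisms bits_vec Bits
  by (rule exI[of _ "0\<^sub>v LENGTH('n)"]) simp

definition bit_at :: "'n::len0 bits \<Rightarrow> nat \<Rightarrow> bit" where
  "bit_at x i = vec_index (bits_vec x) i"

lemma finite_carrier_vec_bit: "finite (carrier_vec k :: bit Matrix.vec set)"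
proof -
  have "carrier_vec k \<subseteq> vec_of_list ` {xs :: bit list. set xs \<subseteq> UNIV \<and> length xs = k}"
  proof
    fix v :: "bit Matrix.vec"
    assume "v \<in> carrier_vec k"
    then have "list_of_vec v \<in> {xs. set xs \<subseteq> UNIV \<and> length xs = k}"
      by auto
    moreover have "v = vec_of_list (list_of_vec v)"
      by (simp add: vec_list)
    ultimately show "v \<in> vec_of_list ` {xs. set xs \<subseteq> UNIV \<and> length xs = k}"
      by blast
  qed
  moreover have "finite (UNIV :: bit set)"
    by (rule finite_subset[of _ "{0, 1}"]) (auto simp: bit_not_one_iff)
  ultimately show ?thesis
    by (rule finite_subset[OF _ finite_imageI[OF finite_lists_length_eq]])
qed

instance bits :: (len0) finite
proof
  show "finite (UNIV :: 'a bits set)"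
    by (metis finite_carrier_vec_bit finite_imageI type_definition.Abs_image type_definition_bits)
qed

instantiation bits :: (len0) ab_group_add
begin

definition zero_bits :: "'a bits" where "zero_bits = Bits (0\<^sub>v LENGTH('a))"
definition plus_bits :: "'a bits \<Rightarrow> 'a bits \<Rightarrow> 'a bits" where
  "plus_bits x y = Bits (bits_vec x + bits_vec y)"
definition uminus_bits :: "'a bits \<Rightarrow> 'a bits" where "uminus_bits x = Bits (- bits_vec x)"
definition minus_bits :: "'a bits \<Rightarrow> 'a bits \<Rightarrow> 'a bits" where "minus_bits x y = x + - y"

instance
proof
  have c[simp]: "bits_vec x \<in> carrier_vec LENGTH('a)" for x :: "'a bits"
    by (rule bits_vec)
  have p: "bits_vec (x + y) = bits_vec x + bits_vec y" for x y :: "'a bits"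
    unfolding plus_bits_def by (rule Bits_inverse) simp
  have z: "bits_vec (0 :: 'a bits) = 0\<^sub>v LENGTH('a)"
    unfolding zero_bits_def by (rule Bits_inverse) simp
  have u: "bits_vec (- x) = - bits_vec x" for x :: "'a bits"
    unfolding uminus_bits_def by (rule Bits_inverse) simp
  fix x y w :: "'a bits"
  show "x + y + w = x + (y + w)"
    by (intro bits_vec_inject[THEN iffD1]) (simp add: p assoc_add_vec[OF c c c])
  show "x + y = y + x"
    by (intro bits_vec_inject[THEN iffD1]) (simp add: p comm_add_vec[OF c c])
  show "0 + x = x"
    by (intro bits_vec_inject[THEN iffD1]) (simp add: p z)
  show "- x + x = 0"
    by (intro bits_vec_inject[THEN iffD1]) (simp add: p z u)
  show "x - y = x + - y"
    by (rule minus_bits_def)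
qed

end

definition matrix_fun :: "bit Matrix.mat \<Rightarrow> 'n::len0 bits \<Rightarrow> 'm::len0 bits" where
  "matrix_fun M z = Bits (M *\<^sub>v bits_vec z)"

text \<open>Since \<open>F\<close> and \<open>G\<close> are matrices with as many rows as the target has bits, surjectivity is
  the full-rank condition.\<close>

definition dual_functions ::
    "('n::len0 bits \<Rightarrow> 'm::len0 bits) \<Rightarrow> ('n bits \<Rightarrow> 'l::len0 bits) \<Rightarrow> bool" where
  "dual_functions f g \<longleftrightarrow>
     (\<exists>F \<in> carrier_mat LENGTH('m) LENGTH('n). \<exists>G \<in> carrier_mat LENGTH('l) LENGTH('n).
        f = matrix_fun F \<and> g = matrix_fun G \<and> surj f \<and> surj g \<and>
        F * transpose_mat G = 0\<^sub>m LENGTH('m) LENGTH('l))"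

text \<open>A random function enters only through its distribution, a \<open>pmf\<close> on functions.  The sets
  \<open>{f\<^sub>1, f\<^sub>2, \<dots>}\<close> and \<open>{g\<^sub>1, g\<^sub>2, \<dots>}\<close> are enumerated without repetition.\<close>

definition dual_random_functions ::
    "('n::len0 bits \<Rightarrow> 'm::len0 bits) pmf \<Rightarrow> ('n bits \<Rightarrow> 'l::len0 bits) pmf \<Rightarrow> bool" where
  "dual_random_functions F G \<longleftrightarrow>
     (\<exists>(N::nat) f g. inj_on f {..<N} \<and> inj_on g {..<N} \<and>
        set_pmf F \<subseteq> f ` {..<N} \<and> set_pmf G \<subseteq> g ` {..<N} \<and>
        (\<forall>i<N. dual_functions (f i) (g i) \<and> pmf F (f i) = pmf G (g i)))"


section \<open>Operators\<close>

text \<open>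
  A Hilbert space with an orthonormal basis indexed by the finite type \<open>'a\<close> is \<open>complex^'a\<close>, its
  operators are \<open>complex^'a^'a\<close>, and a tensor product is indexed by a product type.
\<close>

type_synonym 'a op = "complex^'a^'a"

definition adj :: "'a::finite op \<Rightarrow> 'a op" where
  "adj M = (\<chi> i j. cnj (M $ j $ i))"

definition outer :: "complex^'a::finite \<Rightarrow> 'a op" where
  "outer v = (\<chi> i j. v $ i * cnj (v $ j))"

text \<open>Membership in the nonnegative reals includes that the quadratic form is real, so positive
  semidefinite operators are Hermitian.\<close>

definition psd :: "'a::finite op \<Rightarrow> bool" where
  "psd M \<longleftrightarrow> (\<forall>v. (\<Sum>i\<in>UNIV. \<Sum>j\<in>UNIV. cnj (v $ i) * M $ i $ j * v $ j) \<in> \<real>\<^sub>\<ge>\<^sub>0)"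

definition loewner_le :: "'a::finite op \<Rightarrow> 'a op \<Rightarrow> bool" where
  "loewner_le M N \<longleftrightarrow> psd (N - M)"

definition op_sqrt :: "'a::finite op \<Rightarrow> 'a op" where
  "op_sqrt M = (THE R. psd R \<and> R ** R = M)"

definition trace_norm :: "'a::finite op \<Rightarrow> real" where
  "trace_norm M = Re (trace (op_sqrt (adj M ** M)))"

definition tensor_op :: "'a::finite op \<Rightarrow> 'b::finite op \<Rightarrow> ('a \<times> 'b) op" where
  "tensor_op M N = (\<chi> i j. M $ fst i $ fst j * N $ snd i $ snd j)"

definition normalized_state :: "'a::finite op \<Rightarrow> bool" where
  "normalized_state \<rho> \<longleftrightarrow> psd \<rho> \<and> trace \<rho> = 1"

definition pure :: "'a::finite op \<Rightarrow> bool" where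
  "pure \<rho> \<longleftrightarrow> (\<exists>\<psi>. \<rho> = outer \<psi>)"

definition marginal_AE :: "('a::finite \<times> 'b::finite \<times> 'e::finite) op \<Rightarrow> ('a \<times> 'e) op" where
  "marginal_AE \<rho> = (\<chi> i j. \<Sum>b\<in>UNIV. \<rho> $ (fst i, b, snd i) $ (fst j, b, snd j))"

definition marginal_AB :: "('a::finite \<times> 'b::finite \<times> 'e::finite) op \<Rightarrow> ('a \<times> 'b) op" where
  "marginal_AB \<rho> = (\<chi> i j. \<Sum>e\<in>UNIV. \<rho> $ (fst i, snd i, e) $ (fst j, snd j, e))"


section \<open>The two bases and the measured states\<close>

definition ket_z :: "'n::len0 bits \<Rightarrow> complex^('n bits)" where
  "ket_z z = axis z 1"

text \<open>On one qubit, the eigenvector of \<open>\<sigma>\<^sub>X\<close> for the eigenvalue \<open>(-1)^s\<close> is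
  \<open>(|0> + (-1)^s |1>) / sqrt 2\<close>; \<open>qubit_x s t\<close> is its component at \<open>|t>\<close>.
  As \<open>\<sigma>\<^sub>X\<close> exchanges the two components, the lemma is the eigenvalue equation.\<close>

definition qubit_x :: "bit \<Rightarrow> bit \<Rightarrow> complex" where
  "qubit_x s t = (if s = 1 \<and> t = 1 then - 1 else 1) / complex_of_real (sqrt 2)"

lemma qubit_x_eigenvector: "qubit_x s (t + 1) = (if s = 1 then - 1 else 1) * qubit_x s t"
  by (cases s; cases t) (simp_all add: qubit_x_def)

definition ket_x :: "'n::len0 bits \<Rightarrow> complex^('n bits)" where
  "ket_x x = (\<chi> z. \<Prod>i<LENGTH('n). qubit_x (bit_at x i) (bit_at z i))"

text \<open>State after measuring the first factor in the orthonormal basis \<open>ket\<close>.\<close>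

definition measured :: "('i::finite \<Rightarrow> complex^'a::finite) \<Rightarrow> ('a \<times> 'c::finite) op \<Rightarrow> ('a \<times> 'c) op"
  where
  "measured ket \<rho> =
     (\<Sum>i\<in>UNIV. tensor_op (outer (ket i)) (Finite_Cartesian_Product.mat 1) ** \<rho> **
        tensor_op (outer (ket i)) (Finite_Cartesian_Product.mat 1))"

text \<open>The conditional operator \<open>\<langle>v|\<rho>|v\<rangle>\<close> on the second factor.  If
  \<open>\<rho> = (\<Sum>i. outer (ket i) \<otimes> \<rho>\<^sup>i)\<close> for an orthonormal basis \<open>ket\<close>, then
  \<open>conditional (ket i) \<rho> = \<rho>\<^sup>i\<close>.\<close>

definition conditional :: "complex^'a::finite \<Rightarrow> ('a \<times> 'c::finite) op \<Rightarrow> 'c op" where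
  "conditional v \<rho> =
     (\<chi> c d. \<Sum>a\<in>UNIV. \<Sum>a'\<in>UNIV. cnj (v $ a) * \<rho> $ (a, c) $ (a', d) * v $ a')"

definition standard_form :: "('n::len0 bits \<times> 'b::finite \<times> 'e::finite) op \<Rightarrow> bool" where
  "standard_form \<rho> \<longleftrightarrow> pure \<rho> \<and>
     (marginal_AE \<rho> = measured ket_z (marginal_AE \<rho>) \<or>
      marginal_AB \<rho> = measured ket_x (marginal_AB \<rho>))"

definition corresponding ::
    "('n::len0 bits \<times> 'e::finite) op \<Rightarrow> ('n bits \<times> 'b::finite) op \<Rightarrow> bool" where
  "corresponding \<rho>Z \<rho>X \<longleftrightarrow>
     (\<exists>\<rho> :: ('n bits \<times> 'b \<times> 'e) op. standard_form \<rho> \<and>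
        \<rho>Z = measured ket_z (marginal_AE \<rho>) \<and> \<rho>X = measured ket_x (marginal_AB \<rho>))"


section \<open>Entropies\<close>

text \<open>All minima and maxima below are attained, so they are written as \<open>Inf\<close> and \<open>Sup\<close>.\<close>

definition H_min :: "('u::finite \<times> 'v::finite) op \<Rightarrow> real" where
  "H_min \<rho> = - log 2 (Inf {Re (trace \<sigma>) | \<sigma>. psd \<sigma> \<and>
     loewner_le \<rho> (tensor_op (Finite_Cartesian_Product.mat 1) \<sigma>)})"

text \<open>The condition \<open>0 < t\<close> encodes \<open>log 0 = -\<infinity>\<close>, which never is the maximum for a nonzero state;
  the library's logarithm satisfies \<open>log 2 0 = 0\<close>.\<close>

definition H_max :: "('u::finite \<times> 'v::finite) op \<Rightarrow> real" where
  "H_max \<rho> = Sup {log 2 t | t \<sigma>. normalized_state \<sigma> \<and> 0 < t \<and>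
     t = real CARD('u) * (trace_norm (op_sqrt \<rho> **
         op_sqrt (tensor_op (Finite_Cartesian_Product.mat (1 / of_nat CARD('u))) \<sigma>)))\<^sup>2}"


section \<open>Indices\<close>

definition hashed_state ::
    "('n::len0 bits \<Rightarrow> 'm::len0 bits) \<Rightarrow> ('n bits \<times> 'e::finite) op \<Rightarrow> ('m bits \<times> 'e) op" where
  "hashed_state f \<rho>Z =
     (\<Sum>k\<in>UNIV. tensor_op (outer (ket_z k)) (\<Sum>z\<in>f -` {k}. conditional (ket_z z) \<rho>Z))"

definition Q_PA :: "('n::len0 bits \<Rightarrow> 'm::len0 bits) \<Rightarrow> ('n bits \<times> 'e::finite) op \<Rightarrow> real" where
  "Q_PA f \<rho>Z = Re (trace \<rho>Z) - 2 powr (H_max (hashed_state f \<rho>Z) - real LENGTH('m))"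

definition povm :: "('i::finite \<Rightarrow> 'b::finite op) \<Rightarrow> bool" where
  "povm M \<longleftrightarrow> (\<forall>i. psd (M i)) \<and> (\<Sum>i\<in>UNIV. M i) = Finite_Cartesian_Product.mat 1"

definition Q_EC :: "('n::len0 bits \<Rightarrow> 'l::len0 bits) \<Rightarrow> ('n bits \<times> 'b::finite) op \<Rightarrow> real" where
  "Q_EC g \<rho>X =
     Inf {\<Sum>x\<in>UNIV. \<Sum>e\<in>{e. x + e \<noteq> 0}. Re (trace (conditional (ket_x x) \<rho>X ** M (g x) e))
          | M :: 'l bits \<Rightarrow> 'n bits \<Rightarrow> 'b op. \<forall>s. povm (M s)}"

definition Q_DC :: "('n::len0 bits \<Rightarrow> 'l::len0 bits) \<Rightarrow> ('n bits \<times> 'b::finite) op \<Rightarrow> real" where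
  "Q_DC g \<rho>X =
     Inf {\<Sum>x\<in>UNIV. \<Sum>e\<in>{e. e \<noteq> x}. Re (trace (conditional (ket_x x) \<rho>X ** M (g x) e))
          | M :: 'l bits \<Rightarrow> 'n bits \<Rightarrow> 'b op. \<forall>s. povm (M s)}"

end

theory Submission
  imports Defs
begin

text \<open>
  Write the pure state as a family of operators \<open>\<Phi>\<^sub>z : E \<rightarrow> B\<close> (components in the \<open>z\<close> basis) or as its Fourier
  transform \<open>\<Phi>'\<^sub>x\<close> (components in the \<open>x\<close> basis), so that \<open>\<rho>\<^sup>z\<^sub>E = \<Phi>\<^sub>z\<^sup>* \<Phi>\<^sub>z\<close> and \<open>\<rho>\<^sup>x\<^sub>B\<close> is, up to
  transposition, \<open>\<Phi>'\<^sub>x \<Phi>'\<^sub>x\<^sup>*\<close>.  For dual \<open>f\<close> and \<open>g\<close> the largest probability of guessing \<open>x\<close> from \<open>g x\<close> and \<open>B\<close>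
  equals \<open>2\<^sup>-\<^sup>m\<close> times the maximum over \<open>\<sigma>\<close> of the squared sum over \<open>k\<close> of the fidelities of \<open>\<rho>\<^sup>k\<^sub>E\<close> and \<open>\<sigma>\<close>: by
  polar decomposition both sides are maxima over families of operators that are contractive on the
  fibres of \<open>g\<close> and \<open>f\<close>, and the Fourier transform, combined with the projections onto the mutually
  orthogonal ranges (or supports) provided by the standard form, turns one kind of family into the
  other.  This gives \<open>Q\<^sup>P\<^sup>A = Q\<^sup>D\<^sup>C\<close> for every dual pair.  The same identity with \<open>B\<close> and \<open>E\<close>, and the two
  bases, exchanged and with the dual pair of the identity and a constant, together with semidefinite
  duality for the guessing probability, gives \<open>H\<^sub>m\<^sub>i\<^sub>n = n - H\<^sub>m\<^sub>a\<^sub>x\<close>.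
\<close>

text \<open>The comparison of the two indices is an equality for each dual pair separately, so
  averaging is harmless and the function \<open>r\<close> may be arbitrary. The factor 2^m is the
  size of a fibre of \<open>g\<close>: summed over such a fibre, the squared norms of a Fourier
  transform keep only the correlations inside the fibres of \<open>f\<close>, multiplied by this
  size. The obstacle is that the given families are contractive on each fibre separately, not on the
  whole index set, while the Fourier transform mixes all fibres. The projections repair this: being
  mutually orthogonal, they obey Bessel's inequality, which adds up the fibrewise bounds without
  loss. They are available for only one of the two kinds of components and enter differently in the
  two cases, so each of the two inequalities is proved twice, by different families. Suprema and
  infima over states and POVMs are only compared, never shown to be attained, so no compactness of
  these sets is used.\<close>

no_notation vec_index (infixl "$" 100)
no_notation scalar_prod (infix "\<bullet>" 70)

abbreviation idm :: "'a::finite op" where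
  "idm \<equiv> Finite_Cartesian_Product.mat 1"

section \<open>Matrices with the Hilbert--Schmidt inner product\<close>

text \<open>\<open>adj\<close> exists for square operators only; the components of a tripartite pure
  state map one space to another.\<close>

definition hc :: "complex^'e::finite^'b::finite \<Rightarrow> complex^'b^'e" where
  "hc A = (\<chi> i j. cnj (A $ j $ i))"

lemma adj_eq_hc: "adj M = hc M"
  by (simp add: adj_def hc_def)

lemma hc_hc [simp]: "hc (hc A) = A"
  by (simp add: hc_def Finite_Cartesian_Product.vec_eq_iff)

lemma hc_mult: "hc (A ** B) = hc B ** hc A"
  by (simp add: hc_def matrix_matrix_mult_def Finite_Cartesian_Product.vec_eq_iff mult.commute)

lemma hc_linear: "linear hc"
  by (rule linearI) (simp_all add: hc_def Finite_Cartesian_Product.vec_eq_iff)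

lemmas hc_add = linear_add[OF hc_linear]
  and hc_diff = linear_diff[OF hc_linear]
  and hc_sum = linear_sum[OF hc_linear]
  and hc_scaleR = linear_scale[OF hc_linear]
  and hc_zero [simp] = linear_0[OF hc_linear]

lemma hc_one [simp]: "hc idm = idm"
  by (simp add: hc_def Finite_Cartesian_Product.vec_eq_iff Finite_Cartesian_Product.mat_def)

lemma bounded_bilinear_matrix_mult:
  "bounded_bilinear ((**) :: complex^'e::finite^'b::finite \<Rightarrow> complex^'d::finite^'e \<Rightarrow> complex^'d^'b)"
  unfolding bilinear_conv_bounded_bilinear[symmetric] bilinear_def
  by (auto intro!: linearI simp: matrix_matrix_mult_def Finite_Cartesian_Product.vec_eq_iff
      algebra_simps sum.distrib scaleR_sum_right sum_distrib_left)

lemma bounded_bilinear_matrix_vector_mult: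
  "bounded_bilinear ((*v) :: complex^'e::finite^'b::finite \<Rightarrow> complex^'e \<Rightarrow> complex^'b)"
  unfolding bilinear_conv_bounded_bilinear[symmetric] bilinear_def
  by (auto intro!: linearI simp: matrix_vector_mult_def Finite_Cartesian_Product.vec_eq_iff
      algebra_simps sum.distrib scaleR_sum_right sum_distrib_left)

interpretation mm: bounded_bilinear
  "(**) :: complex^'e::finite^'b::finite \<Rightarrow> complex^'d::finite^'e \<Rightarrow> complex^'d^'b"
  by (rule bounded_bilinear_matrix_mult)

interpretation mv: bounded_bilinear
  "(*v) :: complex^'e::finite^'b::finite \<Rightarrow> complex^'e \<Rightarrow> complex^'b"
  by (rule bounded_bilinear_matrix_vector_mult)

lemma inner_eq_Re_sum: "A \<bullet> B = Re (\<Sum>i\<in>UNIV. \<Sum>j\<in>UNIV. cnj (A $ i $ j) * B $ i $ j)"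
  for A :: "complex^'e::finite^'b::finite"
  by (simp add: inner_vec_def inner_complex_def)

lemma inner_vec_eq_Re_sum: "v \<bullet> w = Re (\<Sum>i\<in>UNIV. cnj (v $ i) * w $ i)"
  for v :: "complex^'b::finite"
  by (simp add: inner_vec_def inner_complex_def)

text \<open>The inner product of the underlying real Euclidean space is the real part of the
  Hilbert--Schmidt product. Overlaps below are therefore real, and Cauchy--Schwarz and separating
  hyperplanes apply as they stand.\<close>

lemma inner_eq_trace: "A \<bullet> B = Re (trace (hc A ** B))"
  for A :: "complex^'e::finite^'b::finite"
  unfolding inner_eq_Re_sum trace_def matrix_matrix_mult_def hc_def
  by (subst sum.swap) simp

lemma inner_hc_hc: "hc A \<bullet> hc B = A \<bullet> B"
  for A :: "complex^'e::finite^'b::finite"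
  unfolding inner_eq_Re_sum hc_def by (subst sum.swap) (simp add: mult.commute)

lemma inner_mult_left: "(A ** B) \<bullet> C = B \<bullet> (hc A ** C)"
  for A :: "complex^'e::finite^'b::finite"
  by (simp add: inner_eq_trace hc_mult matrix_mul_assoc)

lemma inner_mult_right: "(A ** B) \<bullet> C = A \<bullet> (C ** hc B)"
  for A :: "complex^'e::finite^'b::finite"
  using inner_mult_left[of "hc B" "hc A" "hc C"] inner_hc_hc
  by (metis hc_hc hc_mult)

lemma inner_one_left: "idm \<bullet> A = Re (trace A)"
  for A :: "'a::finite op"
  by (simp add: inner_eq_trace)

lemma inner_matrix_vector: "(A *v v) \<bullet> w = v \<bullet> (hc A *v w)"
  for A :: "complex^'e::finite^'b::finite"
proof -
  have "(\<Sum>i\<in>UNIV. cnj ((A *v v) $ i) * w $ i) = (\<Sum>i\<in>UNIV. \<Sum>j\<in>UNIV. cnj (v $ j) * (cnj (A $ i $ j) * w $ i))"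
    by (simp add: matrix_vector_mult_def sum_distrib_right sum_distrib_left mult_ac)
  also have "\<dots> = (\<Sum>j\<in>UNIV. cnj (v $ j) * (hc A *v w) $ j)"
    by (subst sum.swap) (simp add: matrix_vector_mult_def sum_distrib_left hc_def)
  finally show ?thesis
    unfolding inner_vec_eq_Re_sum by simp
qed

lemma inner_eq_sum_columns: "A \<bullet> B = (\<Sum>j\<in>UNIV. column j A \<bullet> column j B)"
  for A :: "complex^'e::finite^'b::finite"
  unfolding inner_vec_def column_def by (subst sum.swap) simp

lemma column_mult: "column j (A ** B) = A *v column j B"
  by (simp add: column_def matrix_matrix_mult_def matrix_vector_mult_def Finite_Cartesian_Product.vec_eq_iff)

lemma matrix_eqI_vec: "(\<And>v. A *v v = B *v v) \<Longrightarrow> A = B" for A :: "complex^'e::finite^'b::finite"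
  by (simp add: matrix_eq)

section \<open>Positive semidefinite operators\<close>

text \<open>Near \<open>t = 0\<close> the linear term dominates, so it must vanish: the
  first-variation argument without derivatives, used for minima and maxima of quadratic
  forms.\<close>

lemma quadratic_nonneg_linear_zero:
  fixes a b :: real
  assumes "\<And>t. 0 \<le> t\<^sup>2 * b - 2 * t * a"
  shows "a = 0"
proof (rule ccontr)
  assume "a \<noteq> 0"
  \<comment> \<open>\<open>K\<close> exceeds \<bar>b\<bar>, so that \<open>b < 2 * K\<close>
    whatever the sign of \<open>b\<close>; then \<open>t = a / K\<close> makes the expression
    negative.\<close>
  define K where "K = \<bar>b\<bar> + 1"
  have K: "K > 0" "b < 2 * K" by (auto simp: K_def)
  have "0 \<le> (a / K)\<^sup>2 * b - 2 * (a / K) * a"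
    by (rule assms)
  also have "\<dots> = (a / K)\<^sup>2 * (b - 2 * K)"
    using K by (simp add: field_simps power2_eq_square)
  also have "\<dots> < 0"
    using K \<open>a \<noteq> 0\<close> by (simp add: mult_pos_neg)
  finally show False by simp
qed

text \<open>The complex product, with real part \<open>\<bullet>\<close>. Realness of a form and
  complex orthogonality cannot be read off from a single real product.\<close>

definition cdot :: "complex^'a::finite \<Rightarrow> complex^'a \<Rightarrow> complex" where
  "cdot v w = (\<Sum>i\<in>UNIV. cnj (v $ i) * w $ i)"

lemma Re_cdot: "Re (cdot v w) = v \<bullet> w"
  by (simp add: cdot_def inner_vec_eq_Re_sum)

lemma cdot_matrix: "cdot v (A *v w) = cdot (hc A *v v) w"
proof -
  have "cdot v (A *v w) = (\<Sum>i\<in>UNIV. \<Sum>j\<in>UNIV. cnj (v $ i) * (A $ i $ j * w $ j))"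
    by (simp add: cdot_def matrix_vector_mult_def sum_distrib_left)
  also have "\<dots> = cdot (hc A *v v) w"
    by (subst sum.swap)
      (simp add: cdot_def matrix_vector_mult_def sum_distrib_right sum_distrib_left hc_def mult_ac)
  finally show ?thesis .
qed

lemma cdot_add_left: "cdot (v + v') w = cdot v w + cdot v' w"
  and cdot_add_right: "cdot v (w + w') = cdot v w + cdot v w'"
  and cdot_diff_right: "cdot v (w - w') = cdot v w - cdot v w'"
  and cdot_cscale_left: "cdot (c *s v) w = cnj c * cdot v w"
  and cdot_cscale_right: "cdot v (c *s w) = c * cdot v w"
  and cdot_scaleR_right: "cdot v (r *\<^sub>R w) = r * cdot v w"
  and cdot_scaleR_left: "cdot (r *\<^sub>R v) w = r * cdot v w"
  by (simp_all add: cdot_def algebra_simps sum.distrib sum_subtractf sum_distrib_left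
      scaleR_conv_of_real[where 'a = complex])

lemma cdot_commute: "cdot v w = cnj (cdot w v)"
  by (simp add: cdot_def mult.commute)

lemma cdot_self: "cdot v v = complex_of_real ((norm v)\<^sup>2)"
proof -
  have "Im (cdot v v) = 0"
    using cdot_commute[of v v] by (metis complex_cnj_cancel_iff Im_complex_of_real Reals_cnj_iff complex_is_Real_iff)
  then show ?thesis
    by (simp add: complex_eq_iff Re_cdot power2_norm_eq_inner)
qed

lemma cdot_eq_zero_all: "(\<And>w. cdot w v = 0) \<Longrightarrow> v = 0"
  using cdot_self[of v] by auto

lemma psd_form: "psd M \<longleftrightarrow> (\<forall>v. cdot v (M *v v) \<in> \<real>\<^sub>\<ge>\<^sub>0)"
  unfolding psd_def cdot_def
  by (simp add: matrix_vector_mult_def sum_distrib_left mult.assoc)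

text \<open>Hermiticity comes from polarization: the form of \<open>K = M - hc M\<close> vanishes on
  every vector, hence on sums, and over the complex numbers this forces
  \<open>K = 0\<close>.\<close>

lemma psd_iff: "psd M \<longleftrightarrow> hc M = M \<and> (\<forall>v. 0 \<le> v \<bullet> (M *v v))"
proof
  assume L: "psd M"
  define K where "K = M - hc M"
  have q: "cdot v (K *v v) = 0" for v
  proof -
    have "cdot v (M *v v) \<in> \<real>"
      using L psd_form nonneg_Reals_subset_Reals by blast
    moreover have "cdot v (hc M *v v) = cnj (cdot v (M *v v))"
      using cdot_matrix[of v "hc M" v] cdot_commute[of "M *v v" v] by simp
    ultimately show ?thesis
      by (simp add: K_def mv.diff_left cdot_diff_right Reals_cnj_iff)
  qed
  have "cdot v (K *v w) = 0" for v w
  proof -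
    have 1: "cdot v (K *v w) + cdot w (K *v v) = 0" for w
      using q[of "v + w"] q[of v] q[of w]
      by (simp add: mv.add_right cdot_add_left cdot_add_right add.commute)
    \<comment> \<open>Replacing \<open>w\<close> by \<open>\<i> *s w\<close> turns the sum of the
      two cross terms into a multiple of their difference, so both vanish.\<close>
    have "\<i> * (cdot v (K *v w) - cdot w (K *v v)) = 0"
      using 1[of "\<i> *s w"]
      by (simp add: vector_scalar_commute cdot_cscale_left cdot_cscale_right algebra_simps)
    with 1[of w] show ?thesis by simp
  qed
  then have "K *v w = 0" for w
    by (rule cdot_eq_zero_all)
  then have "K = 0"
    by (intro matrix_eqI_vec) simp
  moreover have "0 \<le> v \<bullet> (M *v v)" for v
    using L[unfolded psd_form] Re_cdot by (metis complex_nonneg_Reals_iff)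
  ultimately show "hc M = M \<and> (\<forall>v. 0 \<le> v \<bullet> (M *v v))"
    by (simp add: K_def)
next
  assume R: "hc M = M \<and> (\<forall>v. 0 \<le> v \<bullet> (M *v v))"
  show "psd M"
    unfolding psd_form
  proof
    fix v
    have "cdot v (M *v v) = cnj (cdot v (M *v v))"
      using cdot_matrix[of v M v] cdot_commute[of "M *v v" v] R by simp
    then have "Im (cdot v (M *v v)) = 0"
      by (metis Reals_cnj_iff complex_is_Real_iff)
    then show "cdot v (M *v v) \<in> \<real>\<^sub>\<ge>\<^sub>0"
      using R by (simp add: Re_cdot complex_nonneg_Reals_iff)
  qed
qed

lemma psd_hermitian: "psd M \<Longrightarrow> hc M = M"
  and psd_form_nonneg: "psd M \<Longrightarrow> 0 \<le> v \<bullet> (M *v v)"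
  by (simp_all add: psd_iff)

lemma norm_matrix_vector_sq: "(norm (A *v v))\<^sup>2 = v \<bullet> ((hc A ** A) *v v)"
  for A :: "complex^'e::finite^'b::finite"
  by (simp add: power2_norm_eq_inner inner_matrix_vector matrix_vector_mul_assoc)

lemma psd_hc_mult: "psd (hc A ** A)" for A :: "complex^'e::finite^'b::finite"
  unfolding psd_iff norm_matrix_vector_sq[symmetric] by (simp add: hc_mult)

lemma psd_add: "psd A \<Longrightarrow> psd B \<Longrightarrow> psd (A + B)"
  by (simp add: psd_iff hc_add mv.add_left inner_add_right)

lemma psd_zero [simp]: "psd 0"
  by (simp add: psd_iff)

lemma psd_one [simp]: "psd idm"
  by (simp add: psd_iff)

lemma psd_sum: "(\<And>i. i \<in> I \<Longrightarrow> psd (A i)) \<Longrightarrow> psd (\<Sum>i\<in>I. A i)"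
  by (induction I rule: infinite_finite_induct) (auto intro: psd_add)

lemma psd_scaleR: "0 \<le> r \<Longrightarrow> psd A \<Longrightarrow> psd (r *\<^sub>R A)"
  by (simp add: psd_iff hc_scaleR mv.scaleR_left)

lemma psd_conj: "psd M \<Longrightarrow> psd (hc A ** M ** A)" for A :: "complex^'e::finite^'b::finite"
  unfolding psd_iff
  by (auto simp: hc_mult matrix_mul_assoc matrix_vector_mul_assoc[symmetric])
    (metis hc_hc inner_matrix_vector)

lemma psd_inner_conj_nonneg: "psd M \<Longrightarrow> 0 \<le> X \<bullet> (M ** X)" for X :: "complex^'e::finite^'b::finite"
  unfolding inner_eq_sum_columns column_mult
  by (intro sum_nonneg psd_form_nonneg)

text \<open>\<open>v\<close> minimizes the form, so the first variation in the direction
  \<open>M *v v\<close> vanishes; it is a multiple of the squared norm of that vector.\<close>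

lemma psd_form_zero:
  assumes "psd M" "v \<bullet> (M *v v) = 0"
  shows "M *v v = 0"
proof -
  define w where "w = M *v v"
  have h: "(M *v x) \<bullet> y = x \<bullet> (M *v y)" for x y
    using inner_matrix_vector[of M] psd_hermitian[OF assms(1)] by simp
  have "0 \<le> t\<^sup>2 * (w \<bullet> (M *v w)) - 2 * t * (w \<bullet> w)" for t
  proof -
    have "0 \<le> (v - t *\<^sub>R w) \<bullet> (M *v (v - t *\<^sub>R w))"
      using assms(1) by (rule psd_form_nonneg)
    also have "\<dots> = t\<^sup>2 * (w \<bullet> (M *v w)) - 2 * t * (w \<bullet> w)"
      using assms(2) h[of w v] h[of v w]
      by (simp add: mv.diff_right mv.scaleR_right inner_diff_left inner_diff_right
          power2_eq_square w_def[symmetric] inner_commute algebra_simps)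
    finally show ?thesis .
  qed
  then have "w \<bullet> w = 0"
    by (rule quadratic_nonneg_linear_zero)
  then show ?thesis by (simp add: w_def)
qed

lemma psd_inner_conj_zero:
  assumes "psd M" "X \<bullet> (M ** X) = 0"
  shows "M ** X = 0"
proof -
  have "column j X \<bullet> (M *v column j X) = 0" for j
    using assms sum_nonneg_eq_0_iff[of UNIV "\<lambda>j. column j X \<bullet> (M *v column j X)"]
    unfolding inner_eq_sum_columns column_mult by (simp add: psd_form_nonneg)
  then have "column j (M ** X) = 0" for j
    unfolding column_mult by (rule psd_form_zero[OF assms(1)])
  then show ?thesis
    by (simp add: column_def Finite_Cartesian_Product.vec_eq_iff)
qed

section \<open>Spectral theorem, square roots and pseudo-inverses\<close>

text \<open>Complex orthogonality to \<open>b\<close> is real orthogonality to \<open>b\<close> and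
  to \<open>\<i> *s b\<close>; fewer than \<open>2 * CARD('a)\<close> vectors cannot span the real
  space of that dimension.\<close>

lemma orthogonal_complement_nonzero:
  fixes B :: "(complex^'a::finite) set"
  assumes "finite B" "card B < CARD('a)"
  obtains x where "x \<noteq> 0" "\<And>b. b \<in> B \<Longrightarrow> cdot b x = 0"
proof -
  let ?C = "B \<union> (\<lambda>b. \<i> *s b) ` B"
  have "card ?C \<le> card B + card B"
    using card_Un_le[of B "(\<lambda>b. \<i> *s b) ` B"] card_image_le[OF assms(1), of "\<lambda>b. \<i> *s b"] by linarith
  then have "dim ?C < DIM(complex^'a)"
    using dim_le_card'[of ?C] assms by simp
  then obtain x where x: "x \<noteq> 0" "\<And>y. y \<in> span ?C \<Longrightarrow> real_inner_class.orthogonal x y"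
    using orthogonal_to_subspace_exists by blast
  have "cdot b x = 0" if "b \<in> B" for b
  proof -
    have "Re (cdot b x) = 0" "Re (cdot (\<i> *s b) x) = 0"
      using that x(2)[of b] x(2)[of "\<i> *s b"]
      by (auto simp: Re_cdot real_inner_class.orthogonal_def inner_commute span_base)
    then show ?thesis
      by (simp add: cdot_cscale_left complex_eq_iff)
  qed
  with x(1) show ?thesis by (rule that)
qed

text \<open>The Rayleigh quotient has a maximizer \<open>u\<close> on the unit sphere of the
  complement of \<open>B\<close>, which \<open>M\<close> preserves because \<open>B\<close> consists
  of eigenvectors. The first variation at \<open>u\<close> in the direction of the residual
  \<open>w\<close> gives the eigenvalue equation.\<close>

lemma hermitian_eigenvector:
  fixes M :: "'a::finite op"
  assumes M: "hc M = M" and "finite B" "card B < CARD('a)"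
    and ev: "\<And>b. b \<in> B \<Longrightarrow> \<exists>l::real. M *v b = l *\<^sub>R b"
  obtains u l where "norm u = 1" "M *v u = l *\<^sub>R u" "\<And>b. b \<in> B \<Longrightarrow> cdot b u = 0"
proof -
  define S where "S = {v. \<forall>b\<in>B. cdot b v = 0}"
  have S_lin: "v + w \<in> S" "r *\<^sub>R v \<in> S" "v - w \<in> S" if "v \<in> S" "w \<in> S" for v w and r :: real
    using that by (auto simp: S_def cdot_add_right cdot_scaleR_right cdot_diff_right)
  have S_M: "M *v v \<in> S" if "v \<in> S" for v
    unfolding S_def
  proof safe
    fix b assume "b \<in> B"
    then obtain l :: real where "M *v b = l *\<^sub>R b" using ev by blast
    then show "cdot b (M *v v) = 0"
      using that \<open>b \<in> B\<close> M by (simp add: cdot_matrix cdot_scaleR_left S_def)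
  qed
  have "continuous_on UNIV (\<lambda>v. cdot b v)" for b :: "complex^'a"
    unfolding cdot_def by (intro continuous_intros)
  then have "closed S"
    unfolding S_def Collect_ball_eq by (intro closed_INT ballI closed_Collect_eq) auto
  then have comp: "compact (S \<inter> sphere 0 1)"
    by (intro closed_Int_compact compact_sphere)
  obtain x where x: "x \<noteq> 0" "\<And>b. b \<in> B \<Longrightarrow> cdot b x = 0"
    using orthogonal_complement_nonzero[OF assms(2,3)] by blast
  have "(1 / norm x) *\<^sub>R x \<in> S \<inter> sphere 0 1"
    using x by (simp add: S_def cdot_scaleR_right)
  then have ne: "S \<inter> sphere 0 1 \<noteq> {}" by blast
  have "continuous_on (S \<inter> sphere 0 1) (\<lambda>v. v \<bullet> (M *v v))"
    by (intro continuous_intros mv.continuous_on)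
  from continuous_attains_sup[OF comp ne this] obtain u
    where u: "u \<in> S" "norm u = 1"
      and max: "\<And>v. v \<in> S \<Longrightarrow> norm v = 1 \<Longrightarrow> v \<bullet> (M *v v) \<le> u \<bullet> (M *v u)"
    by auto
  define l where "l = u \<bullet> (M *v u)"
  have h: "(M *v x) \<bullet> y = x \<bullet> (M *v y)" for x y
    using inner_matrix_vector[of M] M by simp
  have bound: "v \<bullet> (M *v v) \<le> l * (v \<bullet> v)" if "v \<in> S" for v
  proof (cases "v = 0")
    case False
    then have "((1 / norm v) *\<^sub>R v) \<bullet> (M *v ((1 / norm v) *\<^sub>R v)) \<le> l"
      unfolding l_def using that S_lin by (intro max) auto
    then show ?thesis
      using False by (simp add: mv.scaleR_right field_simps power2_norm_eq_inner[symmetric] power2_eq_square)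
  qed simp
  define w where "w = l *\<^sub>R u - M *v u"
  have w: "w \<in> S"
    using u S_lin S_M by (simp add: w_def)
  have "0 \<le> t\<^sup>2 * (l * (w \<bullet> w) - w \<bullet> (M *v w)) - 2 * t * (w \<bullet> w)" for t
  proof -
    have "0 \<le> l * ((u - t *\<^sub>R w) \<bullet> (u - t *\<^sub>R w)) - (u - t *\<^sub>R w) \<bullet> (M *v (u - t *\<^sub>R w))"
      using bound[of "u - t *\<^sub>R w"] S_lin u w by simp
    also have "\<dots> = t\<^sup>2 * (l * (w \<bullet> w) - w \<bullet> (M *v w)) - 2 * t * (w \<bullet> (l *\<^sub>R u - M *v u))"
    proof -
      have "u \<bullet> u = 1" using u(2) by (simp add: power2_norm_eq_inner[symmetric])
      moreover have "u \<bullet> (M *v w) = w \<bullet> (M *v u)" using h[of u w] by (simp add: inner_commute)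
      ultimately show ?thesis
        by (simp add: mv.diff_right mv.scaleR_right inner_diff_left inner_diff_right
          power2_eq_square inner_commute[of u w] l_def[symmetric] algebra_simps)
    qed
    finally show ?thesis by (simp add: w_def)
  qed
  then have "w \<bullet> w = 0"
    by (rule quadratic_nonneg_linear_zero)
  then have "M *v u = l *\<^sub>R u"
    by (simp add: w_def)
  then show ?thesis
    using u by (intro that) (auto simp: S_def)
qed

lemma hermitian_eigenbasis:
  fixes M :: "'a::finite op"
  assumes M: "hc M = M"
  obtains B where "finite B" "card B = CARD('a)"
    "\<And>b b'. b \<in> B \<Longrightarrow> b' \<in> B \<Longrightarrow> cdot b b' = (if b = b' then 1 else 0)"
    "\<And>b. b \<in> B \<Longrightarrow> \<exists>l::real. M *v b = l *\<^sub>R b"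
proof -
  have "\<exists>B. finite B \<and> card B = k \<and> (\<forall>b\<in>B. \<forall>b'\<in>B. cdot b b' = (if b = b' then 1 else 0)) \<and>
      (\<forall>b\<in>B. \<exists>l::real. M *v b = l *\<^sub>R b)" if "k \<le> CARD('a)" for k
    using that
  proof (induction k)
    case 0
    then show ?case by (intro exI[of _ "{}"]) auto
  next
    case (Suc k)
    then obtain B where B: "finite B" "card B = k" "\<forall>b\<in>B. \<forall>b'\<in>B. cdot b b' = (if b = b' then 1 else 0)"
      "\<forall>b\<in>B. \<exists>l::real. M *v b = l *\<^sub>R b" by auto
    obtain u l where u: "norm u = 1" "M *v u = l *\<^sub>R u" "\<And>b. b \<in> B \<Longrightarrow> cdot b u = 0"
      using hermitian_eigenvector[OF M B(1)] B Suc.prems by (metis Suc_le_lessD)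
    have "u \<notin> B" using u cdot_self[of u] by auto
    moreover have "cdot u b = 0" if "b \<in> B" for b
      using u(3)[OF that] cdot_commute[of u b] by simp
    ultimately show ?case
      using B u by (intro exI[of _ "insert u B"]) (auto simp: cdot_self)
  qed
  from this[of "CARD('a)"] that show ?thesis by blast
qed

definition diag_op :: "('a::finite \<Rightarrow> real) \<Rightarrow> 'a op" where
  "diag_op d = (\<chi> i j. if i = j then complex_of_real (d i) else 0)"

lemma diag_op_mult: "diag_op d ** diag_op e = diag_op (\<lambda>i. d i * e i)"
  by (simp add: diag_op_def matrix_matrix_mult_def Finite_Cartesian_Product.vec_eq_iff
      if_distrib[of "\<lambda>x. x * _"] cong: if_cong)

lemma hc_diag_op [simp]: "hc (diag_op d) = diag_op d"
  by (simp add: hc_def diag_op_def Finite_Cartesian_Product.vec_eq_iff)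

lemma psd_diag_op: "(\<And>i. 0 \<le> d i) \<Longrightarrow> psd (diag_op d)"
  using psd_hc_mult[of "diag_op (\<lambda>i. sqrt (d i))"] by (simp add: diag_op_mult)

lemma spectral_theorem:
  fixes M :: "'a::finite op"
  assumes M: "hc M = M"
  obtains U :: "'a op" and d where "hc U ** U = idm" "U ** hc U = idm" "M = U ** diag_op d ** hc U"
proof -
  obtain B where B: "finite B" "card B = CARD('a)"
    "\<And>b b'. b \<in> B \<Longrightarrow> b' \<in> B \<Longrightarrow> cdot b b' = (if b = b' then 1 else 0)"
    "\<And>b. b \<in> B \<Longrightarrow> \<exists>l::real. M *v b = l *\<^sub>R b"
    using hermitian_eigenbasis[OF M] by blast
  obtain u :: "'a \<Rightarrow> complex^'a" where u: "bij_betw u UNIV B"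
    using B(1,2) finite_same_card_bij[of "UNIV :: 'a set" B] by auto
  have uB: "u i \<in> B" for i using u by (auto simp: bij_betw_def)
  have ui: "u i = u j \<longleftrightarrow> i = j" for i j using u by (auto simp: bij_betw_def inj_on_def)
  obtain d :: "'a \<Rightarrow> real" where d: "\<And>i. M *v u i = d i *\<^sub>R u i"
    using B(4)[OF uB] by metis
  define U :: "'a op" where "U = (\<chi> a i. u i $ a)"
  have U1: "hc U ** U = idm"
    using B(3)[OF uB uB] ui
    by (simp add: U_def hc_def matrix_matrix_mult_def Finite_Cartesian_Product.vec_eq_iff
        Finite_Cartesian_Product.mat_def cdot_def)
  then have U2: "U ** hc U = idm"
    using matrix_left_right_inverse by blast
  have "M ** U = U ** diag_op d"
    using d
    by (simp add: U_def diag_op_def matrix_matrix_mult_def matrix_vector_mult_def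
        Finite_Cartesian_Product.vec_eq_iff scaleR_conv_of_real[where 'a = complex] mult.commute
        if_distrib[of "\<lambda>x. _ * x"] cong: if_cong)
  then have "M ** (U ** hc U) = U ** diag_op d ** hc U"
    by (simp add: matrix_mul_assoc)
  then have "M = U ** diag_op d ** hc U" by (simp add: U2)
  with U1 U2 show ?thesis by (rule that)
qed

lemma psd_spectral:
  fixes M :: "'a::finite op"
  assumes "psd M"
  obtains U :: "'a op" and d where "hc U ** U = idm" "U ** hc U = idm" "M = U ** diag_op d ** hc U" "\<And>i. 0 \<le> d i"
proof -
  obtain U :: "'a op" and d where U: "hc U ** U = idm" "U ** hc U = idm" and M: "M = U ** diag_op d ** hc U"
    using spectral_theorem[OF psd_hermitian[OF assms]] .
  have "diag_op d = hc U ** M ** U"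
    unfolding M by (metis U(1) matrix_mul_assoc matrix_mul_lid matrix_mul_rid)
  then have "psd (diag_op d)"
    using psd_conj[OF assms] by simp
  then have "0 \<le> axis i 1 \<bullet> (diag_op d *v axis i 1)" for i
    by (rule psd_form_nonneg)
  then have "0 \<le> d i" for i
    by (simp add: inner_vec_eq_Re_sum diag_op_def matrix_vector_mult_def axis_def
        if_distrib[of "\<lambda>x. _ * x"] if_distrib[of cnj] if_distrib[of "\<lambda>x. x * _"] cong: if_cong)
  then show ?thesis using U M that by blast
qed

lemma psd_sqrt_exists:
  fixes M :: "'a::finite op"
  assumes "psd M" obtains R where "psd R" "R ** R = M"
proof -
  obtain U :: "'a op" and d where U: "hc U ** U = idm" "U ** hc U = idm" "M = U ** diag_op d ** hc U" "\<And>i. 0 \<le> d i"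
    using psd_spectral[OF assms] by blast
  let ?R = "U ** diag_op (\<lambda>i. sqrt (d i)) ** hc U"
  have "?R ** ?R = U ** (diag_op (\<lambda>i. sqrt (d i)) ** (hc U ** U) ** diag_op (\<lambda>i. sqrt (d i))) ** hc U"
    by (simp add: matrix_mul_assoc)
  also have "\<dots> = M"
    using U by (simp add: diag_op_mult)
  finally have "?R ** ?R = M" .
  moreover have "psd ?R"
    using psd_conj[OF psd_diag_op, of "\<lambda>i. sqrt (d i)" "hc U"] U(4) by simp
  ultimately show ?thesis by (rule that[rotated])
qed

text \<open>For \<open>D = R - S\<close>, equality of the squares gives
  \<open>(R + S) ** D + D ** (R + S) = 0\<close>. Its pairing with \<open>D\<close> is twice the sum
  of two nonnegative forms, so \<open>R ** D\<close> and \<open>S ** D\<close> vanish.\<close>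

lemma psd_sqrt_unique:
  assumes "psd R" "psd S" "R ** R = S ** S"
  shows "R = S"
proof -
  define D where "D = R - S"
  have "D \<bullet> ((R + S) ** D) + D \<bullet> (D ** (R + S)) = 0"
  proof -
    have "(R + S) ** D + D ** (R + S) = 0"
      using assms(3) by (simp add: D_def mm.diff_right mm.diff_left mm.add_left mm.add_right)
    then show ?thesis by (metis inner_add_right inner_zero_right)
  qed
  moreover have hD: "hc D = D"
    using assms(1,2) by (simp add: D_def hc_diff psd_hermitian)
  have hT: "hc (R + S) = R + S"
    using assms(1,2) by (simp add: hc_add psd_hermitian)
  have "D \<bullet> (D ** (R + S)) = D \<bullet> ((R + S) ** D)"
    using inner_hc_hc[of D "D ** (R + S)"] by (simp add: hc_mult hD hT)
  ultimately have "D \<bullet> (R ** D) + D \<bullet> (S ** D) = 0"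
    by (simp add: mm.add_left inner_add_right)
  then have "D \<bullet> (R ** D) = 0" "D \<bullet> (S ** D) = 0"
    using psd_inner_conj_nonneg[OF assms(1), of D] psd_inner_conj_nonneg[OF assms(2), of D] by linarith+
  then have "R ** D = 0" "S ** D = 0"
    using assms(1,2) psd_inner_conj_zero by blast+
  then have "D ** D = 0"
    by (metis D_def mm.diff_left diff_zero)
  then have "D \<bullet> D = 0"
    using inner_mult_left[of D idm D] hD by simp
  then show ?thesis by (simp add: D_def)
qed

lemma op_sqrt_unique: "psd R \<Longrightarrow> R ** R = M \<Longrightarrow> op_sqrt M = R"
  unfolding op_sqrt_def by (rule the_equality) (auto intro: psd_sqrt_unique)

lemma psd_op_sqrt: "psd M \<Longrightarrow> psd (op_sqrt M)"
  and op_sqrt_square: "psd M \<Longrightarrow> op_sqrt M ** op_sqrt M = M"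
  using psd_sqrt_exists op_sqrt_unique by metis+

lemma hc_op_sqrt: "psd M \<Longrightarrow> hc (op_sqrt M) = op_sqrt M"
  by (simp add: psd_op_sqrt psd_hermitian)

lemma psd_pseudo_inverse:
  fixes R :: "'a::finite op"
  assumes "psd R"
  obtains P where "hc P = P" "R ** P = P ** R" "R ** P ** R = R" "P ** R ** P = P"
proof -
  obtain U :: "'a op" and d where U: "hc U ** U = idm" "U ** hc U = idm" "R = U ** diag_op d ** hc U" "\<And>i. 0 \<le> d i"
    using psd_spectral[OF assms] by blast
  \<comment> \<open>With \<open>inverse 0 = 0\<close> this is the Moore--Penrose inverse, also for
    singular \<open>R\<close>.\<close>
  define P where "P = U ** diag_op (\<lambda>i. inverse (d i)) ** hc U"
  have conj: "(U ** diag_op e ** hc U) ** (U ** diag_op e' ** hc U) = U ** diag_op (\<lambda>i. e i * e' i) ** hc U"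
    for e e'
  proof -
    have "(U ** diag_op e ** hc U) ** (U ** diag_op e' ** hc U)
        = U ** (diag_op e ** (hc U ** U) ** diag_op e') ** hc U"
      by (simp add: matrix_mul_assoc)
    then show ?thesis by (simp add: U(1) diag_op_mult)
  qed
  have cancel: "d i * (d i * inverse (d i)) = d i" "inverse (d i) * (d i * inverse (d i)) = inverse (d i)" for i
    by (cases "d i = 0"; simp)+
  then show ?thesis
    by (intro that[of P])
      (simp_all add: P_def U(3) conj mult.commute cancel, simp add: hc_mult matrix_mul_assoc)
qed

definition pinv :: "'a::finite op \<Rightarrow> 'a op" where
  "pinv R = (SOME P. hc P = P \<and> R ** P = P ** R \<and> R ** P ** R = R \<and> P ** R ** P = P)"

lemma
  assumes "psd R"
  shows hc_pinv: "hc (pinv R) = pinv R" and pinv_commute: "R ** pinv R = pinv R ** R"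
    and mult_pinv_mult: "R ** pinv R ** R = R" and pinv_mult_pinv: "pinv R ** R ** pinv R = pinv R"
proof -
  have "\<exists>P. hc P = P \<and> R ** P = P ** R \<and> R ** P ** R = R \<and> P ** R ** P = P"
    using psd_pseudo_inverse[OF assms] by metis
  from someI_ex[OF this] show "hc (pinv R) = pinv R" "R ** pinv R = pinv R ** R"
    "R ** pinv R ** R = R" "pinv R ** R ** pinv R = pinv R"
    by (auto simp: pinv_def)
qed

section \<open>Families of contractions\<close>

text \<open>The block column formed by the \<open>U i\<close> is a contraction.\<close>

definition contractive :: "'i set \<Rightarrow> ('i \<Rightarrow> complex^'e::finite^'b::finite) \<Rightarrow> bool" where
  "contractive I U \<longleftrightarrow> (\<forall>v. (\<Sum>i\<in>I. (norm (U i *v v))\<^sup>2) \<le> (norm v)\<^sup>2)"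

lemma contractiveD: "contractive I U \<Longrightarrow> (\<Sum>i\<in>I. (norm (U i *v v))\<^sup>2) \<le> (norm v)\<^sup>2"
  by (simp add: contractive_def)

lemma contractive_cong: "(\<And>i. i \<in> I \<Longrightarrow> U i = V i) \<Longrightarrow> contractive I U \<longleftrightarrow> contractive I V"
  unfolding contractive_def by (simp cong: sum.cong)

lemma inner_le_half_squares: "x \<bullet> y \<le> ((norm x)\<^sup>2 + (norm y)\<^sup>2) / 2" for x y :: "'v::real_inner"
proof -
  have "0 \<le> (x - y) \<bullet> (x - y)" by simp
  then show ?thesis
    by (simp add: power2_norm_eq_inner inner_diff_left inner_diff_right inner_commute)
qed

lemma sum_inner_le_half_squares:
  fixes x y :: "'i \<Rightarrow> 'v::real_inner"
  shows "(\<Sum>i\<in>I. x i \<bullet> y i) \<le> ((\<Sum>i\<in>I. (norm (x i))\<^sup>2) + (\<Sum>i\<in>I. (norm (y i))\<^sup>2)) / 2"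
  unfolding sum.distrib[symmetric] sum_divide_distrib by (intro sum_mono inner_le_half_squares)

text \<open>Contractivity passes to the adjoint, a block row. Bounding an inner product by half the
  sum of two squares does the work of the operator norm, in both directions.\<close>

lemma contractive_row:
  fixes U :: "'i \<Rightarrow> complex^'e::finite^'b::finite"
  shows "contractive I U \<longleftrightarrow> (\<forall>b. (norm (\<Sum>i\<in>I. hc (U i) *v b i))\<^sup>2 \<le> (\<Sum>i\<in>I. (norm (b i))\<^sup>2))"
proof
  assume L: "contractive I U"
  show "\<forall>b. (norm (\<Sum>i\<in>I. hc (U i) *v b i))\<^sup>2 \<le> (\<Sum>i\<in>I. (norm (b i))\<^sup>2)"
  proof
    fix b
    define y where "y = (\<Sum>i\<in>I. hc (U i) *v b i)"
    have "(norm y)\<^sup>2 = (\<Sum>i\<in>I. b i \<bullet> (U i *v y))"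
      unfolding power2_norm_eq_inner by (subst y_def) (simp add: inner_sum_left inner_matrix_vector)
    with sum_inner_le_half_squares[of b "\<lambda>i. U i *v y" I] contractiveD[OF L, of y]
    have "(norm y)\<^sup>2 \<le> (\<Sum>i\<in>I. (norm (b i))\<^sup>2)" by simp
    then show "(norm (\<Sum>i\<in>I. hc (U i) *v b i))\<^sup>2 \<le> (\<Sum>i\<in>I. (norm (b i))\<^sup>2)"
      by (simp add: y_def)
  qed
next
  assume R: "\<forall>b. (norm (\<Sum>i\<in>I. hc (U i) *v b i))\<^sup>2 \<le> (\<Sum>i\<in>I. (norm (b i))\<^sup>2)"
  show "contractive I U"
    unfolding contractive_def
  proof
    fix v
    define y where "y = (\<Sum>i\<in>I. hc (U i) *v (U i *v v))"
    have "(\<Sum>i\<in>I. (norm (U i *v v))\<^sup>2) = v \<bullet> y"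
      by (simp add: y_def power2_norm_eq_inner inner_sum_right inner_matrix_vector)
    with inner_le_half_squares[of v y] R[rule_format, of "\<lambda>i. U i *v v"]
    show "(\<Sum>i\<in>I. (norm (U i *v v))\<^sup>2) \<le> (norm v)\<^sup>2"
      by (simp add: y_def)
  qed
qed

lemma norm_sq_sum_columns: "(norm A)\<^sup>2 = (\<Sum>j\<in>UNIV. (norm (column j A))\<^sup>2)"
  for A :: "complex^'e::finite^'b::finite"
  by (simp add: power2_norm_eq_inner inner_eq_sum_columns)

lemma contractive_norm_mult:
  fixes U :: "'i \<Rightarrow> complex^'e::finite^'b::finite" and A :: "complex^'d::finite^'e"
  assumes "contractive I U"
  shows "(\<Sum>i\<in>I. (norm (U i ** A))\<^sup>2) \<le> (norm A)\<^sup>2"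
  unfolding norm_sq_sum_columns column_mult
  by (subst sum.swap) (intro sum_mono contractiveD assms)

lemma contractive_comp:
  assumes "contractive I U" "\<And>v. norm (W *v v) \<le> norm v"
  shows "contractive I (\<lambda>i. U i ** W)"
  unfolding contractive_def matrix_vector_mul_assoc[symmetric]
proof
  fix v
  have "(norm (W *v v))\<^sup>2 \<le> (norm v)\<^sup>2"
    using assms(2) by (simp add: power_mono)
  with contractiveD[OF assms(1)] show "(\<Sum>i\<in>I. (norm (U i *v (W *v v)))\<^sup>2) \<le> (norm v)\<^sup>2"
    by (rule order_trans)
qed

lemma norm_hc: "norm (hc A) = norm A"
  by (simp add: norm_eq_sqrt_inner inner_hc_hc)

lemma hc_mult_eq_zeroD:
  fixes A :: "complex^'e::finite^'b::finite"
  assumes "hc A ** A ** B = 0" shows "A ** B = 0"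
proof -
  have "(A ** B) \<bullet> (A ** B) = B \<bullet> (hc A ** A ** B)"
    by (simp add: inner_mult_left matrix_mul_assoc)
  then show ?thesis using assms by simp
qed

lemma norm_projection_le:
  assumes "hc P = P" "P ** P = P" shows "norm (P *v v) \<le> norm v"
proof -
  have "(norm (P *v v))\<^sup>2 = v \<bullet> (P *v v)"
    unfolding norm_matrix_vector_sq assms ..
  with inner_le_half_squares[of v "P *v v"] have "(norm (P *v v))\<^sup>2 \<le> (norm v)\<^sup>2" by simp
  then show ?thesis by (rule power2_le_imp_le) simp
qed

text \<open>The orthogonal projection onto the range of \<open>A\<close>: the least-squares formula,
  with the pseudo-inverse of the Gram matrix in place of its inverse.\<close>

definition range_proj :: "complex^'e::finite^'b::finite \<Rightarrow> 'b op" where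
  "range_proj A = A ** pinv (hc A ** A) ** hc A"

lemma hc_range_proj: "hc (range_proj A) = range_proj A"
  by (simp add: range_proj_def hc_mult hc_pinv psd_hc_mult matrix_mul_assoc)

lemma range_proj_mult: "range_proj A ** A = A"
proof -
  let ?G = "hc A ** A"
  have "?G ** (pinv ?G ** ?G - idm) = 0"
    using mult_pinv_mult[OF psd_hc_mult, of A] by (simp add: mm.diff_right matrix_mul_assoc)
  then have "A ** (pinv ?G ** ?G - idm) = 0"
    by (rule hc_mult_eq_zeroD)
  then show ?thesis
    by (simp add: range_proj_def mm.diff_right matrix_mul_assoc)
qed

lemma range_proj_idem: "range_proj A ** range_proj A = range_proj A"
proof -
  have "range_proj A ** range_proj A = (range_proj A ** A) ** (pinv (hc A ** A) ** hc A)"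
    by (simp add: range_proj_def matrix_mul_assoc)
  then show ?thesis
    unfolding range_proj_mult by (simp add: range_proj_def matrix_mul_assoc)
qed

lemma range_proj_orthogonal: "hc A ** B = 0 \<Longrightarrow> range_proj A ** B = 0"
  by (simp add: range_proj_def matrix_mul_assoc[symmetric])

text \<open>Bessel's inequality. For \<open>y\<close>, the sum of all \<open>P i *v v\<close>, both
  the left-hand side and the squared norm of \<open>y\<close> equal \<open>v \<bullet> y\<close>,
  which is at most half the sum of the squared norms of \<open>v\<close> and
  \<open>y\<close>.\<close>

lemma orthogonal_projections_contractive:
  assumes "finite I" "\<And>i. i \<in> I \<Longrightarrow> hc (P i) = P i" "\<And>i. i \<in> I \<Longrightarrow> P i ** P i = P i"
    "\<And>i j. i \<in> I \<Longrightarrow> j \<in> I \<Longrightarrow> i \<noteq> j \<Longrightarrow> P i ** P j = 0"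
  shows "contractive I P"
  unfolding contractive_def
proof
  fix v
  define y where "y = (\<Sum>i\<in>I. P i *v v)"
  have P: "(P i *v v) \<bullet> (P j *v v) = (if i = j then v \<bullet> (P i *v v) else 0)" if "i \<in> I" "j \<in> I" for i j
    using that assms by (simp add: inner_matrix_vector matrix_vector_mul_assoc)
  have "(\<Sum>i\<in>I. (norm (P i *v v))\<^sup>2) = v \<bullet> y"
    using P by (simp add: y_def power2_norm_eq_inner inner_sum_right)
  moreover have "(norm y)\<^sup>2 = v \<bullet> y"
    unfolding power2_norm_eq_inner y_def inner_sum_left inner_sum_right
    using P assms(1) by simp
  ultimately show "(\<Sum>i\<in>I. (norm (P i *v v))\<^sup>2) \<le> (norm v)\<^sup>2"
    using inner_le_half_squares[of v y] by simp
qed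

section \<open>Polar decomposition and fidelity\<close>

text \<open>The block column of all \<open>X i\<close> has modulus \<open>R\<close>, and
  \<open>W i = X i ** pinv R\<close>. The sum of the \<open>hc (W i) ** W i\<close> is the
  projection \<open>R ** pinv R\<close>, whence the contraction.\<close>

lemma polar_decomposition:
  fixes X :: "'i \<Rightarrow> complex^'e::finite^'b::finite"
  assumes "finite I"
  obtains W where "contractive I W"
    "\<And>i. i \<in> I \<Longrightarrow> X i = W i ** op_sqrt (\<Sum>i\<in>I. hc (X i) ** X i)"
    "(\<Sum>i\<in>I. hc (W i) ** X i) = op_sqrt (\<Sum>i\<in>I. hc (X i) ** X i)"
proof -
  define T where "T = (\<Sum>i\<in>I. hc (X i) ** X i)"
  have psdT: "psd T" unfolding T_def by (intro psd_sum psd_hc_mult)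
  define R where "R = op_sqrt T"
  have R: "psd R" "hc R = R" "R ** R = T"
    using psdT by (simp_all add: R_def psd_op_sqrt hc_op_sqrt op_sqrt_square)
  let ?P = "pinv R"
  have P: "hc ?P = ?P" "R ** ?P = ?P ** R" "R ** ?P ** R = R" "?P ** R ** ?P = ?P"
    using hc_pinv[OF R(1)] pinv_commute[OF R(1)] mult_pinv_mult[OF R(1)] pinv_mult_pinv[OF R(1)] .
  define W where "W i = X i ** ?P" for i
  have "contractive I W"
    unfolding contractive_def
  proof
    fix v
    have "(\<Sum>i\<in>I. (norm (W i *v v))\<^sup>2) = (?P *v v) \<bullet> (T *v (?P *v v))"
      by (simp add: W_def matrix_vector_mul_assoc[symmetric] norm_matrix_vector_sq T_def mv.sum_left inner_sum_right)
    also have "\<dots> = (norm ((R ** ?P) *v v))\<^sup>2"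
      using R by (simp add: matrix_vector_mul_assoc[symmetric] norm_matrix_vector_sq)
    also have "\<dots> \<le> (norm v)\<^sup>2"
    proof (intro power_mono norm_projection_le norm_ge_zero)
      show "hc (R ** ?P) = R ** ?P" using P R by (simp add: hc_mult)
      show "R ** ?P ** (R ** ?P) = R ** ?P" using P by (simp add: matrix_mul_assoc)
    qed
    finally show "(\<Sum>i\<in>I. (norm (W i *v v))\<^sup>2) \<le> (norm v)\<^sup>2" .
  qed
  moreover have "X i = W i ** R" if "i \<in> I" for i
  proof -
    \<comment> \<open>\<open>?Z\<close> maps into the kernel of \<open>R\<close>. There the form of
      \<open>T\<close> vanishes and, being the sum of the squared norms of the \<open>X i\<close>,
      makes each \<open>X i\<close> vanish too; this justifies cancelling the
      pseudo-inverse.\<close>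
    let ?Z = "?P ** R - idm"
    have "R ** ?Z = 0" using P by (simp add: mm.diff_right matrix_mul_assoc)
    then have "T ** ?Z = 0" by (simp add: R(3)[symmetric] matrix_mul_assoc[symmetric])
    moreover have "?Z \<bullet> (T ** ?Z) = (\<Sum>i\<in>I. (norm (X i ** ?Z))\<^sup>2)"
      by (simp add: T_def mm.sum_left inner_sum_right power2_norm_eq_inner inner_mult_left matrix_mul_assoc)
    ultimately have "(\<Sum>i\<in>I. (norm (X i ** ?Z))\<^sup>2) = 0" by simp
    then have "\<forall>i\<in>I. (norm (X i ** ?Z))\<^sup>2 = 0"
      by (subst (asm) sum_nonneg_eq_0_iff[OF assms]) auto
    then have "X i ** ?Z = 0" using that by simp
    then show ?thesis by (simp add: W_def mm.diff_right matrix_mul_assoc)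
  qed
  moreover have "(\<Sum>i\<in>I. hc (W i) ** X i) = R"
  proof -
    have "(\<Sum>i\<in>I. hc (W i) ** X i) = ?P ** T"
      by (simp add: W_def hc_mult P T_def mm.sum_right matrix_mul_assoc)
    also have "\<dots> = (R ** ?P) ** R"
      unfolding P(2) by (simp add: R(3)[symmetric] matrix_mul_assoc)
    finally show ?thesis by (simp add: P(3))
  qed
  ultimately show ?thesis
    unfolding R_def T_def by (rule that)
qed

lemma polar_decomposition_single:
  fixes Y :: "complex^'e::finite^'b::finite"
  obtains W where "\<And>v. norm (W *v v) \<le> norm v" "Y = W ** op_sqrt (hc Y ** Y)" "hc W ** Y = op_sqrt (hc Y ** Y)"
proof -
  obtain W where W: "contractive {()} W" "\<And>i. i \<in> {()} \<Longrightarrow> Y = W i ** op_sqrt (\<Sum>i\<in>{()}. hc Y ** Y)"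
    "(\<Sum>i\<in>{()}. hc (W i) ** Y) = op_sqrt (\<Sum>i\<in>{()}. hc Y ** Y)"
    using polar_decomposition[of "{()}" "\<lambda>_. Y"] by blast
  have "norm (W () *v v) \<le> norm v" for v
  proof (rule power2_le_imp_le)
    show "(norm (W () *v v))\<^sup>2 \<le> (norm v)\<^sup>2"
      using contractiveD[OF W(1), of v] by simp
  qed simp
  with W(2,3) show ?thesis
    by (intro that[of "W ()"]) simp_all
qed

text \<open>The unsquared convention; for positive operators this is the trace norm of
  \<open>op_sqrt \<rho> ** op_sqrt \<sigma>\<close>.\<close>

definition fidelity :: "'e::finite op \<Rightarrow> 'e op \<Rightarrow> real" where
  "fidelity \<rho> \<sigma> = Re (trace (op_sqrt (op_sqrt \<sigma> ** \<rho> ** op_sqrt \<sigma>)))"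

lemma norm_sq_eq_trace: "(norm A)\<^sup>2 = Re (trace (hc A ** A))" for A :: "complex^'e::finite^'b::finite"
  by (simp add: power2_norm_eq_inner inner_eq_trace)

lemma norm_sq_eq_trace_hc: "(norm A)\<^sup>2 = Re (trace (A ** hc A))" for A :: "complex^'e::finite^'b::finite"
  using norm_sq_eq_trace[of "hc A"] by (simp add: norm_hc)

lemma Re_trace_sum: "Re (trace (\<Sum>i\<in>I. A i)) = (\<Sum>i\<in>I. Re (trace (A i)))"
  by (simp only: inner_one_left[symmetric] inner_sum_right)

lemma norm_op_sqrt_sq: "psd M \<Longrightarrow> (norm (op_sqrt M))\<^sup>2 = Re (trace M)"
  by (simp add: norm_sq_eq_trace hc_op_sqrt op_sqrt_square)

text \<open>One half of Uhlmann's theorem: the block column \<Phi> purifies the state, and no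
  contraction overlaps better than the polar factor.\<close>

lemma fidelity_ge:
  fixes \<Phi> :: "'i \<Rightarrow> complex^'e::finite^'b::finite"
  assumes "psd \<sigma>" "contractive I U" "finite I"
  shows "(\<Sum>i\<in>I. U i \<bullet> (\<Phi> i ** op_sqrt \<sigma>)) \<le> fidelity (\<Sum>i\<in>I. hc (\<Phi> i) ** \<Phi> i) \<sigma>"
proof -
  let ?s = "op_sqrt \<sigma>"
  define X where "X i = \<Phi> i ** ?s" for i
  define T where "T = (\<Sum>i\<in>I. hc (X i) ** X i)"
  have T: "T = ?s ** (\<Sum>i\<in>I. hc (\<Phi> i) ** \<Phi> i) ** ?s"
    using assms(1) by (simp add: T_def X_def hc_mult hc_op_sqrt mm.sum_left mm.sum_right matrix_mul_assoc)
  have psdT: "psd T" unfolding T_def by (intro psd_sum psd_hc_mult)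
  obtain W where W: "contractive I W" "\<And>i. i \<in> I \<Longrightarrow> X i = W i ** op_sqrt T"
    using polar_decomposition[OF \<open>finite I\<close>, of X] unfolding T_def by blast
  \<comment> \<open>Splitting the modulus as \<open>Q ** Q\<close> puts one factor \<open>Q\<close>
    under each of the two contractions; the squared norm of \<open>Q\<close> is the trace of the
    modulus, that is, the fidelity.\<close>
  define Q where "Q = op_sqrt (op_sqrt T)"
  have Q: "hc Q = Q" "Q ** Q = op_sqrt T"
    using psdT by (simp_all add: Q_def hc_op_sqrt op_sqrt_square psd_op_sqrt)
  have "(\<Sum>i\<in>I. U i \<bullet> X i) = (\<Sum>i\<in>I. (U i ** Q) \<bullet> (W i ** Q))"
    using W(2) by (intro sum.cong) (simp_all add: inner_mult_right Q matrix_mul_assoc[symmetric])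
  also have "\<dots> \<le> ((norm Q)\<^sup>2 + (norm Q)\<^sup>2) / 2"
    using contractive_norm_mult[OF assms(2), of Q] contractive_norm_mult[OF W(1), of Q]
    by (intro order_trans[OF sum_inner_le_half_squares]) simp
  also have "\<dots> = fidelity (\<Sum>i\<in>I. hc (\<Phi> i) ** \<Phi> i) \<sigma>"
    using psdT by (simp add: Q_def norm_op_sqrt_sq psd_op_sqrt fidelity_def T[symmetric])
  finally show ?thesis by (simp add: X_def)
qed

text \<open>The other half of Uhlmann's theorem: the polar factor of the block column
  \<open>\<Phi> i ** op_sqrt \<sigma>\<close> attains the bound.\<close>

lemma fidelity_attained:
  fixes \<Phi> :: "'i \<Rightarrow> complex^'e::finite^'b::finite"
  assumes "psd \<sigma>" "finite I"
  obtains U where "contractive I U"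
    "(\<Sum>i\<in>I. U i \<bullet> (\<Phi> i ** op_sqrt \<sigma>)) = fidelity (\<Sum>i\<in>I. hc (\<Phi> i) ** \<Phi> i) \<sigma>"
proof -
  let ?s = "op_sqrt \<sigma>"
  define X where "X i = \<Phi> i ** ?s" for i
  define T where "T = (\<Sum>i\<in>I. hc (X i) ** X i)"
  have T: "T = ?s ** (\<Sum>i\<in>I. hc (\<Phi> i) ** \<Phi> i) ** ?s"
    using assms(1) by (simp add: T_def X_def hc_mult hc_op_sqrt mm.sum_left mm.sum_right matrix_mul_assoc)
  obtain W where W: "contractive I W" "(\<Sum>i\<in>I. hc (W i) ** X i) = op_sqrt T"
    using polar_decomposition[OF \<open>finite I\<close>, of X] unfolding T_def by blast
  have "(\<Sum>i\<in>I. W i \<bullet> X i) = Re (trace (\<Sum>i\<in>I. hc (W i) ** X i))"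
    by (simp add: inner_eq_trace Re_trace_sum)
  then have "(\<Sum>i\<in>I. W i \<bullet> X i) = fidelity (\<Sum>i\<in>I. hc (\<Phi> i) ** \<Phi> i) \<sigma>"
    by (simp add: W(2) fidelity_def T)
  with W(1) show ?thesis
    by (intro that[of W]) (simp_all add: X_def)
qed

lemma normalized_state_exists: "\<exists>\<sigma> :: 'e::finite op. normalized_state \<sigma>"
proof
  show "normalized_state ((1 / real CARD('e)) *\<^sub>R idm :: 'e op)"
    using psd_scaleR[OF _ psd_one, of "1 / real CARD('e)"] unfolding normalized_state_def
    by (simp add: trace_def Finite_Cartesian_Product.mat_def scaleR_conv_of_real[where 'a = complex])
qed

lemma psd_trace_real: assumes "psd M" shows "trace M = complex_of_real (Re (trace M))"
proof -
  have "cnj (M $ i $ i) = hc M $ i $ i" for i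
    by (simp add: hc_def)
  then have "cnj (trace M) = trace M"
    by (simp add: trace_def psd_hermitian[OF assms])
  then show ?thesis by (metis Reals_cnj_iff of_real_Re)
qed

lemma normalized_state_iff: "normalized_state \<sigma> \<longleftrightarrow> psd \<sigma> \<and> Re (trace \<sigma>) = 1"
  unfolding normalized_state_def using psd_trace_real[of \<sigma>] by (auto simp: complex_eq_iff)

lemma op_sqrt_scaleR:
  assumes "psd M" "0 \<le> r" shows "op_sqrt (r\<^sup>2 *\<^sub>R M) = r *\<^sub>R op_sqrt M"
  using assms by (intro op_sqrt_unique[of "r *\<^sub>R op_sqrt M"])
    (simp_all add: psd_scaleR psd_op_sqrt op_sqrt_square mm.scaleR_left mm.scaleR_right power2_eq_square)

text \<open>The optimal \<open>\<sigma>\<close> is proportional to \<open>Y\<^sup>* Y\<close> for the operator \<open>Y\<close> whose norm is on the left.\<close>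

lemma sum_fidelity_ge_norm:
  fixes \<Phi> :: "'z::finite \<Rightarrow> complex^'e::finite^'b::finite" and U :: "'z \<Rightarrow> complex^'d::finite^'b"
    and f :: "'z \<Rightarrow> 'k::finite"
  assumes U: "\<And>k. contractive (f -` {k}) U"
  obtains \<sigma> where "normalized_state \<sigma>"
    "norm (\<Sum>z\<in>UNIV. hc (U z) ** \<Phi> z) \<le> (\<Sum>k\<in>UNIV. fidelity (\<Sum>z\<in>f -` {k}. hc (\<Phi> z) ** \<Phi> z) \<sigma>)"
proof -
  define Y where "Y = (\<Sum>z\<in>UNIV. hc (U z) ** \<Phi> z)"
  show ?thesis
  proof (cases "Y = 0")
    case True
    \<comment> \<open>Every state will do, because the zero family shows that fidelities are
      nonnegative.\<close>
    obtain \<sigma> :: "'e op" where \<sigma>: "normalized_state \<sigma>" using normalized_state_exists by blast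
    have "0 \<le> fidelity (\<Sum>z\<in>f -` {k}. hc (\<Phi> z) ** \<Phi> z) \<sigma>" for k
      using fidelity_ge[of \<sigma> "f -` {k}" "\<lambda>_. 0" \<Phi>] \<sigma>
      by (simp add: contractive_def normalized_state_def)
    with \<sigma> True show ?thesis by (intro that[of \<sigma>]) (auto simp: Y_def intro: sum_nonneg)
  next
    case False
    obtain W where W: "\<And>v. norm (W *v v) \<le> norm v" "hc W ** Y = op_sqrt (hc Y ** Y)"
      using polar_decomposition_single[of Y] by blast
    define R where "R = op_sqrt (hc Y ** Y)"
    have R: "hc R = R" "(norm R)\<^sup>2 = (norm Y)\<^sup>2"
      by (simp_all add: R_def hc_op_sqrt psd_hc_mult norm_op_sqrt_sq norm_sq_eq_trace[of Y])
    define \<sigma> where "\<sigma> = (1 / norm Y)\<^sup>2 *\<^sub>R (hc Y ** Y)"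
    have s: "op_sqrt \<sigma> = (1 / norm Y) *\<^sub>R R"
      unfolding \<sigma>_def R_def by (rule op_sqrt_scaleR) (simp_all add: psd_hc_mult)
    have psd\<sigma>: "psd \<sigma>" unfolding \<sigma>_def by (intro psd_scaleR psd_hc_mult) simp
    have "Re (trace \<sigma>) = (1 / norm Y)\<^sup>2 * (norm Y)\<^sup>2"
      unfolding \<sigma>_def norm_sq_eq_trace by (simp only: inner_one_left[symmetric] inner_scaleR_right)
    then have norm\<sigma>: "normalized_state \<sigma>"
      unfolding normalized_state_iff using psd\<sigma> False by (simp add: power_divide)
    have fib: "(\<Sum>z\<in>UNIV. h z) = (\<Sum>k\<in>UNIV. \<Sum>z\<in>f -` {k}. h z)" for h :: "'z \<Rightarrow> real"
      using sum.group[of UNIV UNIV f h] by (simp add: vimage_def)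
    \<comment> \<open>The norm of \<open>Y\<close> is the overlap of its polar factor
      \<open>W\<close> with \<open>Y ** op_sqrt \<sigma>\<close>. Absorbing \<open>W\<close> into
      each \<open>U z\<close> preserves the contraction on fibres and changes the source space from
      \<open>'d\<close> to \<open>'e\<close>, as the fidelity bound requires.\<close>
    have "norm Y = R \<bullet> R / norm Y"
      using R(2) False by (simp add: power2_norm_eq_inner[symmetric]) (simp add: power2_eq_square)
    also have "\<dots> = W \<bullet> (Y ** op_sqrt \<sigma>)"
    proof -
      have "hc Y ** W = R"
        using arg_cong[OF W(2), of hc] R by (simp add: hc_mult R_def)
      then have "W \<bullet> (Y ** R) = R \<bullet> R"
        using inner_mult_left[of "Y" R W] by (simp add: inner_commute)
      then show ?thesis by (simp add: s mm.scaleR_right)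
    qed
    also have "\<dots> = (\<Sum>z\<in>UNIV. (U z ** W) \<bullet> (\<Phi> z ** op_sqrt \<sigma>))"
      by (simp add: Y_def mm.sum_left inner_sum_right inner_mult_left matrix_mul_assoc)
    also have "\<dots> \<le> (\<Sum>k\<in>UNIV. fidelity (\<Sum>z\<in>f -` {k}. hc (\<Phi> z) ** \<Phi> z) \<sigma>)"
      unfolding fib by (intro sum_mono fidelity_ge psd\<sigma> contractive_comp U W finite)
    finally show ?thesis using norm\<sigma> by (intro that[of \<sigma>]) (simp_all add: Y_def)
  qed
qed

section \<open>Dual pairs of hash functions and the Fourier transform\<close>

text \<open>\<open>\<xi> x z\<close> is the character \<open>(-1)\<^bsup>x \<cdot> z\<^esup>\<close>; the kernels of \<open>f\<close> and \<open>g\<close> are each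
  other's annihilators.\<close>

locale dual_pair =
  fixes \<xi> :: "'x::finite \<Rightarrow> 'z::finite \<Rightarrow> real" and f :: "'z \<Rightarrow> 'k::finite" and g :: "'x \<Rightarrow> 's::finite"
  assumes xi_square: "\<xi> x z * \<xi> x z = 1"
    and card_f: "card (f -` {k}) = CARD('s)"
    and card_g: "card (g -` {s}) = CARD('k)"
    and xi_annihilate: "f z = f z' \<Longrightarrow> g x = g x' \<Longrightarrow> \<xi> x z * \<xi> x z' = \<xi> x' z * \<xi> x' z'"
    and xi_sum_g: "f z \<noteq> f z' \<Longrightarrow> (\<Sum>x\<in>g -` {s}. \<xi> x z * \<xi> x z') = 0"
    and xi_sum_f: "g x \<noteq> g x' \<Longrightarrow> (\<Sum>z\<in>f -` {k}. \<xi> x z * \<xi> x' z) = 0"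
    and xi_orthogonal_x: "z \<noteq> z' \<Longrightarrow> (\<Sum>x\<in>UNIV. \<xi> x z * \<xi> x z') = 0"
    and xi_orthogonal_z: "x \<noteq> x' \<Longrightarrow> (\<Sum>z\<in>UNIV. \<xi> x z * \<xi> x' z) = 0"
begin

text \<open>The assumptions are symmetric in the two sides. Only annihilation needs a computation:
  multiply by \<open>\<xi> x z' * \<xi> x' z\<close> and cancel the squares.\<close>

lemma dual_pair_swap: "dual_pair (\<lambda>z x. \<xi> x z) g f"
proof
  fix x x' z z'
  assume "g x = g x'" "f z = f z'"
  then have "\<xi> x z * \<xi> x z' * (\<xi> x z' * \<xi> x' z) = \<xi> x' z * \<xi> x' z' * (\<xi> x z' * \<xi> x' z)"
    using xi_annihilate by metis
  moreover have "\<xi> x z * \<xi> x z' * (\<xi> x z' * \<xi> x' z) = \<xi> x z * \<xi> x' z * (\<xi> x z' * \<xi> x z')"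
    "\<xi> x' z * \<xi> x' z' * (\<xi> x z' * \<xi> x' z) = \<xi> x z' * \<xi> x' z' * (\<xi> x' z * \<xi> x' z)"
    by (simp_all add: mult_ac)
  ultimately show "\<xi> x z * \<xi> x' z = \<xi> x z' * \<xi> x' z'"
    by (simp add: xi_square)
qed (auto simp: xi_square card_f card_g xi_sum_f xi_sum_g xi_orthogonal_x xi_orthogonal_z)

text \<open>By \<open>card_g\<close> this is the size of each fibre of \<open>g\<close>, and 2^m in
  the application to hashing.\<close>

definition c :: real where "c = real CARD('k)"
definition N :: real where "N = real CARD('k) * real CARD('s)"

lemma c_pos: "0 < c" and N_pos: "0 < N"
  by (simp_all add: c_def N_def zero_less_card_finite)

lemma sum_fibres_f: "(\<Sum>z\<in>UNIV. h z) = (\<Sum>k\<in>UNIV. \<Sum>z\<in>f -` {k}. h z)"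
  and sum_fibres_g: "(\<Sum>x\<in>UNIV. h' x) = (\<Sum>s\<in>UNIV. \<Sum>x\<in>g -` {s}. h' x)"
  for h :: "'z \<Rightarrow> 'v::comm_monoid_add" and h' :: "'x \<Rightarrow> 'v"
  using sum.group[of UNIV UNIV f h] sum.group[of UNIV UNIV g h'] by (simp_all add: vimage_def)

lemma card_z: "real CARD('z) = N"
  using sum_fibres_f[of "\<lambda>_. 1 :: real"] by (simp add: card_f N_def)

lemma card_x: "real CARD('x) = N"
  using sum_fibres_g[of "\<lambda>_. 1 :: real"] by (simp add: card_g N_def)

lemma fibre_g_nonempty: "\<exists>x. g x = s"
  using card_g[of s] by (metis card.empty equals0I vimage_singleton_eq zero_less_card_finite less_irrefl)

lemma parseval_x:
  fixes a :: "'z \<Rightarrow> 'v::real_inner"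
  shows "(\<Sum>x\<in>UNIV. (norm (\<Sum>z\<in>UNIV. \<xi> x z *\<^sub>R a z))\<^sup>2) = N * (\<Sum>z\<in>UNIV. (norm (a z))\<^sup>2)"
proof -
  have "(\<Sum>x\<in>UNIV. (norm (\<Sum>z\<in>UNIV. \<xi> x z *\<^sub>R a z))\<^sup>2)
      = (\<Sum>x\<in>UNIV. \<Sum>z\<in>UNIV. \<Sum>z'\<in>UNIV. (\<xi> x z * \<xi> x z') * (a z \<bullet> a z'))"
    by (simp add: power2_norm_eq_inner inner_sum_left inner_sum_right mult_ac inner_commute)
  also have "\<dots> = (\<Sum>z\<in>UNIV. \<Sum>z'\<in>UNIV. (\<Sum>x\<in>UNIV. \<xi> x z * \<xi> x z') * (a z \<bullet> a z'))"
    by (subst sum.swap, intro sum.cong refl, subst sum.swap) (simp add: sum_distrib_right)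
  also have "\<dots> = (\<Sum>z\<in>UNIV. \<Sum>z'\<in>UNIV. (if z' = z then N * (a z \<bullet> a z') else 0))"
    using xi_orthogonal_x by (intro sum.cong refl) (auto simp: xi_square card_x)
  finally show ?thesis
    by (simp add: power2_norm_eq_inner sum_distrib_left)
qed

text \<open>Summed over a fibre of \<open>g\<close>, the signs at \<open>z\<close> and
  \<open>z'\<close> cancel if \<open>f z \<noteq> f z'\<close>; otherwise their product is constant
  on the fibre and can be evaluated at \<open>x0\<close>.\<close>

lemma parseval_fibre:
  fixes a :: "'z \<Rightarrow> 'v::real_inner"
  shows "(\<Sum>x\<in>g -` {g x0}. (norm (\<Sum>z\<in>UNIV. \<xi> x z *\<^sub>R a z))\<^sup>2)
    = c * (\<Sum>k\<in>UNIV. (norm (\<Sum>z\<in>f -` {k}. \<xi> x0 z *\<^sub>R a z))\<^sup>2)"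
proof -
  have fib: "(\<Sum>x\<in>g -` {g x0}. \<xi> x z * \<xi> x z') = (if f z = f z' then c * (\<xi> x0 z * \<xi> x0 z') else 0)" for z z'
  proof (cases "f z = f z'")
    case True
    then have "(\<Sum>x\<in>g -` {g x0}. \<xi> x z * \<xi> x z') = (\<Sum>x\<in>g -` {g x0}. \<xi> x0 z * \<xi> x0 z')"
      by (intro sum.cong refl xi_annihilate) auto
    with True show ?thesis by (simp add: card_g c_def)
  qed (simp add: xi_sum_g)
  have "(\<Sum>x\<in>g -` {g x0}. (norm (\<Sum>z\<in>UNIV. \<xi> x z *\<^sub>R a z))\<^sup>2)
      = (\<Sum>x\<in>g -` {g x0}. \<Sum>z\<in>UNIV. \<Sum>z'\<in>UNIV. (\<xi> x z * \<xi> x z') * (a z \<bullet> a z'))"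
    by (simp add: power2_norm_eq_inner inner_sum_left inner_sum_right mult_ac inner_commute)
  also have "\<dots> = (\<Sum>z\<in>UNIV. \<Sum>z'\<in>UNIV. (\<Sum>x\<in>g -` {g x0}. \<xi> x z * \<xi> x z') * (a z \<bullet> a z'))"
    by (subst sum.swap, intro sum.cong refl, subst sum.swap) (simp add: sum_distrib_right)
  also have "\<dots> = c * (\<Sum>z\<in>UNIV. \<Sum>z'\<in>f -` {f z}. (\<xi> x0 z * \<xi> x0 z') * (a z \<bullet> a z'))"
  proof -
    have "(\<Sum>z'\<in>UNIV. (\<Sum>x\<in>g -` {g x0}. \<xi> x z * \<xi> x z') * (a z \<bullet> a z'))
        = c * (\<Sum>z'\<in>f -` {f z}. (\<xi> x0 z * \<xi> x0 z') * (a z \<bullet> a z'))" for z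
      unfolding fib sum_distrib_left
      by (intro sum.mono_neutral_cong_right) (auto simp: mult.assoc)
    then show ?thesis by (simp add: sum_distrib_left)
  qed
  also have "\<dots> = c * (\<Sum>k\<in>UNIV. \<Sum>z\<in>f -` {k}. \<Sum>z'\<in>f -` {k}. (\<xi> x0 z * \<xi> x0 z') * (a z \<bullet> a z'))"
    by (subst sum_fibres_f) simp
  also have "\<dots> = c * (\<Sum>k\<in>UNIV. (norm (\<Sum>z\<in>f -` {k}. \<xi> x0 z *\<^sub>R a z))\<^sup>2)"
    by (simp add: power2_norm_eq_inner inner_sum_left inner_sum_right mult_ac inner_commute)
  finally show ?thesis .
qed

lemma fibre_sign:
  assumes "f z = f z'" "g x = g x0"
  shows "\<xi> x z = (\<xi> x0 z * \<xi> x0 z') * \<xi> x z'"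
proof -
  have "\<xi> x z * (\<xi> x z' * \<xi> x z') = (\<xi> x0 z * \<xi> x0 z') * \<xi> x z'"
    using xi_annihilate[OF assms] by (simp add: mult.assoc[symmetric])
  then show ?thesis by (simp add: xi_square)
qed

lemma sign_abs: "\<bar>\<xi> x z\<bar> = 1"
  using xi_square[of x z] by (metis abs_mult_self_eq abs_1 abs_ge_zero mult_cancel_left2 power2_eq_1_iff power2_eq_square abs_minus_cancel)

text \<open>Moving \<open>z\<close> within its fibre of \<open>f\<close> changes all signs
  \<open>\<xi> x z\<close> with \<open>g x = s\<close> by one common factor. Norms of such sums,
  even after applying an operator, thus depend only on the fibre.\<close>

lemma norm_fibre_sum:
  fixes y :: "'x \<Rightarrow> 'v::real_normed_vector"
  assumes "f z = f z'"
  shows "\<exists>\<epsilon>. \<bar>\<epsilon>\<bar> = 1 \<and> (\<Sum>x\<in>g -` {s}. \<xi> x z *\<^sub>R y x) = \<epsilon> *\<^sub>R (\<Sum>x\<in>g -` {s}. \<xi> x z' *\<^sub>R y x)"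
proof -
  obtain x0 where "g x0 = s" using fibre_g_nonempty by blast
  then have "\<xi> x z = (\<xi> x0 z * \<xi> x0 z') * \<xi> x z'" if "g x = s" for x
    using fibre_sign[OF assms] that by blast
  then have "(\<Sum>x\<in>g -` {s}. \<xi> x z *\<^sub>R y x) = (\<xi> x0 z * \<xi> x0 z') *\<^sub>R (\<Sum>x\<in>g -` {s}. \<xi> x z' *\<^sub>R y x)"
    unfolding scaleR_sum_right by (intro sum.cong) auto
  then show ?thesis by (intro exI[of _ "\<xi> x0 z * \<xi> x0 z'"]) (simp add: abs_mult sign_abs)
qed

end

text \<open>A block column as one matrix, so that a sum of squared norms becomes a single squared
  norm.\<close>

definition stack :: "('i::finite \<Rightarrow> complex^'e::finite^'d::finite) \<Rightarrow> complex^'e^('i \<times> 'd)" where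
  "stack A = (\<chi> p. A (fst p) $ snd p)"

definition stack_vec :: "('i::finite \<Rightarrow> complex^'d::finite) \<Rightarrow> complex^('i \<times> 'd)" where
  "stack_vec v = (\<chi> p. v (fst p) $ snd p)"

lemma stack_mult: "stack A ** M = stack (\<lambda>i. A i ** M)"
  and stack_sum: "(\<Sum>j\<in>J. stack (A' j)) = stack (\<lambda>i. \<Sum>j\<in>J. A' j i)"
  and stack_mult_vec: "stack A *v v = stack_vec (\<lambda>i. A i *v v)"
  and stack_vec_sum: "(\<Sum>j\<in>J. stack_vec (w j)) = stack_vec (\<lambda>i. \<Sum>j\<in>J. w j i)"
  by (simp_all add: stack_def stack_vec_def matrix_matrix_mult_def matrix_vector_mult_def
      Finite_Cartesian_Product.vec_eq_iff)

lemma sum_UNIV_prod: "(\<Sum>p\<in>UNIV. h p) = (\<Sum>i\<in>UNIV. \<Sum>j\<in>UNIV. h (i, j))"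
  for h :: "'i::finite \<times> 'j::finite \<Rightarrow> 'v::comm_monoid_add"
  by (simp add: sum.cartesian_product)

lemma norm_stack: "(norm (stack A))\<^sup>2 = (\<Sum>i\<in>UNIV. (norm (A i))\<^sup>2)"
  and norm_stack_vec: "(norm (stack_vec v))\<^sup>2 = (\<Sum>i\<in>UNIV. (norm (v i))\<^sup>2)"
  by (simp_all add: power2_norm_eq_inner inner_vec_def stack_def stack_vec_def sum_UNIV_prod)

text \<open>Both sides of the duality are suprema of values of families of contractions, and the
  Fourier transform turns a family for one side into a family for the other.  Either the
  components in the \<open>z\<close> basis have orthogonal ranges or the components in the \<open>x\<close> basis have
  orthogonal supports; these are the two cases of the standard form.\<close>

locale dual_pair_state = dual_pair \<xi> f g
  for \<xi> :: "'x::finite \<Rightarrow> 'z::finite \<Rightarrow> real" and f :: "'z \<Rightarrow> 'k::finite" and g :: "'x \<Rightarrow> 's::finite" +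
  fixes \<Phi> :: "'z \<Rightarrow> complex^'e::finite^'b::finite" and \<Phi>' :: "'x \<Rightarrow> complex^'e^'b"
  assumes fourier: "\<Phi>' x = (1 / sqrt N) *\<^sub>R (\<Sum>z\<in>UNIV. \<xi> x z *\<^sub>R \<Phi> z)"
    and standard: "(\<forall>z z'. z \<noteq> z' \<longrightarrow> hc (\<Phi> z) ** \<Phi> z' = 0) \<or> (\<forall>x x'. x \<noteq> x' \<longrightarrow> \<Phi>' x ** hc (\<Phi>' x') = 0)"
begin

lemma fourier_inverse: "\<Phi> z = (1 / sqrt N) *\<^sub>R (\<Sum>x\<in>UNIV. \<xi> x z *\<^sub>R \<Phi>' x)"
proof -
  have "(\<Sum>x\<in>UNIV. \<xi> x z *\<^sub>R \<Phi>' x) = (1 / sqrt N) *\<^sub>R (\<Sum>x\<in>UNIV. \<Sum>z'\<in>UNIV. (\<xi> x z * \<xi> x z') *\<^sub>R \<Phi> z')"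
    by (simp add: fourier scaleR_sum_right mult_ac)
  also have "\<dots> = (1 / sqrt N) *\<^sub>R (\<Sum>z'\<in>UNIV. (\<Sum>x\<in>UNIV. \<xi> x z * \<xi> x z') *\<^sub>R \<Phi> z')"
    by (subst sum.swap) (simp add: scaleR_sum_left)
  also have "(\<Sum>z'\<in>UNIV. (\<Sum>x\<in>UNIV. \<xi> x z * \<xi> x z') *\<^sub>R \<Phi> z') = (\<Sum>z'\<in>UNIV. if z' = z then N *\<^sub>R \<Phi> z' else 0)"
    using xi_orthogonal_x by (intro sum.cong refl) (auto simp: xi_square card_x)
  finally show ?thesis
    using N_pos by (simp add: real_sqrt_mult_self field_simps)
qed

text \<open>\<open>B x\<close> is the Fourier transform of \<open>hc (U z) ** P z\<close>. As
  \<open>P z\<close> keeps \<open>\<Phi> z\<close> and kills the other components, and signs square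
  to 1, \<open>B x ** \<Phi>' x\<close> is the same multiple of \<open>Y\<close> for all
  \<open>x\<close>. Contraction combines \<open>parseval_fibre\<close>, the bound on each fibre of
  \<open>f\<close>, and Bessel's inequality for \<open>P\<close>.\<close>

lemma guess_from_fidelity_z:
  fixes U :: "'z \<Rightarrow> complex^'e^'b" and s :: "'e op"
  assumes z: "\<And>z z'. z \<noteq> z' \<Longrightarrow> hc (\<Phi> z) ** \<Phi> z' = 0"
    and U: "\<And>k. contractive (f -` {k}) U" and s: "hc s = s" "norm s = 1"
  obtains B :: "'x \<Rightarrow> complex^'b^'e" where "\<And>t. contractive (g -` {t}) B"
    "(\<Sum>z\<in>UNIV. U z \<bullet> (\<Phi> z ** s))\<^sup>2 \<le> c * (\<Sum>x\<in>UNIV. (norm (B x ** \<Phi>' x))\<^sup>2)"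
proof -
  define P where "P z = range_proj (\<Phi> z)" for z
  have P: "hc (P z) = P z" "P z ** P z = P z" "P z ** \<Phi> z' = (if z = z' then \<Phi> z else 0)" for z z'
    using z by (auto simp: P_def hc_range_proj range_proj_idem range_proj_mult range_proj_orthogonal)
  have PP: "P z ** P z' = 0" if "z \<noteq> z'" for z z'
    using P(3)[of z z'] that by (simp add: P_def range_proj_def[of "\<Phi> z'"] matrix_mul_assoc)
  have bessel: "contractive UNIV P"
    by (intro orthogonal_projections_contractive) (simp_all add: P PP)
  define Y where "Y = (\<Sum>z\<in>UNIV. hc (U z) ** \<Phi> z)"
  \<comment> \<open>The constant cancels the factor \<open>c\<close> of
    \<open>parseval_fibre\<close>.\<close>
  define B where "B x = (1 / sqrt c) *\<^sub>R (\<Sum>z\<in>UNIV. \<xi> x z *\<^sub>R (hc (U z) ** P z))" for x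
  have "contractive (g -` {t}) B" for t
    unfolding contractive_def
  proof
    fix v
    obtain x0 where x0: "g x0 = t" using fibre_g_nonempty by blast
    define a where "a z = hc (U z) *v (P z *v v)" for z
    have "B x *v v = (1 / sqrt c) *\<^sub>R (\<Sum>z\<in>UNIV. \<xi> x z *\<^sub>R a z)" for x
      by (simp add: B_def a_def mv.scaleR_left mv.sum_left matrix_vector_mul_assoc)
    then have "(\<Sum>x\<in>g -` {t}. (norm (B x *v v))\<^sup>2) = (1 / c) * (\<Sum>x\<in>g -` {g x0}. (norm (\<Sum>z\<in>UNIV. \<xi> x z *\<^sub>R a z))\<^sup>2)"
      using c_pos by (simp add: power_mult_distrib power_divide sum_divide_distrib x0)
    also have "\<dots> = (\<Sum>k\<in>UNIV. (norm (\<Sum>z\<in>f -` {k}. \<xi> x0 z *\<^sub>R a z))\<^sup>2)"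
      unfolding parseval_fibre using c_pos by simp
    also have "\<dots> \<le> (\<Sum>k\<in>UNIV. \<Sum>z\<in>f -` {k}. (norm (P z *v v))\<^sup>2)"
    proof (intro sum_mono)
      fix k
      have "(norm (\<Sum>z\<in>f -` {k}. hc (U z) *v (\<xi> x0 z *\<^sub>R (P z *v v))))\<^sup>2
          \<le> (\<Sum>z\<in>f -` {k}. (norm (\<xi> x0 z *\<^sub>R (P z *v v)))\<^sup>2)"
        by (rule U[of k, unfolded contractive_row, rule_format])
      then show "(norm (\<Sum>z\<in>f -` {k}. \<xi> x0 z *\<^sub>R a z))\<^sup>2 \<le> (\<Sum>z\<in>f -` {k}. (norm (P z *v v))\<^sup>2)"
        by (simp add: a_def mv.scaleR_right sign_abs)
    qed
    also have "\<dots> \<le> (norm v)\<^sup>2"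
      using contractiveD[OF bessel, of v] by (simp add: sum_fibres_f)
    finally show "(\<Sum>x\<in>g -` {t}. (norm (B x *v v))\<^sup>2) \<le> (norm v)\<^sup>2" .
  qed
  moreover have "(\<Sum>z\<in>UNIV. U z \<bullet> (\<Phi> z ** s))\<^sup>2 \<le> c * (\<Sum>x\<in>UNIV. (norm (B x ** \<Phi>' x))\<^sup>2)"
  proof -
    have Bx: "B x ** \<Phi>' x = (1 / sqrt (c * N)) *\<^sub>R Y" for x
    proof -
      have "(\<Sum>z\<in>UNIV. \<xi> x z *\<^sub>R (hc (U z) ** P z)) ** (\<Sum>z'\<in>UNIV. \<xi> x z' *\<^sub>R \<Phi> z')
          = (\<Sum>z\<in>UNIV. \<Sum>z'\<in>UNIV. if z' = z then hc (U z) ** \<Phi> z else 0)"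
        unfolding mm.sum_left mm.sum_right
        by (intro sum.cong refl)
          (auto simp: mm.scaleR_left mm.scaleR_right xi_square P matrix_mul_assoc[symmetric])
      then show ?thesis
        by (simp add: B_def fourier mm.scaleR_left mm.scaleR_right Y_def real_sqrt_mult)
    qed
    have "(\<Sum>z\<in>UNIV. U z \<bullet> (\<Phi> z ** s)) = Y \<bullet> s"
      unfolding Y_def inner_sum_left inner_mult_left hc_hc
      by (subst inner_commute) (simp add: inner_mult_right s)
    then have "(\<Sum>z\<in>UNIV. U z \<bullet> (\<Phi> z ** s))\<^sup>2 \<le> (norm Y * norm s)\<^sup>2"
      using Cauchy_Schwarz_ineq2[of Y s] by (metis abs_ge_zero power2_abs power_mono)
    also have "\<dots> = c * (\<Sum>x\<in>UNIV. (norm (B x ** \<Phi>' x))\<^sup>2)"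
      unfolding Bx using c_pos N_pos s
      by (simp add: power_mult_distrib power_divide card_x)
    finally show ?thesis .
  qed
  ultimately show ?thesis by (rule that)
qed

text \<open>The projections now act on the side of \<open>s\<close>. The polar factor
  \<open>K x\<close> of \<open>s ** Q x\<close> is absorbed into \<open>B x\<close>; the modulus
  \<open>r x\<close> remains. By Bessel's inequality for \<open>Q\<close> the squared norms of all
  \<open>r x\<close> add up to at most 1, so Cauchy--Schwarz over \<open>x\<close> costs no
  constant.\<close>

lemma guess_from_fidelity_x:
  fixes U :: "'z \<Rightarrow> complex^'e^'b" and s :: "'e op"
  assumes x: "\<And>x x'. x \<noteq> x' \<Longrightarrow> \<Phi>' x ** hc (\<Phi>' x') = 0"
    and U: "\<And>k. contractive (f -` {k}) U" and s: "hc s = s" "norm s = 1"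
  obtains B :: "'x \<Rightarrow> complex^'b^'e" where "\<And>t. contractive (g -` {t}) B"
    "(\<Sum>z\<in>UNIV. U z \<bullet> (\<Phi> z ** s))\<^sup>2 \<le> c * (\<Sum>x\<in>UNIV. (norm (B x ** \<Phi>' x))\<^sup>2)"
proof -
  define Q where "Q x = range_proj (hc (\<Phi>' x))" for x
  have Q: "hc (Q x) = Q x" "Q x ** Q x = Q x" "\<Phi>' x ** Q x = \<Phi>' x" for x
  proof -
    show "hc (Q x) = Q x" "Q x ** Q x = Q x"
      by (simp_all add: Q_def hc_range_proj range_proj_idem)
    then show "\<Phi>' x ** Q x = \<Phi>' x"
      using arg_cong[OF range_proj_mult[of "hc (\<Phi>' x)"], of hc] by (simp add: hc_mult Q_def)
  qed
  have QQ: "Q x ** Q x' = 0" if "x \<noteq> x'" for x x'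
  proof -
    have "Q x ** hc (\<Phi>' x') = 0"
      unfolding Q_def by (rule range_proj_orthogonal) (simp add: x[OF that])
    then show ?thesis by (simp add: Q_def[of x'] range_proj_def[of "hc (\<Phi>' x')"] matrix_mul_assoc)
  qed
  have bessel: "contractive UNIV Q"
    by (intro orthogonal_projections_contractive) (simp_all add: Q QQ)
  have "\<exists>K. (\<forall>v. norm (K *v v) \<le> norm v) \<and> s ** Q x = K ** op_sqrt (hc (s ** Q x) ** (s ** Q x))" for x
    using polar_decomposition_single[of "s ** Q x"] by metis
  then obtain K where K: "\<And>x v. norm (K x *v v) \<le> norm v"
    "\<And>x. s ** Q x = K x ** op_sqrt (hc (s ** Q x) ** (s ** Q x))"
    by metis
  define r where "r x = op_sqrt (hc (s ** Q x) ** (s ** Q x))" for x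
  have r: "hc (r x) = r x" "s ** Q x = K x ** r x" "(norm (r x))\<^sup>2 = (norm (Q x ** s))\<^sup>2" for x
  proof -
    have "(norm (r x))\<^sup>2 = (norm (s ** Q x))\<^sup>2"
      by (simp add: r_def norm_op_sqrt_sq psd_hc_mult norm_sq_eq_trace[of "s ** Q x"])
    also have "\<dots> = (norm (Q x ** s))\<^sup>2"
      using norm_hc[of "s ** Q x"] by (simp add: hc_mult Q s)
    finally show "(norm (r x))\<^sup>2 = (norm (Q x ** s))\<^sup>2" .
  qed (simp_all add: r_def hc_op_sqrt psd_hc_mult K(2)[symmetric])
  define V where "V x = (\<Sum>z\<in>UNIV. \<xi> x z *\<^sub>R U z)" for x
  define B where "B x = (1 / sqrt (c * N)) *\<^sub>R hc (V x ** K x)" for x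
  have "contractive (g -` {t}) B" for t
    unfolding contractive_row
  proof
    fix b
    define y where "y x = (if g x = t then K x *v b x else 0)" for x
    \<comment> \<open>The Fourier transform of the vectors on one fibre of \<open>g\<close>. On a
      fibre of \<open>f\<close> it is constant up to sign.\<close>
    define \<eta> where "\<eta> z = (\<Sum>x\<in>g -` {t}. \<xi> x z *\<^sub>R y x)" for z
    have \<eta>_UNIV: "\<eta> z = (\<Sum>x\<in>UNIV. \<xi> x z *\<^sub>R y x)" for z
      unfolding \<eta>_def by (intro sum.mono_neutral_left) (auto simp: y_def)
    have "(\<Sum>x\<in>g -` {t}. hc (B x) *v b x) = (1 / sqrt (c * N)) *\<^sub>R (\<Sum>x\<in>g -` {t}. V x *v y x)"
      by (simp add: B_def hc_scaleR mv.scaleR_left scaleR_sum_right y_def matrix_vector_mul_assoc)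
    also have "(\<Sum>x\<in>g -` {t}. V x *v y x) = (\<Sum>z\<in>UNIV. U z *v \<eta> z)"
      unfolding V_def \<eta>_def mv.sum_left mv.sum_right mv.scaleR_left mv.scaleR_right by (rule sum.swap)
    finally have "(norm (\<Sum>x\<in>g -` {t}. hc (B x) *v b x))\<^sup>2 = (1 / (c * N)) * (norm (\<Sum>z\<in>UNIV. U z *v \<eta> z))\<^sup>2"
      using c_pos N_pos by (simp add: power_mult_distrib power_divide)
    also have "\<dots> \<le> (1 / (c * N)) * (N * (\<Sum>z\<in>UNIV. (norm (U z *v \<eta> z))\<^sup>2))"
    proof -
      \<comment> \<open>The constants \<open>1 / (c * N)\<close> from \<open>B\<close>,
        \<open>N\<close> from Cauchy--Schwarz, \<open>1 / CARD('s)\<close> from the sign symmetry of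
        \<eta> and \<open>N\<close> from Parseval multiply to 1.\<close>
      have "(norm (\<Sum>z\<in>UNIV. U z *v \<eta> z))\<^sup>2 \<le> (\<Sum>z\<in>UNIV. norm (U z *v \<eta> z))\<^sup>2"
        by (intro power_mono norm_sum) simp
      also have "\<dots> \<le> real CARD('z) * (\<Sum>z\<in>UNIV. (norm (U z *v \<eta> z))\<^sup>2)"
        using Cauchy_Schwarz_ineq_sum[of "\<lambda>_. 1" "\<lambda>z. norm (U z *v \<eta> z)" UNIV] by simp
      finally show ?thesis using c_pos N_pos by (intro mult_left_mono) (simp_all add: card_z)
    qed
    also have "\<dots> = (1 / c) * (\<Sum>k\<in>UNIV. \<Sum>z\<in>f -` {k}. (norm (U z *v \<eta> z))\<^sup>2)"
      using N_pos by (simp add: sum_fibres_f)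
    also have "\<dots> \<le> (1 / c) * (\<Sum>k\<in>UNIV. (1 / real CARD('s)) * (\<Sum>z\<in>f -` {k}. (norm (\<eta> z))\<^sup>2))"
    proof (intro mult_left_mono sum_mono)
      fix k
      obtain z0 where z0: "f z0 = k"
        using dual_pair.fibre_g_nonempty[OF dual_pair_swap] by blast
      have \<eta>: "norm (U z *v \<eta> z) = norm (U z *v \<eta> z0)" "norm (\<eta> z) = norm (\<eta> z0)" if fz: "f z = k" for z
      proof -
        have "\<exists>\<epsilon>. \<bar>\<epsilon>\<bar> = 1 \<and> \<eta> z = \<epsilon> *\<^sub>R \<eta> z0"
          unfolding \<eta>_def by (rule norm_fibre_sum) (simp add: fz z0)
        then obtain \<epsilon> where "\<bar>\<epsilon>\<bar> = 1" "\<eta> z = \<epsilon> *\<^sub>R \<eta> z0" by blast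
        then show "norm (U z *v \<eta> z) = norm (U z *v \<eta> z0)" "norm (\<eta> z) = norm (\<eta> z0)"
          by (simp_all add: mv.scaleR_right)
      qed
      have "(\<Sum>z\<in>f -` {k}. (norm (U z *v \<eta> z))\<^sup>2) = (\<Sum>z\<in>f -` {k}. (norm (U z *v \<eta> z0))\<^sup>2)"
        using \<eta> by (intro sum.cong) auto
      also have "\<dots> \<le> (norm (\<eta> z0))\<^sup>2" by (rule contractiveD[OF U])
      also have "\<dots> = (1 / real CARD('s)) * (\<Sum>z\<in>f -` {k}. (norm (\<eta> z))\<^sup>2)"
        using \<eta> by (simp add: card_f)
      finally show "(\<Sum>z\<in>f -` {k}. (norm (U z *v \<eta> z))\<^sup>2) \<le> (1 / real CARD('s)) * (\<Sum>z\<in>f -` {k}. (norm (\<eta> z))\<^sup>2)" .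
    qed (use c_pos in simp)
    also have "\<dots> = (1 / N) * (\<Sum>z\<in>UNIV. (norm (\<eta> z))\<^sup>2)"
      by (simp add: sum_fibres_f sum_distrib_left c_def N_def)
    also have "\<dots> = (\<Sum>x\<in>UNIV. (norm (y x))\<^sup>2)"
      unfolding \<eta>_UNIV dual_pair.parseval_x[OF dual_pair_swap] dual_pair.N_def[OF dual_pair_swap]
      using N_pos by (simp add: N_def)
    also have "\<dots> = (\<Sum>x\<in>g -` {t}. (norm (y x))\<^sup>2)"
      by (intro sum.mono_neutral_right) (auto simp: y_def)
    also have "\<dots> \<le> (\<Sum>x\<in>g -` {t}. (norm (b x))\<^sup>2)"
      by (intro sum_mono power_mono) (auto simp: y_def K)
    finally show "(norm (\<Sum>x\<in>g -` {t}. hc (B x) *v b x))\<^sup>2 \<le> (\<Sum>x\<in>g -` {t}. (norm (b x))\<^sup>2)" .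
  qed
  moreover have "(\<Sum>z\<in>UNIV. U z \<bullet> (\<Phi> z ** s))\<^sup>2 \<le> c * (\<Sum>x\<in>UNIV. (norm (B x ** \<Phi>' x))\<^sup>2)"
  proof -
    \<comment> \<open>Inserting \<open>Q x\<close> after \<open>\<Phi>' x\<close> and using the
      adjoint of \<open>s ** Q x = K x ** r x\<close> moves everything except \<open>r x\<close>
      into \<open>B x\<close>.\<close>
    have summand: "\<bar>V x \<bullet> (\<Phi>' x ** s)\<bar> \<le> sqrt (c * N) * (norm (B x ** \<Phi>' x) * norm (r x))" for x
    proof -
      have "Q x ** s = r x ** hc (K x)"
        using arg_cong[OF r(2)[of x], of hc] by (simp add: hc_mult Q r(1) s)
      then have "\<Phi>' x ** s = \<Phi>' x ** r x ** hc (K x)"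
        using Q(3)[of x] by (metis matrix_mul_assoc)
      then have "V x \<bullet> (\<Phi>' x ** s) = (\<Phi>' x ** r x) \<bullet> (V x ** K x)"
        using inner_mult_right[of "V x" "K x" "\<Phi>' x ** r x"] by (simp add: inner_commute)
      also have "\<dots> = (hc (V x ** K x) ** \<Phi>' x) \<bullet> r x"
        using inner_mult_left[of "hc (V x ** K x)" "\<Phi>' x" "r x"]
          inner_mult_right[of "\<Phi>' x" "r x" "V x ** K x"] by (simp add: r)
      also have "\<dots> = sqrt (c * N) * ((B x ** \<Phi>' x) \<bullet> r x)"
        using c_pos N_pos by (simp add: B_def mm.scaleR_left)
      finally have "\<bar>V x \<bullet> (\<Phi>' x ** s)\<bar> = sqrt (c * N) * \<bar>(B x ** \<Phi>' x) \<bullet> r x\<bar>"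
        using c_pos N_pos by (simp add: abs_mult)
      then show ?thesis
        using c_pos N_pos by (simp add: mult_left_mono Cauchy_Schwarz_ineq2)
    qed
    have "(\<Sum>z\<in>UNIV. U z \<bullet> (\<Phi> z ** s)) = (1 / sqrt N) * (\<Sum>z\<in>UNIV. \<Sum>x\<in>UNIV. \<xi> x z * (U z \<bullet> (\<Phi>' x ** s)))"
      by (simp add: fourier_inverse mm.scaleR_left mm.sum_left inner_sum_right sum_distrib_left)
    also have "\<dots> = (1 / sqrt N) * (\<Sum>x\<in>UNIV. V x \<bullet> (\<Phi>' x ** s))"
      by (subst sum.swap) (simp add: V_def inner_sum_left)
    finally have "\<bar>\<Sum>z\<in>UNIV. U z \<bullet> (\<Phi> z ** s)\<bar> = (1 / sqrt N) * \<bar>\<Sum>x\<in>UNIV. V x \<bullet> (\<Phi>' x ** s)\<bar>"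
      using N_pos by (simp add: abs_mult)
    also have "\<dots> \<le> (1 / sqrt N) * (\<Sum>x\<in>UNIV. sqrt (c * N) * (norm (B x ** \<Phi>' x) * norm (r x)))"
      using N_pos by (intro mult_left_mono order_trans[OF sum_abs] sum_mono summand) simp
    also have "\<dots> = sqrt c * (\<Sum>x\<in>UNIV. norm (B x ** \<Phi>' x) * norm (r x))"
      using N_pos by (simp add: sum_distrib_left[symmetric] real_sqrt_mult)
    finally have "\<bar>\<Sum>z\<in>UNIV. U z \<bullet> (\<Phi> z ** s)\<bar>\<^sup>2 \<le> (sqrt c * (\<Sum>x\<in>UNIV. norm (B x ** \<Phi>' x) * norm (r x)))\<^sup>2"
      by (rule power_mono) simp
    also have "\<dots> = c * (\<Sum>x\<in>UNIV. norm (B x ** \<Phi>' x) * norm (r x))\<^sup>2"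
      using c_pos by (simp add: power_mult_distrib)
    also have "\<dots> \<le> c * ((\<Sum>x\<in>UNIV. (norm (B x ** \<Phi>' x))\<^sup>2) * (\<Sum>x\<in>UNIV. (norm (r x))\<^sup>2))"
      using c_pos by (intro mult_left_mono Cauchy_Schwarz_ineq_sum) simp
    also have "\<dots> \<le> c * ((\<Sum>x\<in>UNIV. (norm (B x ** \<Phi>' x))\<^sup>2) * 1)"
      using contractive_norm_mult[OF bessel, of s] c_pos s
      by (intro mult_left_mono sum_nonneg) (simp_all add: r)
    finally show ?thesis by simp
  qed
  ultimately show ?thesis by (rule that)
qed

text \<open>Here no square root is needed, because the block column \<open>U\<close> may act on a larger space.\<close>

lemma fidelity_from_guess_z:
  fixes B :: "'x \<Rightarrow> complex^'b^'d::finite"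
  assumes z: "\<And>z z'. z \<noteq> z' \<Longrightarrow> hc (\<Phi> z) ** \<Phi> z' = 0"
    and B: "\<And>t. contractive (g -` {t}) B"
  obtains U :: "'z \<Rightarrow> complex^('x \<times> 'd)^'b" where "\<And>k. contractive (f -` {k}) U"
    "c * (\<Sum>x\<in>UNIV. (norm (B x ** \<Phi>' x))\<^sup>2) = (norm (\<Sum>z\<in>UNIV. hc (U z) ** \<Phi> z))\<^sup>2"
proof -
  define P where "P z = range_proj (\<Phi> z)" for z
  have P: "hc (P z) = P z" "P z ** P z = P z" "P z ** \<Phi> z = \<Phi> z" for z
    by (auto simp: P_def hc_range_proj range_proj_idem range_proj_mult)
  have PP: "P z ** P z' = 0" if "z \<noteq> z'" for z z'
    using range_proj_orthogonal[OF z[OF that]]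
    by (simp add: P_def range_proj_def[of "\<Phi> z'"] matrix_mul_assoc)
  \<comment> \<open>The factor \<open>\<xi> x z\<close> makes the sum over \<open>z\<close> of
    \<open>V z ** \<Phi> z\<close> the stack of the multiples \<open>sqrt c\<close> of
    \<open>B x ** \<Phi>' x\<close>.\<close>
  define V where "V z = stack (\<lambda>x. (sqrt (c / N) * \<xi> x z) *\<^sub>R (B x ** P z))" for z
  define U where "U z = hc (V z)" for z
  have cN: "(sqrt (c / N))\<^sup>2 = 1 / real CARD('s)"
    using c_pos N_pos by (simp add: c_def N_def)
  have "contractive (f -` {k}) U" for k
    unfolding contractive_row
  proof
    fix b
    obtain z0 where z0: "f z0 = k"
      using dual_pair.fibre_g_nonempty[OF dual_pair_swap] by blast
    define y where "y z = P z *v b z" for z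
    define w where "w x = (\<Sum>z\<in>f -` {k}. \<xi> x z *\<^sub>R y z)" for x
    have yy: "y z \<bullet> y z' = 0" if "z \<noteq> z'" for z z'
      by (simp add: y_def inner_matrix_vector matrix_vector_mul_assoc P PP[OF that])
    \<comment> \<open>Mutually orthogonal ranges make all signed sums \<open>w x\<close> equally
      long.\<close>
    have w_norm: "(norm (w x))\<^sup>2 = (\<Sum>z\<in>f -` {k}. (norm (y z))\<^sup>2)" for x
    proof -
      have "(norm (w x))\<^sup>2 = (\<Sum>z\<in>f -` {k}. \<Sum>z'\<in>f -` {k}. if z' = z then (norm (y z))\<^sup>2 else 0)"
        unfolding w_def power2_norm_eq_inner inner_sum_left inner_sum_right
        using yy by (intro sum.cong refl) (auto simp: mult.assoc[symmetric] xi_square)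
      then show ?thesis by simp
    qed
    have "(norm (\<Sum>z\<in>f -` {k}. hc (U z) *v b z))\<^sup>2
        = (norm (stack_vec (\<lambda>x. sqrt (c / N) *\<^sub>R (B x *v w x))))\<^sup>2"
      by (simp add: U_def V_def stack_mult_vec stack_vec_sum y_def w_def mv.scaleR_left mv.scaleR_right
          mv.sum_right scaleR_sum_right matrix_vector_mul_assoc)
    also have "\<dots> = (1 / real CARD('s)) * (\<Sum>x\<in>UNIV. (norm (B x *v w x))\<^sup>2)"
      by (simp add: norm_stack_vec power_mult_distrib cN sum_distrib_left)
    also have "\<dots> = (1 / real CARD('s)) * (\<Sum>t\<in>UNIV. \<Sum>x\<in>g -` {t}. (norm (B x *v w x))\<^sup>2)"
      by (simp add: sum_fibres_g)
    also have "\<dots> \<le> (1 / real CARD('s)) * (\<Sum>t\<in>(UNIV :: 's set). \<Sum>z\<in>f -` {k}. (norm (y z))\<^sup>2)"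
    proof (intro mult_left_mono sum_mono)
      fix t
      obtain x0 where x0: "g x0 = t" using fibre_g_nonempty by blast
      have "norm (B x *v w x) = norm (B x *v w x0)" if gx: "g x = t" for x
      proof -
        have "\<exists>\<epsilon>. \<bar>\<epsilon>\<bar> = 1 \<and> w x = \<epsilon> *\<^sub>R w x0"
          unfolding w_def by (rule dual_pair.norm_fibre_sum[OF dual_pair_swap]) (simp add: gx x0)
        then obtain \<epsilon> where "\<bar>\<epsilon>\<bar> = 1" "w x = \<epsilon> *\<^sub>R w x0" by blast
        then show ?thesis by (simp add: mv.scaleR_right)
      qed
      then have "(\<Sum>x\<in>g -` {t}. (norm (B x *v w x))\<^sup>2) = (\<Sum>x\<in>g -` {t}. (norm (B x *v w x0))\<^sup>2)"
        by (intro sum.cong) auto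
      also have "\<dots> \<le> (norm (w x0))\<^sup>2" by (rule contractiveD[OF B])
      finally show "(\<Sum>x\<in>g -` {t}. (norm (B x *v w x))\<^sup>2) \<le> (\<Sum>z\<in>f -` {k}. (norm (y z))\<^sup>2)"
        by (simp add: w_norm)
    qed simp
    also have "\<dots> = (\<Sum>z\<in>f -` {k}. (norm (y z))\<^sup>2)" by simp
    also have "\<dots> \<le> (\<Sum>z\<in>f -` {k}. (norm (b z))\<^sup>2)"
      by (intro sum_mono power_mono) (auto simp: y_def P intro: norm_projection_le)
    finally show "(norm (\<Sum>z\<in>f -` {k}. hc (U z) *v b z))\<^sup>2 \<le> (\<Sum>z\<in>f -` {k}. (norm (b z))\<^sup>2)" .
  qed
  moreover have "c * (\<Sum>x\<in>UNIV. (norm (B x ** \<Phi>' x))\<^sup>2) = (norm (\<Sum>z\<in>UNIV. hc (U z) ** \<Phi> z))\<^sup>2"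
  proof -
    have "(\<Sum>z\<in>UNIV. hc (U z) ** \<Phi> z)
        = stack (\<lambda>x. sqrt (c / N) *\<^sub>R (B x ** (\<Sum>z\<in>UNIV. \<xi> x z *\<^sub>R \<Phi> z)))"
      by (simp add: U_def V_def stack_mult stack_sum mm.scaleR_left mm.scaleR_right mm.sum_right
          scaleR_sum_right matrix_mul_assoc[symmetric] P)
    also have "\<dots> = stack (\<lambda>x. sqrt c *\<^sub>R (B x ** \<Phi>' x))"
      by (simp add: fourier mm.scaleR_right real_sqrt_divide)
    finally show ?thesis
      using c_pos by (simp add: norm_stack power_mult_distrib sum_distrib_left)
  qed
  ultimately show ?thesis by (rule that)
qed

text \<open>Bessel's inequality for the supports \<open>Q x\<close> holds on the space
  \<open>'e\<close>, whereas \<open>hc (B x)\<close> starts from \<open>'d\<close>. The polar factor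
  \<open>C x\<close> of \<open>B x ** \<Phi>' x\<close> links the two. It leaves the moduli
  \<open>R x\<close>, which are mutually orthogonal, so the squared norm of their sum is the sum of
  the squared norms.\<close>

lemma fidelity_from_guess_x:
  fixes B :: "'x \<Rightarrow> complex^'b^'d::finite"
  assumes x: "\<And>x x'. x \<noteq> x' \<Longrightarrow> \<Phi>' x ** hc (\<Phi>' x') = 0"
    and B: "\<And>t. contractive (g -` {t}) B"
  obtains U :: "'z \<Rightarrow> complex^'e^'b" where "\<And>k. contractive (f -` {k}) U"
    "c * (\<Sum>x\<in>UNIV. (norm (B x ** \<Phi>' x))\<^sup>2) = (norm (\<Sum>z\<in>UNIV. hc (U z) ** \<Phi> z))\<^sup>2"
proof -
  define Q where "Q x = range_proj (hc (\<Phi>' x))" for x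
  have Q: "hc (Q x) = Q x" "Q x ** Q x = Q x" "\<Phi>' x ** Q x = \<Phi>' x" for x
  proof -
    show "hc (Q x) = Q x" "Q x ** Q x = Q x"
      by (simp_all add: Q_def hc_range_proj range_proj_idem)
    then show "\<Phi>' x ** Q x = \<Phi>' x"
      using arg_cong[OF range_proj_mult[of "hc (\<Phi>' x)"], of hc] by (simp add: hc_mult Q_def)
  qed
  have QQ: "Q x ** Q x' = 0" if "x \<noteq> x'" for x x'
  proof -
    have "Q x ** hc (\<Phi>' x') = 0"
      unfolding Q_def by (rule range_proj_orthogonal) (simp add: x[OF that])
    then show ?thesis by (simp add: Q_def[of x'] range_proj_def[of "hc (\<Phi>' x')"] matrix_mul_assoc)
  qed
  have bessel: "contractive UNIV Q"
    by (intro orthogonal_projections_contractive) (simp_all add: Q QQ)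
  define Y where "Y x = B x ** \<Phi>' x" for x
  define R where "R x = op_sqrt (hc (Y x) ** Y x)" for x
  have "\<exists>C. (\<forall>v. norm (C *v v) \<le> norm v) \<and> hc C ** Y x = R x" for x
    using polar_decomposition_single[of "Y x"] unfolding R_def by metis
  then obtain C where C: "\<And>x v. norm (C x *v v) \<le> norm v" "\<And>x. hc (C x) ** Y x = R x"
    by metis
  have R: "hc (R x) = R x" "(norm (R x))\<^sup>2 = (norm (Y x))\<^sup>2" "R x ** R x = hc (Y x) ** Y x" for x
    by (simp_all add: R_def hc_op_sqrt psd_hc_mult norm_op_sqrt_sq norm_sq_eq_trace[of "Y x"] op_sqrt_square)
  \<comment> \<open>\<open>R x\<close> and \<open>Y x\<close> have the same kernel, so
    \<open>Q x\<close> also covers the support of \<open>R x\<close>.\<close>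
  have QR: "Q x ** R x = R x" for x
  proof -
    have "Y x ** (Q x - idm) = 0"
      using Q(3)[of x] by (simp add: Y_def mm.diff_right matrix_mul_assoc[symmetric])
    then have "hc (R x) ** R x ** (Q x - idm) = 0"
      by (simp add: R matrix_mul_assoc[symmetric])
    then have "R x ** (Q x - idm) = 0" by (rule hc_mult_eq_zeroD)
    then have "hc (R x ** Q x) = hc (R x)" by (simp add: mm.diff_right)
    then show ?thesis by (simp add: hc_mult R Q)
  qed
  define U where "U z = sqrt (c / N) *\<^sub>R (\<Sum>x\<in>UNIV. \<xi> x z *\<^sub>R (hc (B x) ** (C x ** Q x)))" for z
  have cN: "(sqrt (c / N))\<^sup>2 = 1 / real CARD('s)"
    using c_pos N_pos by (simp add: c_def N_def)
  have "contractive (f -` {k}) U" for k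
    unfolding contractive_def
  proof
    fix v
    obtain z0 where z0: "f z0 = k"
      using dual_pair.fibre_g_nonempty[OF dual_pair_swap] by blast
    define u where "u x = C x *v (Q x *v v)" for x
    have "U z *v v = sqrt (c / N) *\<^sub>R (\<Sum>x\<in>UNIV. \<xi> x z *\<^sub>R (hc (B x) *v u x))" for z
      by (simp add: U_def u_def mv.scaleR_left mv.sum_left matrix_vector_mul_assoc matrix_mul_assoc)
    then have "(\<Sum>z\<in>f -` {k}. (norm (U z *v v))\<^sup>2)
        = (1 / real CARD('s)) * (\<Sum>z\<in>f -` {f z0}. (norm (\<Sum>x\<in>UNIV. \<xi> x z *\<^sub>R (hc (B x) *v u x)))\<^sup>2)"
      by (simp add: power_mult_distrib cN sum_distrib_left z0)
    also have "\<dots> = (\<Sum>t\<in>UNIV. (norm (\<Sum>x\<in>g -` {t}. \<xi> x z0 *\<^sub>R (hc (B x) *v u x)))\<^sup>2)"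
      unfolding dual_pair.parseval_fibre[OF dual_pair_swap] dual_pair.c_def[OF dual_pair_swap] by simp
    also have "\<dots> \<le> (\<Sum>t\<in>UNIV. \<Sum>x\<in>g -` {t}. (norm (Q x *v v))\<^sup>2)"
    proof (intro sum_mono)
      fix t
      have "(norm (\<Sum>x\<in>g -` {t}. hc (B x) *v (\<xi> x z0 *\<^sub>R u x)))\<^sup>2
          \<le> (\<Sum>x\<in>g -` {t}. (norm (\<xi> x z0 *\<^sub>R u x))\<^sup>2)"
        by (rule B[of t, unfolded contractive_row, rule_format])
      also have "\<dots> \<le> (\<Sum>x\<in>g -` {t}. (norm (Q x *v v))\<^sup>2)"
        by (intro sum_mono power_mono) (simp_all add: sign_abs u_def C)
      finally show "(norm (\<Sum>x\<in>g -` {t}. \<xi> x z0 *\<^sub>R (hc (B x) *v u x)))\<^sup>2 \<le> (\<Sum>x\<in>g -` {t}. (norm (Q x *v v))\<^sup>2)"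
        by (simp add: mv.scaleR_right)
    qed
    also have "\<dots> \<le> (norm v)\<^sup>2"
      using contractiveD[OF bessel, of v] by (simp add: sum_fibres_g)
    finally show "(\<Sum>z\<in>f -` {k}. (norm (U z *v v))\<^sup>2) \<le> (norm v)\<^sup>2" .
  qed
  moreover have "c * (\<Sum>x\<in>UNIV. (norm (B x ** \<Phi>' x))\<^sup>2) = (norm (\<Sum>z\<in>UNIV. hc (U z) ** \<Phi> z))\<^sup>2"
  proof -
    define A where "A x = hc (hc (B x) ** (C x ** Q x))" for x
    have A: "A x ** \<Phi>' x = R x" for x
    proof -
      have "A x ** \<Phi>' x = Q x ** (hc (C x) ** Y x)"
        by (simp add: A_def hc_mult Q Y_def matrix_mul_assoc)
      then show ?thesis by (simp add: C QR)
    qed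
    have "(\<Sum>z\<in>UNIV. hc (U z) ** \<Phi> z) = (\<Sum>z\<in>UNIV. \<Sum>x\<in>UNIV. sqrt (c / N) *\<^sub>R (A x ** (\<xi> x z *\<^sub>R \<Phi> z)))"
      by (simp add: U_def A_def[symmetric] hc_scaleR hc_sum mm.scaleR_left mm.scaleR_right mm.sum_left scaleR_sum_right)
    also have "\<dots> = (\<Sum>x\<in>UNIV. sqrt (c / N) *\<^sub>R (A x ** (\<Sum>z\<in>UNIV. \<xi> x z *\<^sub>R \<Phi> z)))"
      by (subst sum.swap) (simp add: mm.sum_right scaleR_sum_right)
    also have "\<dots> = (\<Sum>x\<in>UNIV. sqrt c *\<^sub>R (A x ** \<Phi>' x))"
      by (simp add: fourier mm.scaleR_right real_sqrt_divide)
    also have "\<dots> = sqrt c *\<^sub>R (\<Sum>x\<in>UNIV. R x)"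
      by (simp add: A scaleR_sum_right)
    finally have "(norm (\<Sum>z\<in>UNIV. hc (U z) ** \<Phi> z))\<^sup>2 = c * (norm (\<Sum>x\<in>UNIV. R x))\<^sup>2"
      using c_pos by (simp add: power_mult_distrib)
    also have "(norm (\<Sum>x\<in>UNIV. R x))\<^sup>2 = (\<Sum>x\<in>UNIV. \<Sum>x'\<in>UNIV. if x' = x then (norm (R x))\<^sup>2 else 0)"
    proof -
      have "R x \<bullet> R x' = 0" if "x \<noteq> x'" for x x'
      proof -
        have "R x \<bullet> R x' = (Q x ** R x) \<bullet> (Q x' ** R x')" by (simp add: QR)
        also have "\<dots> = R x \<bullet> ((Q x ** Q x') ** R x')"
          unfolding inner_mult_left Q by (simp add: matrix_mul_assoc)
        finally show ?thesis by (simp add: QQ[OF that])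
      qed
      then show ?thesis
        unfolding power2_norm_eq_inner inner_sum_left inner_sum_right by (intro sum.cong refl) auto
    qed
    finally show ?thesis by (simp add: R Y_def)
  qed
  ultimately show ?thesis by (rule that)
qed

end

section \<open>Measurements from states and states from measurements\<close>

context dual_pair_state
begin

text \<open>Each summand is the real part of the trace of \<open>M (g x) x\<close> against
  \<open>\<Phi>' x ** hc (\<Phi>' x)\<close>, the probability of a correct guess.\<close>

definition guess_value :: "('s \<Rightarrow> 'x \<Rightarrow> 'b op) \<Rightarrow> real" where
  "guess_value M = (\<Sum>x\<in>UNIV. \<Phi>' x \<bullet> (M (g x) x ** \<Phi>' x))"

definition fidelity_value :: "'e op \<Rightarrow> real" where
  "fidelity_value \<sigma> = (\<Sum>k\<in>UNIV. fidelity (\<Sum>z\<in>f -` {k}. hc (\<Phi> z) ** \<Phi> z) \<sigma>)"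

text \<open>The optimal contractions of the single fibres of \<open>f\<close> are glued into one
  family, which the two cases of the standard form turn into \<open>B\<close>. On each fibre of
  \<open>g\<close> the \<open>hc (B x) ** B x\<close> sum to at most the identity and are completed
  to a POVM.\<close>

lemma fidelity_le_guess:
  assumes "normalized_state \<sigma>"
  obtains M where "\<And>s. povm (M s)" "(fidelity_value \<sigma>)\<^sup>2 \<le> c * guess_value M"
proof -
  have \<sigma>: "psd \<sigma>" "(norm (op_sqrt \<sigma>))\<^sup>2 = 1"
    using assms by (simp_all add: normalized_state_def norm_op_sqrt_sq)
  then have s: "hc (op_sqrt \<sigma>) = op_sqrt \<sigma>" "norm (op_sqrt \<sigma>) = 1"
    using power2_eq_imp_eq[of "norm (op_sqrt \<sigma>)" 1] by (simp_all add: hc_op_sqrt)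
  have ex: "\<forall>k. \<exists>U. contractive (f -` {k}) U \<and> (\<Sum>z\<in>f -` {k}. U z \<bullet> (\<Phi> z ** op_sqrt \<sigma>))
      = fidelity (\<Sum>z\<in>f -` {k}. hc (\<Phi> z) ** \<Phi> z) \<sigma>"
  proof
    fix k
    obtain U where "contractive (f -` {k}) U" "(\<Sum>z\<in>f -` {k}. U z \<bullet> (\<Phi> z ** op_sqrt \<sigma>))
      = fidelity (\<Sum>z\<in>f -` {k}. hc (\<Phi> z) ** \<Phi> z) \<sigma>"
      by (rule fidelity_attained[OF \<sigma>(1) finite])
    then show "\<exists>U. contractive (f -` {k}) U \<and> (\<Sum>z\<in>f -` {k}. U z \<bullet> (\<Phi> z ** op_sqrt \<sigma>))
      = fidelity (\<Sum>z\<in>f -` {k}. hc (\<Phi> z) ** \<Phi> z) \<sigma>" by blast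
  qed
  from choice[OF ex] obtain W where W: "\<And>k. contractive (f -` {k}) (W k)"
    "\<And>k. (\<Sum>z\<in>f -` {k}. W k z \<bullet> (\<Phi> z ** op_sqrt \<sigma>)) = fidelity (\<Sum>z\<in>f -` {k}. hc (\<Phi> z) ** \<Phi> z) \<sigma>"
    by blast
  define U where "U z = W (f z) z" for z
  have U: "contractive (f -` {k}) U" for k
    using W(1)[of k] by (subst contractive_cong[of _ _ "W k"]) (auto simp: U_def)
  have "(\<Sum>z\<in>f -` {k}. U z \<bullet> (\<Phi> z ** op_sqrt \<sigma>)) = fidelity (\<Sum>z\<in>f -` {k}. hc (\<Phi> z) ** \<Phi> z) \<sigma>" for k
    unfolding W(2)[symmetric] by (intro sum.cong) (auto simp: U_def)
  then have val: "fidelity_value \<sigma> = (\<Sum>z\<in>UNIV. U z \<bullet> (\<Phi> z ** op_sqrt \<sigma>))"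
    by (simp add: fidelity_value_def sum_fibres_f)
  obtain B :: "'x \<Rightarrow> complex^'b^'e" where B: "\<And>t. contractive (g -` {t}) B"
    "(fidelity_value \<sigma>)\<^sup>2 \<le> c * (\<Sum>x\<in>UNIV. (norm (B x ** \<Phi>' x))\<^sup>2)"
    using standard
  proof
    assume "\<forall>z z'. z \<noteq> z' \<longrightarrow> hc (\<Phi> z) ** \<Phi> z' = 0"
    then have z: "\<And>z z'. z \<noteq> z' \<Longrightarrow> hc (\<Phi> z) ** \<Phi> z' = 0" by blast
    show thesis by (rule guess_from_fidelity_z[OF z U s], assumption) (rule that, auto simp: val)
  next
    assume "\<forall>x x'. x \<noteq> x' \<longrightarrow> \<Phi>' x ** hc (\<Phi>' x') = 0"
    then have x: "\<And>x x'. x \<noteq> x' \<Longrightarrow> \<Phi>' x ** hc (\<Phi>' x') = 0" by blast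
    show thesis by (rule guess_from_fidelity_x[OF x U s], assumption) (rule that, auto simp: val)
  qed
  \<comment> \<open>The part of the identity still missing; spreading it evenly over all outcomes
    can only increase the success.\<close>
  define Z where "Z t = idm - (\<Sum>x\<in>g -` {t}. hc (B x) ** B x)" for t
  have Z: "psd (Z t)" for t
    unfolding psd_iff
  proof safe
    show "hc (Z t) = Z t" by (simp add: Z_def hc_diff hc_sum hc_mult)
    fix v
    have "v \<bullet> (Z t *v v) = (norm v)\<^sup>2 - (\<Sum>x\<in>g -` {t}. (norm (B x *v v))\<^sup>2)"
      by (simp add: Z_def mv.diff_left mv.sum_left inner_diff_right inner_sum_right
          norm_matrix_vector_sq power2_norm_eq_inner[of v])
    then show "0 \<le> v \<bullet> (Z t *v v)" using contractiveD[OF B(1)[of t], of v] by simp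
  qed
  define M where "M t x = (if g x = t then hc (B x) ** B x else 0) + (1 / real CARD('x)) *\<^sub>R Z t" for t x
  have psdM: "psd (M t x)" for t x
    unfolding M_def using Z by (intro psd_add psd_scaleR) (auto simp: psd_hc_mult)
  have "(\<Sum>x\<in>UNIV. if g x = t then hc (B x) ** B x else 0) = (\<Sum>x\<in>g -` {t}. hc (B x) ** B x)" for t
    by (intro sum.mono_neutral_cong_right) auto
  moreover have "(\<Sum>x\<in>(UNIV :: 'x set). (1 / real CARD('x)) *\<^sub>R Z t) = Z t" for t
    unfolding scaleR_sum_left[symmetric] by simp
  ultimately have "(\<Sum>x\<in>UNIV. M t x) = idm" for t
    by (simp add: M_def sum.distrib Z_def)
  with psdM have "povm (M t)" for t
    by (simp add: povm_def)
  moreover have "(\<Sum>x\<in>UNIV. (norm (B x ** \<Phi>' x))\<^sup>2) \<le> guess_value M"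
    unfolding guess_value_def
  proof (rule sum_mono)
    fix x
    have "\<Phi>' x \<bullet> (M (g x) x ** \<Phi>' x) = (norm (B x ** \<Phi>' x))\<^sup>2 + (1 / real CARD('x)) * (\<Phi>' x \<bullet> (Z (g x) ** \<Phi>' x))"
      by (simp add: M_def mm.add_left mm.scaleR_left inner_add_right power2_norm_eq_inner inner_mult_left matrix_mul_assoc)
    then show "(norm (B x ** \<Phi>' x))\<^sup>2 \<le> \<Phi>' x \<bullet> (M (g x) x ** \<Phi>' x)"
      using psd_inner_conj_nonneg[OF Z[of "g x"], of "\<Phi>' x"] by simp
  qed
  ultimately show ?thesis
    using B(2) c_pos by (intro that[of M]) (auto intro!: order_trans[OF B(2)] mult_left_mono)
qed

lemma fidelity_value_ge_norm:
  fixes U :: "'z \<Rightarrow> complex^'d::finite^'b"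
  assumes "\<And>k. contractive (f -` {k}) U"
  obtains \<sigma> where "normalized_state \<sigma>" "(norm (\<Sum>z\<in>UNIV. hc (U z) ** \<Phi> z))\<^sup>2 \<le> (fidelity_value \<sigma>)\<^sup>2"
proof -
  obtain \<sigma> where "normalized_state \<sigma>" "norm (\<Sum>z\<in>UNIV. hc (U z) ** \<Phi> z) \<le> fidelity_value \<sigma>"
    using sum_fidelity_ge_norm[OF assms, of \<Phi>] unfolding fidelity_value_def by blast
  then show ?thesis by (intro that[of \<sigma>] power_mono) auto
qed

text \<open>Only the outcomes \<open>x\<close> with \<open>g x = t\<close> of the POVM
  \<open>M t\<close> count; their square roots are contractive on the fibre because all outcomes sum
  to the identity.\<close>

lemma guess_le_fidelity:
  assumes M: "\<And>s. povm (M s)"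
  obtains \<sigma> where "normalized_state \<sigma>" "c * guess_value M \<le> (fidelity_value \<sigma>)\<^sup>2"
proof -
  have psdM: "psd (M t x)" for t x using M by (simp add: povm_def)
  define B where "B x = op_sqrt (M (g x) x)" for x
  have BB: "hc (B x) ** B x = M (g x) x" for x
    by (simp add: B_def hc_op_sqrt psdM op_sqrt_square)
  have B: "contractive (g -` {t}) B" for t
    unfolding contractive_def
  proof
    fix v
    have "(\<Sum>x\<in>g -` {t}. (norm (B x *v v))\<^sup>2) = (\<Sum>x\<in>g -` {t}. v \<bullet> (M t x *v v))"
      unfolding norm_matrix_vector_sq BB by (intro sum.cong) auto
    also have "\<dots> \<le> (\<Sum>x\<in>UNIV. v \<bullet> (M t x *v v))"
      by (intro sum_mono2) (auto intro: psd_form_nonneg psdM)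
    also have "\<dots> = v \<bullet> ((\<Sum>x\<in>UNIV. M t x) *v v)"
      by (simp add: mv.sum_left inner_sum_right)
    also have "\<dots> = (norm v)\<^sup>2"
      using M[of t] by (simp add: povm_def power2_norm_eq_inner)
    finally show "(\<Sum>x\<in>g -` {t}. (norm (B x *v v))\<^sup>2) \<le> (norm v)\<^sup>2" .
  qed
  have val: "guess_value M = (\<Sum>x\<in>UNIV. (norm (B x ** \<Phi>' x))\<^sup>2)"
    by (simp add: guess_value_def power2_norm_eq_inner inner_mult_left matrix_mul_assoc BB)
  from standard show thesis
  proof
    assume "\<forall>z z'. z \<noteq> z' \<longrightarrow> hc (\<Phi> z) ** \<Phi> z' = 0"
    then have z: "\<And>z z'. z \<noteq> z' \<Longrightarrow> hc (\<Phi> z) ** \<Phi> z' = 0" by blast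
    obtain U :: "'z \<Rightarrow> complex^('x \<times> 'b)^'b" where U: "\<And>k. contractive (f -` {k}) U"
      "c * guess_value M = (norm (\<Sum>z\<in>UNIV. hc (U z) ** \<Phi> z))\<^sup>2"
      unfolding val by (rule fidelity_from_guess_z[OF z B], assumption) blast
    obtain \<sigma> where "normalized_state \<sigma>" "c * guess_value M \<le> (fidelity_value \<sigma>)\<^sup>2"
      unfolding U(2) using fidelity_value_ge_norm[OF U(1)] by blast
    then show thesis by (rule that)
  next
    assume "\<forall>x x'. x \<noteq> x' \<longrightarrow> \<Phi>' x ** hc (\<Phi>' x') = 0"
    then have x: "\<And>x x'. x \<noteq> x' \<Longrightarrow> \<Phi>' x ** hc (\<Phi>' x') = 0" by blast
    obtain U :: "'z \<Rightarrow> complex^'e^'b" where U: "\<And>k. contractive (f -` {k}) U"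
      "c * guess_value M = (norm (\<Sum>z\<in>UNIV. hc (U z) ** \<Phi> z))\<^sup>2"
      unfolding val by (rule fidelity_from_guess_x[OF x B], assumption) blast
    obtain \<sigma> where "normalized_state \<sigma>" "c * guess_value M \<le> (fidelity_value \<sigma>)\<^sup>2"
      unfolding U(2) using fidelity_value_ge_norm[OF U(1)] by blast
    then show thesis by (rule that)
  qed
qed

end

section \<open>Characters of bit strings\<close>

lemma bits_vec_carrier [simp]: "bits_vec (x :: 'n::len0 bits) \<in> carrier_vec LENGTH('n)"
  by (rule bits_vec)

lemma dim_bits_vec [simp]: "dim_vec (bits_vec (x :: 'n::len0 bits)) = LENGTH('n)"
  using bits_vec_carrier[of x] by simp

lemma bits_vec_add: "bits_vec (x + y) = bits_vec x + bits_vec y" for x y :: "'n::len0 bits"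
  unfolding plus_bits_def by (rule Bits_inverse) simp

lemma bits_vec_zero: "bits_vec (0 :: 'n::len0 bits) = 0\<^sub>v LENGTH('n)"
  unfolding zero_bits_def by (rule Bits_inverse) simp

lemma bit_add_self [simp]: "(b :: bit) + b = 0"
  by (cases b) simp_all

lemma bits_add_self [simp]: "(x :: 'n::len0 bits) + x = 0"
  by (intro bits_vec_inject[THEN iffD1] eq_vecI) (simp_all add: bits_vec_add bits_vec_zero)

lemma bits_add_add_cancel [simp]: "x + y + y = x" for x y :: "'n::len0 bits"
  by (simp add: add.assoc)

lemma bits_add_eq_zero_iff: "x + y = 0 \<longleftrightarrow> x = y" for x y :: "'n::len0 bits"
proof
  assume "x + y = 0"
  then have "x + y + y = 0 + y" by (rule arg_cong)
  then show "x = y" by simp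
qed simp

definition bit_sign :: "bit \<Rightarrow> real" where
  "bit_sign b = (if b = 1 then - 1 else 1)"

lemma bit_sign_simps [simp]: "bit_sign 0 = 1" "bit_sign 1 = - 1"
  by (simp_all add: bit_sign_def)

lemma bit_sign_add: "bit_sign (a + b) = bit_sign a * bit_sign b"
  by (cases a; cases b) simp_all

lemma bit_sign_sum: "bit_sign (\<Sum>i\<in>I. h i) = (\<Prod>i\<in>I. bit_sign (h i))"
proof (induction I rule: infinite_finite_induct)
  case (insert i I)
  then have "(\<Sum>j\<in>insert i I. h j) = h i + (\<Sum>j\<in>I. h j)" by (intro sum.insert)
  with insert show ?case by (simp only: bit_sign_add prod.insert not_False_eq_True)
qed simp_all

definition character :: "'n::len0 bits \<Rightarrow> 'n bits \<Rightarrow> real" where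
  "character x z = bit_sign (scalar_prod (bits_vec x) (bits_vec z))"

lemma character_commute: "character x z = character z x"
  unfolding character_def by (subst comm_scalar_prod[OF bits_vec_carrier bits_vec_carrier]) (rule refl)

lemma character_add_left: "character (x + y) z = character x z * character y z"
  unfolding character_def bits_vec_add
  by (subst add_scalar_prod_distrib[OF bits_vec_carrier bits_vec_carrier bits_vec_carrier]) (rule bit_sign_add)

lemma character_add_right: "character x (z + w) = character x z * character x w"
  by (simp add: character_commute[of x] character_add_left)

lemma character_zero_left [simp]: "character 0 z = 1"
  by (simp add: character_def bits_vec_zero)

lemma character_square: "character x z * character x z = 1"
  using character_add_left[of x x z] by simp

lemma character_cases: "character x z = 1 \<or> character x z = - 1"
  by (simp add: character_def bit_sign_def)

lemma character_nondegenerate: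
  fixes z :: "'n::len0 bits"
  assumes "z \<noteq> 0" shows "\<exists>y. character y z = - 1"
proof -
  have "bits_vec z \<noteq> 0\<^sub>v LENGTH('n)"
    using assms bits_vec_inject[of z 0] by (simp add: bits_vec_zero)
  moreover have "bits_vec z = 0\<^sub>v LENGTH('n)" if "\<forall>i<LENGTH('n). vec_index (bits_vec z) i = 0"
    using that by (intro eq_vecI) simp_all
  ultimately obtain i where i: "i < LENGTH('n)" "vec_index (bits_vec z) i \<noteq> 0"
    by blast
  define y :: "'n bits" where "y = Bits (unit_vec LENGTH('n) i)"
  have "bits_vec y = unit_vec LENGTH('n) i"
    unfolding y_def by (rule Bits_inverse) simp
  then have "scalar_prod (bits_vec y) (bits_vec z) = vec_index (bits_vec z) i"
    using scalar_prod_left_unit[OF bits_vec_carrier i(1), of z] by simp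
  moreover have "vec_index (bits_vec z) i = 1"
    using i(2) by (simp add: bit_not_zero_iff)
  ultimately show ?thesis
    by (intro exI[of _ y]) (simp add: character_def)
qed

text \<open>Translation by \<open>y\<close> permutes \<open>S\<close> and reverses the sign of every
  term.\<close>

lemma character_sum_zero:
  assumes "\<And>x. x \<in> S \<Longrightarrow> x + y \<in> S" "character y u = - 1"
  shows "(\<Sum>x\<in>S. character x u) = 0"
proof -
  have "bij_betw (\<lambda>x. x + y) S S"
    by (rule bij_betw_byWitness[where f' = "\<lambda>x. x + y"]) (auto simp: assms(1))
  then have "(\<Sum>x\<in>S. character x u) = (\<Sum>x\<in>S. character (x + y) u)"
    by (rule sum.reindex_bij_betw[symmetric])
  also have "\<dots> = - (\<Sum>x\<in>S. character x u)"
    by (simp add: character_add_left assms(2) sum_negf)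
  finally show ?thesis by simp
qed

lemma character_orthogonal: "z \<noteq> z' \<Longrightarrow> (\<Sum>x\<in>UNIV. character x z * character x z') = 0"
proof -
  assume "z \<noteq> z'"
  then obtain y where "character y (z + z') = - 1"
    using character_nondegenerate[of "z + z'"] by (auto simp: bits_add_eq_zero_iff)
  then show ?thesis
    unfolding character_add_right[symmetric] by (intro character_sum_zero[of _ y]) simp_all
qed

lemma UNIV_bit: "(UNIV :: bit set) = {0, 1}"
  by (auto simp: bit_not_one_iff)

lemma card_bits: "CARD('n::len0 bits) = 2 ^ LENGTH('n)"
proof -
  let ?L = "{xs :: bit list. set xs \<subseteq> UNIV \<and> length xs = LENGTH('n)}"
  let ?l = "\<lambda>x :: 'n bits. list_of_vec (bits_vec x)"
  have "inj ?l"
    by (intro injI) (metis vec_list bits_vec_inject)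
  moreover have "range ?l = ?L"
  proof (intro subset_antisym subsetI)
    fix xs assume "xs \<in> ?L"
    then have "vec_of_list xs \<in> carrier_vec LENGTH('n)"
      by (intro carrier_vecI) simp
    then have "?l (Bits (vec_of_list xs)) = xs"
      by (simp add: Bits_inverse list_vec)
    then show "xs \<in> range ?l" by (metis rangeI)
  qed auto
  ultimately have "CARD('n bits) = card ?L"
    using card_image[of ?l UNIV] by simp
  also have "\<dots> = CARD(bit) ^ LENGTH('n)"
    by (rule card_lists_length_eq) (simp add: UNIV_bit)
  also have "CARD(bit) = 2"
    by (simp add: UNIV_bit)
  finally show ?thesis .
qed

section \<open>Linear functions and their annihilators\<close>

lemma bits_vec_matrix_fun:
  fixes x :: "'n::len0 bits"
  assumes "M \<in> carrier_mat LENGTH('m::len0) LENGTH('n)"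
  shows "bits_vec (matrix_fun M x :: 'm bits) = M *\<^sub>v bits_vec x"
  unfolding matrix_fun_def using assms by (intro Bits_inverse mult_mat_vec_carrier) auto

lemma matrix_fun_add:
  fixes x y :: "'n::len0 bits"
  assumes "M \<in> carrier_mat LENGTH('m::len0) LENGTH('n)"
  shows "(matrix_fun M (x + y) :: 'm bits) = matrix_fun M x + matrix_fun M y"
  by (intro bits_vec_inject[THEN iffD1])
    (simp add: bits_vec_add bits_vec_matrix_fun[OF assms] mult_add_distrib_mat_vec[OF assms])

lemma character_transpose:
  fixes x :: "'n::len0 bits" and w :: "'m::len0 bits"
  assumes "M \<in> carrier_mat LENGTH('m) LENGTH('n)"
  shows "character x (matrix_fun (transpose_mat M) w) = character (matrix_fun M x) w"
  using transpose_vec_mult_scalar[OF assms bits_vec_carrier bits_vec_carrier, of w x] assms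
  by (subst character_commute, subst character_commute)
    (simp add: character_def bits_vec_matrix_fun)

lemma matrix_fun_orthogonal:
  fixes w :: "'l::len0 bits"
  assumes F: "F \<in> carrier_mat LENGTH('m::len0) LENGTH('n::len0)" and G: "G \<in> carrier_mat LENGTH('l) LENGTH('n)"
    and FG: "F * transpose_mat G = 0\<^sub>m LENGTH('m) LENGTH('l)"
  shows "(matrix_fun F (matrix_fun (transpose_mat G) w :: 'n bits) :: 'm bits) = 0"
proof (rule bits_vec_inject[THEN iffD1])
  have "bits_vec (matrix_fun F (matrix_fun (transpose_mat G) w :: 'n bits) :: 'm bits)
      = (F * transpose_mat G) *\<^sub>v bits_vec w"
    using F G by (simp add: bits_vec_matrix_fun assoc_mult_mat_vec[OF F, of _ "LENGTH('l)"])
  then show "bits_vec (matrix_fun F (matrix_fun (transpose_mat G) w :: 'n bits) :: 'm bits) = bits_vec (0 :: 'm bits)"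
    unfolding FG bits_vec_zero by (auto intro!: eq_vecI)
qed

lemma dual_functions_swap: "dual_functions f g \<Longrightarrow> dual_functions g f"
  for f :: "'n::len0 bits \<Rightarrow> 'm::len0 bits" and g :: "'n bits \<Rightarrow> 'l::len0 bits"
  unfolding dual_functions_def
proof (elim bexE conjE)
  fix F G assume F: "F \<in> carrier_mat LENGTH('m) LENGTH('n)" and G: "G \<in> carrier_mat LENGTH('l) LENGTH('n)"
    and "f = matrix_fun F" "g = matrix_fun G" "surj f" "surj g"
    and FG: "F * transpose_mat G = 0\<^sub>m LENGTH('m) LENGTH('l)"
  moreover have "G * transpose_mat F = 0\<^sub>m LENGTH('l) LENGTH('m)"
    using arg_cong[OF FG, of transpose_mat] transpose_mult[OF F, of "transpose_mat G" "LENGTH('l)"] G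
    by simp
  ultimately show "\<exists>F \<in> carrier_mat LENGTH('l) LENGTH('n). \<exists>G \<in> carrier_mat LENGTH('m) LENGTH('n).
       g = matrix_fun F \<and> f = matrix_fun G \<and> surj g \<and> surj f \<and>
       F * transpose_mat G = 0\<^sub>m LENGTH('l) LENGTH('m)"
    by (intro bexI[of _ G] bexI[of _ F]) simp_all
qed

lemma dual_functions_add:
  assumes "dual_functions f g"
  shows "f (x + y) = f x + f y"
  using assms unfolding dual_functions_def by (auto simp: matrix_fun_add)

lemma dual_functions_card_fibre:
  fixes f :: "'n::len0 bits \<Rightarrow> 'm::len0 bits"
  assumes d: "dual_functions f g" and le: "LENGTH('m) \<le> LENGTH('n)"
  shows "card (f -` {k}) = 2 ^ (LENGTH('n) - LENGTH('m))"
proof -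
  have fib: "card (f -` {k}) = card (f -` {0})" for k
  proof -
    obtain x0 where x0: "f x0 = k" using d unfolding dual_functions_def by (metis surjD)
    have "bij_betw (\<lambda>x. x + x0) (f -` {0}) (f -` {k})"
      by (rule bij_betw_byWitness[where f' = "\<lambda>x. x + x0"])
        (auto simp: dual_functions_add[OF d] x0)
    then show ?thesis by (rule bij_betw_same_card[symmetric])
  qed
  have "CARD('n bits) = (\<Sum>k\<in>UNIV. card (f -` {k}))"
    using sum.group[of UNIV UNIV f "\<lambda>_. 1 :: nat"] by (simp add: vimage_def)
  also have "\<dots> = (\<Sum>k\<in>(UNIV :: 'm bits set). card (f -` {0}))"
    by (intro sum.cong refl fib)
  also have "\<dots> = CARD('m bits) * card (f -` {0})"
    by simp
  finally have "2 ^ LENGTH('n) = 2 ^ LENGTH('m) * card (f -` {0})"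
    by (simp add: card_bits)
  also have "(2 :: nat) ^ LENGTH('n) = 2 ^ LENGTH('m) * 2 ^ (LENGTH('n) - LENGTH('m))"
    using le by (simp add: power_add[symmetric])
  finally show ?thesis unfolding fib[of k] by simp
qed

text \<open>The transpose of \<open>F\<close> supplies \<open>y\<close>: its image lies in the
  kernel of \<open>g\<close> by duality, and pairing it with \<open>u\<close> amounts to pairing
  \<open>w\<close> with \<open>f u\<close>.\<close>

lemma dual_functions_separate:
  fixes f :: "'n::len0 bits \<Rightarrow> 'm::len0 bits" and g :: "'n bits \<Rightarrow> 'l::len0 bits"
  assumes "dual_functions f g" "f u \<noteq> 0"
  shows "\<exists>y. g y = 0 \<and> character y u = - 1"
proof -
  obtain F G where F: "F \<in> carrier_mat LENGTH('m) LENGTH('n)" and G: "G \<in> carrier_mat LENGTH('l) LENGTH('n)"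
    and fg: "f = matrix_fun F" "g = matrix_fun G" and GF: "G * transpose_mat F = 0\<^sub>m LENGTH('l) LENGTH('m)"
    using dual_functions_swap[OF assms(1)] unfolding dual_functions_def by blast
  obtain w where w: "character w (f u) = - 1"
    using character_nondegenerate[OF assms(2)] by blast
  define y :: "'n bits" where "y = matrix_fun (transpose_mat F) w"
  have "character u y = - 1"
    unfolding y_def character_transpose[OF F] using w by (simp add: fg(1) character_commute[of w])
  then have "character y u = - 1"
    by (simp add: character_commute[of u])
  moreover have "g y = 0"
    unfolding y_def fg by (rule matrix_fun_orthogonal[OF G F GF])
  ultimately show ?thesis by blast
qed

text \<open>The range of the transpose of \<open>G\<close> has as many elements as the kernel of \<open>F\<close>, which contains it.\<close>

lemma dual_functions_annihilate:
  fixes f :: "'n::len0 bits \<Rightarrow> 'm::len0 bits" and g :: "'n bits \<Rightarrow> 'l::len0 bits"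
  assumes d: "dual_functions f g" and le: "LENGTH('m) \<le> LENGTH('n)" and l: "LENGTH('l) = LENGTH('n) - LENGTH('m)"
    and u: "f u = 0" and y: "g y = 0"
  shows "character y u = 1"
proof -
  obtain F G where F: "F \<in> carrier_mat LENGTH('m) LENGTH('n)" and G: "G \<in> carrier_mat LENGTH('l) LENGTH('n)"
    and fg: "f = matrix_fun F" "g = matrix_fun G" and FG: "F * transpose_mat G = 0\<^sub>m LENGTH('m) LENGTH('l)"
    and surj: "surj g"
    using d unfolding dual_functions_def by blast
  define T :: "'l bits \<Rightarrow> 'n bits" where "T = matrix_fun (transpose_mat G)"
  have T_add: "T (v + w) = T v + T w" for v w
    unfolding T_def using G by (intro matrix_fun_add) simp
  have T_char: "character x (T w) = character (g x) w" for x w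
    unfolding T_def fg by (rule character_transpose[OF G])
  have "T w = 0 \<Longrightarrow> w = 0" for w
  proof (rule ccontr)
    assume "T w = 0" "w \<noteq> 0"
    then obtain v where v: "character v w = - 1" using character_nondegenerate by blast
    obtain x where "g x = v" using surj by (metis surjD)
    then have "character x (T w) = - 1" by (simp add: T_char v)
    then show False using \<open>T w = 0\<close> character_commute[of x 0] by simp
  qed
  then have "inj T"
    by (intro injI) (metis T_add bits_add_eq_zero_iff)
  then have "card (range T) = card (f -` {0})"
    using dual_functions_card_fibre[OF d le, of 0] by (simp add: card_image card_bits l)
  moreover have "range T \<subseteq> f -` {0}"
    unfolding T_def fg using matrix_fun_orthogonal[OF F G FG] by auto
  ultimately have "range T = f -` {0}"
    by (intro card_subset_eq) simp_all
  then obtain w where "u = T w" using u by blast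
  then show ?thesis by (simp add: T_char y)
qed

lemma dual_functions_character_sum:
  fixes f :: "'n::len0 bits \<Rightarrow> 'm::len0 bits" and g :: "'n bits \<Rightarrow> 'l::len0 bits"
  assumes d: "dual_functions f g" and "f z \<noteq> f z'"
  shows "(\<Sum>x\<in>g -` {s}. character x z * character x z') = 0"
proof -
  have "f (z + z') \<noteq> 0"
    using assms(2) by (simp add: dual_functions_add[OF d] bits_add_eq_zero_iff)
  then obtain y where "g y = 0" "character y (z + z') = - 1"
    using dual_functions_separate[OF d] by blast
  then show ?thesis
    unfolding character_add_right[symmetric]
    by (intro character_sum_zero[of _ y]) (auto simp: dual_functions_add[OF dual_functions_swap[OF d]])
qed

lemma dual_functions_dual_pair:
  fixes f :: "'n::len0 bits \<Rightarrow> 'm::len0 bits" and g :: "'n bits \<Rightarrow> 'l::len0 bits"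
  assumes d: "dual_functions f g" and le: "LENGTH('m) \<le> LENGTH('n)" and l: "LENGTH('l) = LENGTH('n) - LENGTH('m)"
  shows "dual_pair character f g"
proof
  show "card (f -` {k}) = CARD('l bits)" for k
    by (simp add: dual_functions_card_fibre[OF d le] card_bits l)
  show "card (g -` {s}) = CARD('m bits)" for s
    using dual_functions_card_fibre[OF dual_functions_swap[OF d], of s] le l by (simp add: card_bits)
  fix z z' x x'
  assume "f z = f z'" "g x = g x'"
  then have "character (x + x') (z + z') = 1"
    by (intro dual_functions_annihilate[OF d le l])
      (simp_all add: dual_functions_add[OF d] dual_functions_add[OF dual_functions_swap[OF d]])
  then show "character x z * character x z' = character x' z * character x' z'"
    unfolding character_add_left character_add_right
    using character_cases[of x z] character_cases[of x z'] character_cases[of x' z] character_cases[of x' z']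
    by auto
next
  show "g x \<noteq> g x' \<Longrightarrow> (\<Sum>z\<in>f -` {k}. character x z * character x' z) = 0" for x x' k
    using dual_functions_character_sum[OF dual_functions_swap[OF d], of x x' k]
    by (simp add: character_commute[of x] character_commute[of x'])
  show "x \<noteq> x' \<Longrightarrow> (\<Sum>z\<in>UNIV. character x z * character x' z) = 0" for x x' :: "'n bits"
    using character_orthogonal[of x x'] by (simp add: character_commute[of x] character_commute[of x'])
qed (auto simp: character_square character_orthogonal dual_functions_character_sum[OF d])

text \<open>The pair for the entropies: the identity has \<open>c\<close> equal to 2^n, and the
  constant makes guessing proceed without a syndrome.\<close>

lemma trivial_dual_pair: "dual_pair (character :: 'n::len0 bits \<Rightarrow> 'n bits \<Rightarrow> real) id (\<lambda>_. ())"
proof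
  show "x \<noteq> x' \<Longrightarrow> (\<Sum>z\<in>UNIV. character x z * character x' z) = 0" for x x' :: "'n bits"
    using character_orthogonal[of x x'] by (simp add: character_commute[of x] character_commute[of x'])
qed (auto simp: character_square character_orthogonal vimage_def)

lemma ket_x_nth: "ket_x x $ z = complex_of_real (character x z / sqrt (2 ^ LENGTH('n)))"
  for x z :: "'n::len0 bits"
proof -
  have "qubit_x s t = complex_of_real (bit_sign (s * t) / sqrt 2)" for s t
    by (cases s; cases t) (simp_all add: qubit_x_def)
  then have "ket_x x $ z = complex_of_real ((\<Prod>i<LENGTH('n). bit_sign (bit_at x i * bit_at z i)) / sqrt 2 ^ LENGTH('n))"
    by (simp add: ket_x_def prod_dividef)
  also have "(\<Prod>i<LENGTH('n). bit_sign (bit_at x i * bit_at z i)) = character x z"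
    unfolding character_def scalar_prod_def bit_sign_sum bit_at_def dim_bits_vec lessThan_atLeast0 ..
  finally show ?thesis by (simp add: real_sqrt_power)
qed

section \<open>Duality for the guessing probability\<close>

lemma psd_inner_nonneg:
  assumes "psd A" "psd B" shows "0 \<le> A \<bullet> B"
proof -
  have "A \<bullet> B = (A ** hc (op_sqrt B)) \<bullet> op_sqrt B"
    using assms(2) by (simp add: inner_mult_right op_sqrt_square)
  also have "\<dots> = op_sqrt B \<bullet> (A ** op_sqrt B)"
    using assms(2) by (simp add: hc_op_sqrt inner_commute)
  also have "0 \<le> \<dots>" by (rule psd_inner_conj_nonneg[OF assms(1)])
  finally show ?thesis .
qed

lemma inner_outer: "A \<bullet> outer v = (A *v v) \<bullet> v" for A :: "'a::finite op"
proof -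
  have "(\<Sum>i\<in>UNIV. \<Sum>j\<in>UNIV. cnj (A $ i $ j) * outer v $ i $ j)
      = (\<Sum>i\<in>UNIV. cnj ((A *v v) $ i) * v $ i)"
    by (simp add: outer_def matrix_vector_mult_def sum_distrib_right sum_distrib_left mult_ac)
  then show ?thesis
    by (simp add: inner_eq_Re_sum inner_vec_eq_Re_sum)
qed

lemma psd_outer: "psd (outer v)"
  unfolding psd_iff
proof safe
  show "hc (outer v) = outer v"
    by (simp add: outer_def hc_def Finite_Cartesian_Product.vec_eq_iff mult.commute)
  fix w
  have "outer v *v w = cdot v w *s v"
    by (simp add: outer_def cdot_def matrix_vector_mult_def Finite_Cartesian_Product.vec_eq_iff
        sum_distrib_left mult_ac)
  then have "cdot w (outer v *v w) = cnj (cdot v w) * cdot v w"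
    using cdot_commute[of w v] by (simp add: cdot_cscale_right mult.commute)
  then show "0 \<le> w \<bullet> (outer v *v w)"
    unfolding Re_cdot[symmetric] by simp
qed

text \<open>Self-duality of the positive cone; rank-one \<open>S\<close> suffice as tests.\<close>

lemma psdI_inner:
  assumes "hc A = A" "\<And>S. psd S \<Longrightarrow> 0 \<le> A \<bullet> S" shows "psd A"
  unfolding psd_iff
proof safe
  fix v
  show "0 \<le> v \<bullet> (A *v v)"
    using assms(2)[OF psd_outer[of v]] by (simp add: inner_outer inner_commute)
qed (rule assms(1))

lemma psd_trace_le_zero: assumes "psd A" "Re (trace A) \<le> 0" shows "A = 0"
proof -
  have "(norm (op_sqrt A))\<^sup>2 \<le> 0"
    using assms by (simp add: norm_op_sqrt_sq)
  then have "op_sqrt A = 0" by simp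
  then show ?thesis using op_sqrt_square[OF assms(1)] by simp
qed

lemma guess_weak_duality:
  assumes \<sigma>: "\<And>z. psd (\<sigma> - \<rho> z)" and M: "povm M"
  shows "(\<Sum>z\<in>UNIV. \<rho> z \<bullet> M z) \<le> Re (trace \<sigma>)"
proof -
  have "(\<Sum>z\<in>UNIV. \<rho> z \<bullet> M z) \<le> (\<Sum>z\<in>UNIV. \<sigma> \<bullet> M z)"
  proof (rule sum_mono)
    fix z
    have "0 \<le> (\<sigma> - \<rho> z) \<bullet> M z"
      using M by (intro psd_inner_nonneg \<sigma>) (simp add: povm_def)
    then show "\<rho> z \<bullet> M z \<le> \<sigma> \<bullet> M z" by (simp add: inner_diff_left)
  qed
  also have "\<dots> = \<sigma> \<bullet> (\<Sum>z\<in>UNIV. M z)"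
    by (simp add: inner_sum_right)
  also have "\<dots> = Re (trace \<sigma>)"
    using M by (simp add: povm_def inner_commute[of \<sigma>] inner_one_left)
  finally show ?thesis .
qed

lemma completed_povm:
  fixes M :: "'z::finite \<Rightarrow> 'e::finite op"
  assumes "\<And>z. psd (M z)" "psd (idm - (\<Sum>z\<in>UNIV. M z))"
  shows "povm (\<lambda>z. M z + (if z = z0 then idm - (\<Sum>z\<in>UNIV. M z) else 0))"
  using assms by (auto simp: povm_def sum.distrib intro: psd_add)

text \<open>Separate \<open>(1, q)\<close> from the convex cone of all \<open>(S, t)\<close> such that \<open>t\<close> is at most the value of a
  family of positive operators whose sum is at most \<open>S\<close>.  The separating functional is an
  unnormalized dual solution.\<close>

lemma guess_strong_duality:
  fixes \<rho> :: "'z::finite \<Rightarrow> 'e::finite op"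
  assumes \<rho>: "\<And>z. psd (\<rho> z)" and p: "\<And>M. povm M \<Longrightarrow> (\<Sum>z\<in>UNIV. \<rho> z \<bullet> M z) < q"
  obtains \<sigma> where "psd \<sigma>" "\<And>z. psd (\<sigma> - \<rho> z)" "Re (trace \<sigma>) \<le> q"
proof -
  \<comment> \<open>The condition on \<open>S\<close> minus the sum constrains only the real part of
    the form, so \<open>C\<close> contains every skew-Hermitian \<open>S\<close> with
    \<open>t = 0\<close>. This forces the separating functional to be Hermitian.\<close>
  define C where "C = {(S :: 'e op, t :: real). \<exists>M. (\<forall>z. psd (M z)) \<and>
    (\<forall>v. 0 \<le> v \<bullet> ((S - (\<Sum>z\<in>UNIV. M z)) *v v)) \<and> t \<le> (\<Sum>z\<in>UNIV. \<rho> z \<bullet> M z)}"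
  have CI: "(S, t) \<in> C" if "\<And>z. psd (M z)" "\<And>v. 0 \<le> v \<bullet> ((S - (\<Sum>z\<in>UNIV. M z)) *v v)"
    "t \<le> (\<Sum>z\<in>UNIV. \<rho> z \<bullet> M z)" for S t M
    using that unfolding C_def by blast
  have cone: "u *\<^sub>R x \<in> C" if x: "x \<in> C" and u: "0 \<le> u" for x u
  proof -
    obtain S t M where M: "x = (S, t)" "\<And>z. psd (M z)" "\<And>v. 0 \<le> v \<bullet> ((S - (\<Sum>z\<in>UNIV. M z)) *v v)"
      "t \<le> (\<Sum>z\<in>UNIV. \<rho> z \<bullet> M z)" using x unfolding C_def by blast
    have "(u *\<^sub>R S, u * t) \<in> C"
    proof (rule CI[of "\<lambda>z. u *\<^sub>R M z"])
      fix v
      show "0 \<le> v \<bullet> ((u *\<^sub>R S - (\<Sum>z\<in>UNIV. u *\<^sub>R M z)) *v v)"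
        using M(3)[of v] u
        by (simp add: scaleR_sum_right[symmetric] scaleR_diff_right[symmetric] mv.scaleR_left)
    qed (use M u in \<open>auto intro: psd_scaleR mult_left_mono simp: sum_distrib_left[symmetric]\<close>)
    then show ?thesis by (simp add: M(1))
  qed
  have add: "x + y \<in> C" if x: "x \<in> C" and y: "y \<in> C" for x y
  proof -
    obtain S t M where M: "x = (S, t)" "\<And>z. psd (M z)" "\<And>v. 0 \<le> v \<bullet> ((S - (\<Sum>z\<in>UNIV. M z)) *v v)"
      "t \<le> (\<Sum>z\<in>UNIV. \<rho> z \<bullet> M z)" using x unfolding C_def by blast
    obtain S' t' M' where M': "y = (S', t')" "\<And>z. psd (M' z)" "\<And>v. 0 \<le> v \<bullet> ((S' - (\<Sum>z\<in>UNIV. M' z)) *v v)"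
      "t' \<le> (\<Sum>z\<in>UNIV. \<rho> z \<bullet> M' z)" using y unfolding C_def by blast
    have "(S + S', t + t') \<in> C"
    proof (rule CI[of "\<lambda>z. M z + M' z"])
      fix v
      have "S + S' - (\<Sum>z\<in>UNIV. M z + M' z) = (S - (\<Sum>z\<in>UNIV. M z)) + (S' - (\<Sum>z\<in>UNIV. M' z))"
        by (simp add: sum.distrib)
      then show "0 \<le> v \<bullet> ((S + S' - (\<Sum>z\<in>UNIV. M z + M' z)) *v v)"
        using M(3)[of v] M'(3)[of v] by (simp only: mv.add_left inner_add_right add_nonneg_nonneg)
    qed (use M M' in \<open>auto intro: psd_add simp: sum.distrib inner_add_right\<close>)
    then show ?thesis by (simp add: M(1) M'(1))
  qed
  have convex: "convex C"
    by (intro convexI add cone) auto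
  have zero: "(0, 0) \<in> C"
    by (rule CI[of "\<lambda>_. 0"]) simp_all
  have "(idm, q) \<notin> C"
  proof
    assume "(idm, q) \<in> C"
    then obtain M where M: "\<And>z. psd (M z)" "\<And>v. 0 \<le> v \<bullet> ((idm - (\<Sum>z\<in>UNIV. M z)) *v v)"
      "q \<le> (\<Sum>z\<in>UNIV. \<rho> z \<bullet> M z)" unfolding C_def by blast
    define Z where "Z = idm - (\<Sum>z\<in>UNIV. M z)"
    have Z: "psd Z"
      using M(1,2) unfolding psd_iff Z_def by (simp add: hc_diff hc_sum)
    define M' where "M' z = M z + (if z = undefined then Z else 0)" for z
    have "povm M'"
      unfolding M'_def Z_def using M(1) Z unfolding Z_def by (rule completed_povm)
    then have "(\<Sum>z\<in>UNIV. \<rho> z \<bullet> M' z) < q" by (rule p)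
    moreover have "(\<Sum>z\<in>UNIV. \<rho> z \<bullet> M z) \<le> (\<Sum>z\<in>UNIV. \<rho> z \<bullet> M' z)"
      using psd_inner_nonneg[OF \<rho> Z] by (intro sum_mono) (simp add: M'_def inner_add_right)
    ultimately show False using M(3) by linarith
  qed
  then have "C \<inter> {(idm, q)} = {}" by blast
  moreover have "C \<noteq> {}" using zero by blast
  ultimately have "\<exists>a b. a \<noteq> 0 \<and> (\<forall>x\<in>C. a \<bullet> x \<le> b) \<and> (\<forall>x\<in>{(idm, q)}. a \<bullet> x \<ge> b)"
    by (intro separating_hyperplane_sets convex) simp_all
  then obtain a b where a: "a \<noteq> 0" "\<And>x. x \<in> C \<Longrightarrow> a \<bullet> x \<le> b" "b \<le> a \<bullet> (idm, q)"
    by blast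
  have b: "0 \<le> b" using a(2)[OF zero] by (simp add: zero_prod_def[symmetric])
  \<comment> \<open>A functional bounded above on a cone is nonpositive there: a positive value,
    scaled to \<open>b + 1\<close>, would exceed the bound.\<close>
  have neg: "a \<bullet> x \<le> 0" if "x \<in> C" for x
  proof (rule ccontr)
    assume pos: "\<not> a \<bullet> x \<le> 0"
    have "a \<bullet> (((b + 1) / (a \<bullet> x)) *\<^sub>R x) \<le> b"
      using pos b by (intro a(2) cone that) simp
    then show False using pos by simp
  qed
  obtain A \<alpha> where A: "a = (A, \<alpha>)" by (cases a)
  have neg': "A \<bullet> S + \<alpha> * t \<le> 0" if "(S, t) \<in> C" for S t
    using neg[OF that] by (simp add: A)
  have one: "0 \<le> A \<bullet> idm + \<alpha> * q" using a(3) b by (simp add: A)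
  have \<alpha>: "0 \<le> \<alpha>"
    using neg'[of 0 "- 1"] CI[of "\<lambda>_. 0" 0 "- 1"] by simp
  have hA: "hc A = A"
  proof -
    define K where "K = A - hc A"
    have hK: "hc K = - K" by (simp add: K_def hc_diff)
    have "v \<bullet> (K *v v) = 0" for v
      using inner_matrix_vector[of K v v] by (simp add: hK mv.minus_left inner_commute)
    then have "(K, 0) \<in> C" "(- K, 0) \<in> C"
      by (auto intro!: CI[of "\<lambda>_. 0"] simp: mv.minus_left)
    then have "A \<bullet> K = 0" using neg'[of K 0] neg'[of "- K" 0] by simp
    moreover have "hc A \<bullet> K = - (A \<bullet> K)"
      using inner_hc_hc[of A "- K"] hK by (simp add: linear_neg[OF hc_linear])
    ultimately have "(A - hc A) \<bullet> K = 0" by (simp add: inner_diff_left)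
    then have "K \<bullet> K = 0" unfolding K_def[symmetric] .
    then show ?thesis by (simp add: K_def)
  qed
  have psdA: "psd (- A)"
  proof (rule psdI_inner)
    fix S :: "'e op" assume "psd S"
    then have "(S, 0) \<in> C" by (intro CI[of "\<lambda>_. 0"]) (simp_all add: psd_form_nonneg)
    then show "0 \<le> - A \<bullet> S" using neg'[of S 0] by simp
  qed (simp add: linear_neg[OF hc_linear] hA)
  have psdA\<rho>: "psd (- A - \<alpha> *\<^sub>R \<rho> z)" for z
  proof (rule psdI_inner)
    fix S :: "'e op" assume S: "psd S"
    have "(S, \<rho> z \<bullet> S) \<in> C"
    proof (rule CI[of "\<lambda>z'. if z' = z then S else 0"])
      have "\<rho> z' \<bullet> (if z' = z then S else 0) = (if z' = z then \<rho> z \<bullet> S else 0)" for z' by simp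
      then show "\<rho> z \<bullet> S \<le> (\<Sum>z'\<in>UNIV. \<rho> z' \<bullet> (if z' = z then S else 0))" by simp
    qed (use S in auto)
    then show "0 \<le> (- A - \<alpha> *\<^sub>R \<rho> z) \<bullet> S" using neg' by (fastforce simp: inner_diff_left)
  qed (simp add: hc_diff linear_neg[OF hc_linear] hA hc_scaleR psd_hermitian \<rho>)
  \<comment> \<open>With \<alpha> = 0 the positive operator \<open>- A\<close> would have trace at
    most 0, hence vanish, and with it the whole functional.\<close>
  have "\<alpha> \<noteq> 0"
  proof
    assume "\<alpha> = 0"
    then have "Re (trace (- A)) \<le> 0"
      using one unfolding inner_one_left[symmetric] by (simp add: inner_commute)
    then have "A = 0" using psd_trace_le_zero[OF psdA] by simp
    with \<open>\<alpha> = 0\<close> A a(1) show False by (simp add: zero_prod_def)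
  qed
  with \<alpha> have \<alpha>: "0 < \<alpha>" by simp
  define \<sigma> where "\<sigma> = (1 / \<alpha>) *\<^sub>R (- A)"
  show thesis
  proof
    show "psd \<sigma>" unfolding \<sigma>_def using \<alpha> by (intro psd_scaleR psdA) simp
    have "\<sigma> - \<rho> z = (1 / \<alpha>) *\<^sub>R (- A - \<alpha> *\<^sub>R \<rho> z)" for z
      using \<alpha> by (simp add: \<sigma>_def scaleR_diff_right)
    then show "psd (\<sigma> - \<rho> z)" for z
      using \<alpha> psd_scaleR[OF _ psdA\<rho>, of "1 / \<alpha>" z] by simp
    have "Re (trace \<sigma>) = - (A \<bullet> idm) / \<alpha>"
      unfolding inner_one_left[symmetric] \<sigma>_def by (simp add: inner_commute)
    also have "\<dots> \<le> q" using one \<alpha> by (simp add: field_simps)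
    finally show "Re (trace \<sigma>) \<le> q" .
  qed
qed

lemma povm_uniform: "povm (\<lambda>_ :: 'z::finite. (1 / real CARD('z)) *\<^sub>R idm)"
  unfolding povm_def scaleR_sum_left[symmetric] by (auto intro: psd_scaleR)

text \<open>The left-hand side is the quantity in the min-entropy, the right-hand side a guessing
  probability. Strong duality is applied to \<open>Sup ?D + e\<close>, which lies strictly above all
  values, so no optimal POVM is needed.\<close>

lemma guess_duality:
  fixes \<rho> :: "'z::finite \<Rightarrow> 'e::finite op"
  assumes \<rho>: "\<And>z. psd (\<rho> z)"
  shows "Inf {Re (trace \<sigma>) | \<sigma>. psd \<sigma> \<and> (\<forall>z. psd (\<sigma> - \<rho> z))} = Sup {\<Sum>z\<in>UNIV. \<rho> z \<bullet> M z | M. povm M}"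
    (is "Inf ?P = Sup ?D")
proof (rule antisym)
  have D: "?D \<noteq> {}" using povm_uniform by blast
  have le: "d \<le> p" if "d \<in> ?D" "p \<in> ?P" for d p
    using that guess_weak_duality by blast
  have ex: "\<exists>p\<in>?P. p \<le> q" if q: "\<And>M. povm M \<Longrightarrow> (\<Sum>z\<in>UNIV. \<rho> z \<bullet> M z) < q" for q
  proof -
    obtain \<sigma> where "psd \<sigma>" "\<And>z. psd (\<sigma> - \<rho> z)" "Re (trace \<sigma>) \<le> q"
      using guess_strong_duality[of \<rho> q] \<rho> q by blast
    then show ?thesis by blast
  qed
  have trace_bound: "(\<Sum>z\<in>UNIV. \<rho> z \<bullet> M z) \<le> (\<Sum>z\<in>UNIV. Re (trace (\<rho> z)))" if "povm M" for M
  proof -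
    have "(\<Sum>z'\<in>UNIV. \<rho> z') - \<rho> z = (\<Sum>z'\<in>UNIV - {z}. \<rho> z')" for z
      by (simp add: sum_diff1)
    then have "psd ((\<Sum>z'\<in>UNIV. \<rho> z') - \<rho> z)" for z
      using \<rho> by (simp add: psd_sum)
    from guess_weak_duality[OF this that] show ?thesis by (simp add: Re_trace_sum)
  qed
  have bdd: "bdd_above ?D"
    by (rule bdd_aboveI[of _ "\<Sum>z\<in>UNIV. Re (trace (\<rho> z))"]) (use trace_bound in blast)
  have P: "?P \<noteq> {}"
    using ex[of "(\<Sum>z\<in>UNIV. Re (trace (\<rho> z))) + 1"] trace_bound by force
  show "Sup ?D \<le> Inf ?P"
    by (intro cSup_least[OF D] cInf_greatest[OF P] le)
  show "Inf ?P \<le> Sup ?D"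
  proof (rule field_le_epsilon)
    fix e :: real assume e: "0 < e"
    have "(\<Sum>z\<in>UNIV. \<rho> z \<bullet> M z) < Sup ?D + e" if "povm M" for M
      using cSup_upper[OF _ bdd, of "\<Sum>z\<in>UNIV. \<rho> z \<bullet> M z"] that e by force
    from ex[OF this] obtain p where p: "p \<in> ?P" "p \<le> Sup ?D + e" by blast
    obtain d where "d \<in> ?D" using D by blast
    then have "bdd_below ?P" by (intro bdd_belowI[of _ d] le)
    then show "Inf ?P \<le> Sup ?D + e"
      using cInf_lower[OF p(1)] p(2) by linarith
  qed
qed

section \<open>Block-diagonal operators\<close>

text \<open>\<open>ket_tensor v\<close> is the map \<open>w \<mapsto> v \<otimes> w\<close>.\<close>

definition ket_tensor :: "complex^'a::finite \<Rightarrow> complex^'c::finite^('a \<times> 'c)" where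
  "ket_tensor v = (\<chi> p d. if snd p = d then v $ fst p else 0)"

lemma tensor_outer: "tensor_op (outer v) B = ket_tensor v ** B ** hc (ket_tensor v)"
  by (simp add: tensor_op_def outer_def ket_tensor_def hc_def matrix_matrix_mult_def
      Finite_Cartesian_Product.vec_eq_iff if_distrib[of "\<lambda>x. x * _"] if_distrib[of "\<lambda>x. _ * x"]
      if_distrib[of cnj] mult_ac cong: if_cong)

lemma ket_tensor_sandwich_nth:
  "(hc (ket_tensor v) ** M ** ket_tensor w) $ c $ d = (\<Sum>a\<in>UNIV. \<Sum>a'\<in>UNIV. cnj (v $ a) * M $ (a, c) $ (a', d) * w $ a')"
proof -
  have "(hc (ket_tensor v) ** M ** ket_tensor w) $ c $ d
      = (\<Sum>a'\<in>UNIV. \<Sum>a\<in>UNIV. cnj (v $ a) * M $ (a, c) $ (a', d) * w $ a')"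
    by (simp add: ket_tensor_def hc_def matrix_matrix_mult_def sum_UNIV_prod if_distrib[of "\<lambda>x. x * _"]
        if_distrib[of "\<lambda>x. _ * x"] if_distrib[of cnj] sum_distrib_right cong: if_cong)
  then show ?thesis by (subst sum.swap) simp
qed

lemma conditional_eq: "conditional v M = hc (ket_tensor v) ** M ** ket_tensor v"
  by (simp add: conditional_def Finite_Cartesian_Product.vec_eq_iff ket_tensor_sandwich_nth)

lemma hc_ket_tensor_ket_tensor: "hc (ket_tensor v) ** ket_tensor w = (\<chi> c d. if c = d then cdot v w else 0)"
  by (simp add: ket_tensor_def hc_def cdot_def matrix_matrix_mult_def sum_UNIV_prod Finite_Cartesian_Product.vec_eq_iff
      if_distrib[of "\<lambda>x. x * _"] if_distrib[of "\<lambda>x. _ * x"] if_distrib[of cnj] cong: if_cong)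

lemma tensor_op_sum_left: "tensor_op (\<Sum>i\<in>I. A i) B = (\<Sum>i\<in>I. tensor_op (A i) B)"
  by (simp add: tensor_op_def Finite_Cartesian_Product.vec_eq_iff sum_distrib_right)

locale basis =
  fixes ket :: "'i::finite \<Rightarrow> complex^'a::finite"
  assumes orthonormal: "cdot (ket i) (ket j) = (if i = j then 1 else 0)"
    and complete: "(\<Sum>i\<in>UNIV. outer (ket i)) = idm"
begin

definition block :: "('i \<Rightarrow> 'c::finite op) \<Rightarrow> ('a \<times> 'c) op" where
  "block A = (\<Sum>i\<in>UNIV. ket_tensor (ket i) ** A i ** hc (ket_tensor (ket i)))"

lemma ket_tensor_orthonormal: "hc (ket_tensor (ket i)) ** ket_tensor (ket j) = (if i = j then idm else 0 :: 'c::finite op)"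
  by (simp add: hc_ket_tensor_ket_tensor orthonormal Finite_Cartesian_Product.vec_eq_iff Finite_Cartesian_Product.mat_def)

lemma block_tensor: "(\<Sum>i\<in>UNIV. tensor_op (outer (ket i)) (A i)) = block A"
  by (simp add: block_def tensor_outer)

lemma tensor_one_eq_block: "tensor_op idm B = block (\<lambda>_. B)"
  unfolding complete[symmetric] tensor_op_sum_left by (rule block_tensor)

lemma measured_eq_block: "measured ket M = block (\<lambda>i. conditional (ket i) M)"
  by (simp add: measured_def block_def conditional_eq tensor_outer matrix_mul_assoc)

lemma sandwich_block:
  "hc (ket_tensor (ket i)) ** block A ** ket_tensor (ket j) = (if i = j then A i else 0)"
proof -
  have "hc (ket_tensor (ket i)) ** block A ** ket_tensor (ket j)
      = (\<Sum>k\<in>UNIV. (hc (ket_tensor (ket i)) ** ket_tensor (ket k)) ** A k ** (hc (ket_tensor (ket k)) ** ket_tensor (ket j)))"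
    by (simp add: block_def mm.sum_left mm.sum_right matrix_mul_assoc)
  also have "\<dots> = (\<Sum>k\<in>UNIV. if k = i then (if i = j then A i else 0) else 0)"
    by (intro sum.cong refl) (auto simp: ket_tensor_orthonormal)
  finally show ?thesis by simp
qed

lemma conditional_block: "conditional (ket i) (block A) = A i"
  by (simp add: conditional_eq sandwich_block)

lemma block_mult: "block A ** block B = block (\<lambda>i. A i ** B i)"
proof -
  have "block A ** block B = (\<Sum>i\<in>UNIV. \<Sum>j\<in>UNIV.
      ket_tensor (ket i) ** A i ** (hc (ket_tensor (ket i)) ** ket_tensor (ket j)) ** B j ** hc (ket_tensor (ket j)))"
    by (simp add: block_def mm.sum_left mm.sum_right matrix_mul_assoc) (rule sum.swap)
  also have "\<dots> = (\<Sum>i\<in>UNIV. \<Sum>j\<in>UNIV. if j = i then ket_tensor (ket i) ** A i ** B i ** hc (ket_tensor (ket i)) else 0)"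
    by (intro sum.cong refl) (auto simp: ket_tensor_orthonormal)
  finally show ?thesis by (simp add: block_def matrix_mul_assoc)
qed

lemma hc_block: "hc (block A) = block (\<lambda>i. hc (A i))"
  by (simp add: block_def hc_sum hc_mult matrix_mul_assoc)

lemma block_diff: "block A - block B = block (\<lambda>i. A i - B i)"
  by (simp add: block_def mm.diff_left mm.diff_right sum_subtractf)

lemma Re_trace_block: "Re (trace (block A)) = (\<Sum>i\<in>UNIV. Re (trace (A i)))"
proof -
  have "Re (trace (ket_tensor (ket i) ** A i ** hc (ket_tensor (ket i)))) = Re (trace (A i))" for i
  proof -
    have "Re (trace (ket_tensor (ket i) ** A i ** hc (ket_tensor (ket i)))) = ket_tensor (ket i) \<bullet> (ket_tensor (ket i) ** A i)"
      unfolding inner_one_left[symmetric]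
      by (subst inner_commute, subst inner_mult_right) (simp add: inner_commute)
    also have "\<dots> = A i \<bullet> (hc (ket_tensor (ket i)) ** ket_tensor (ket i))"
      by (subst inner_commute) (rule inner_mult_left)
    finally show ?thesis by (simp add: ket_tensor_orthonormal inner_one_left inner_commute[of "A i"])
  qed
  then show ?thesis by (simp add: block_def Re_trace_sum)
qed

lemma psd_block_iff: "psd (block A) \<longleftrightarrow> (\<forall>i. psd (A i))"
proof
  assume "psd (block A)"
  then show "\<forall>i. psd (A i)"
    using psd_conj[of "block A" "ket_tensor (ket _)"] by (simp add: sandwich_block)
next
  assume "\<forall>i. psd (A i)"
  then show "psd (block A)"
    unfolding block_def using psd_conj[of _ "hc (ket_tensor (ket _))"] by (auto intro!: psd_sum)
qed

lemma op_sqrt_block: "(\<And>i. psd (A i)) \<Longrightarrow> op_sqrt (block A) = block (\<lambda>i. op_sqrt (A i))"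
  by (rule op_sqrt_unique) (simp_all add: psd_block_iff psd_op_sqrt block_mult op_sqrt_square)

text \<open>On a block-diagonal state the trace norm splits into fidelities, and the factor
  \<open>CARD('a)\<close> cancels the normalization of the maximally mixed operator.\<close>

lemma H_max_block:
  fixes A :: "'i \<Rightarrow> 'c::finite op"
  assumes A: "\<And>i. psd (A i)"
  shows "H_max (block A) = Sup {log 2 t | t \<sigma>. normalized_state \<sigma> \<and> 0 < t \<and> t = (\<Sum>i\<in>UNIV. fidelity (A i) \<sigma>)\<^sup>2}"
proof -
  have "real CARD('a) * (trace_norm (op_sqrt (block A) **
        op_sqrt (tensor_op (Finite_Cartesian_Product.mat (1 / of_nat CARD('a))) \<sigma>)))\<^sup>2
      = (\<Sum>i\<in>UNIV. fidelity (A i) \<sigma>)\<^sup>2" if "normalized_state \<sigma>" for \<sigma> :: "'c op"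
  proof -
    define r where "r = 1 / sqrt (real CARD('a))"
    have r: "0 \<le> r" "r\<^sup>2 = 1 / real CARD('a)" by (simp_all add: r_def power_divide)
    have \<sigma>: "psd \<sigma>" using that by (simp add: normalized_state_def)
    have "tensor_op (Finite_Cartesian_Product.mat (1 / of_nat CARD('a)) :: 'a op) \<sigma> = tensor_op idm (r\<^sup>2 *\<^sub>R \<sigma>)"
      unfolding r(2) by (simp add: tensor_op_def Finite_Cartesian_Product.mat_def
          Finite_Cartesian_Product.vec_eq_iff scaleR_conv_of_real[where 'a = complex])
    then have "op_sqrt (tensor_op (Finite_Cartesian_Product.mat (1 / of_nat CARD('a)) :: 'a op) \<sigma>)
        = block (\<lambda>_. r *\<^sub>R op_sqrt \<sigma>)"
      using r(1) \<sigma> by (simp only: tensor_one_eq_block op_sqrt_block psd_scaleR zero_le_power2 op_sqrt_scaleR)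
    then have X: "op_sqrt (block A) ** op_sqrt (tensor_op (Finite_Cartesian_Product.mat (1 / of_nat CARD('a)) :: 'a op) \<sigma>)
        = block (\<lambda>i. r *\<^sub>R (op_sqrt (A i) ** op_sqrt \<sigma>))"
      by (simp add: op_sqrt_block A block_mult mm.scaleR_right)
    have "adj (block (\<lambda>i. r *\<^sub>R (op_sqrt (A i) ** op_sqrt \<sigma>))) ** block (\<lambda>i. r *\<^sub>R (op_sqrt (A i) ** op_sqrt \<sigma>))
        = block (\<lambda>i. r\<^sup>2 *\<^sub>R (op_sqrt \<sigma> ** A i ** op_sqrt \<sigma>))"
    proof -
      have "op_sqrt \<sigma> ** op_sqrt (A i) ** (op_sqrt (A i) ** op_sqrt \<sigma>) = op_sqrt \<sigma> ** A i ** op_sqrt \<sigma>" for i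
      proof -
        have "op_sqrt \<sigma> ** op_sqrt (A i) ** (op_sqrt (A i) ** op_sqrt \<sigma>)
            = op_sqrt \<sigma> ** (op_sqrt (A i) ** op_sqrt (A i)) ** op_sqrt \<sigma>"
          by (simp add: matrix_mul_assoc)
        then show ?thesis by (simp add: op_sqrt_square A)
      qed
      then show ?thesis
        by (simp add: adj_eq_hc hc_block block_mult hc_scaleR hc_mult hc_op_sqrt A \<sigma> mm.scaleR_left mm.scaleR_right
            power2_eq_square)
    qed
    moreover have "psd (op_sqrt \<sigma> ** A i ** op_sqrt \<sigma>)" for i
      using psd_conj[OF A[of i], of "op_sqrt \<sigma>"] by (simp add: hc_op_sqrt \<sigma>)
    ultimately have "trace_norm (block (\<lambda>i. r *\<^sub>R (op_sqrt (A i) ** op_sqrt \<sigma>))) = r * (\<Sum>i\<in>UNIV. fidelity (A i) \<sigma>)"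
      unfolding trace_norm_def using r(1)
      by (simp only: op_sqrt_block psd_scaleR zero_le_power2 op_sqrt_scaleR Re_trace_block fidelity_def)
        (simp only: inner_one_left[symmetric] inner_scaleR_right sum_distrib_left)
    then show ?thesis
      unfolding X by (simp add: power_mult_distrib r)
  qed
  then show ?thesis
    unfolding H_max_def
    by (intro arg_cong[of _ _ Sup] Collect_cong ex_cong1 conj_cong refl) simp
qed

lemma H_min_block:
  fixes A :: "'i \<Rightarrow> 'c::finite op"
  shows "H_min (block A) = - log 2 (Inf {Re (trace \<sigma>) | \<sigma>. psd \<sigma> \<and> (\<forall>i. psd (\<sigma> - A i))})"
  unfolding H_min_def loewner_le_def tensor_one_eq_block block_diff psd_block_iff ..

end

lemma ket_z_basis: "basis (ket_z :: 'n::len0 bits \<Rightarrow> _)"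
proof
  show "cdot (ket_z i) (ket_z j) = (if i = j then 1 else 0)" for i j :: "'n bits"
    by (simp add: cdot_def ket_z_def axis_def if_distrib[of cnj] if_distrib[of "\<lambda>x. x * _"] cong: if_cong)
  show "(\<Sum>i\<in>UNIV. outer (ket_z i)) = (idm :: 'n bits op)"
    by (simp add: outer_def ket_z_def axis_def Finite_Cartesian_Product.vec_eq_iff
        Finite_Cartesian_Product.mat_def if_distrib[of cnj] if_distrib[of "\<lambda>x. x * _"]
        if_distrib[of "\<lambda>x. _ * x"] cong: if_cong)
qed

lemma ket_x_basis: "basis (ket_x :: 'n::len0 bits \<Rightarrow> _)"
proof
  have sum: "(\<Sum>x\<in>UNIV. character x i * character x j) / 2 ^ LENGTH('n) = (if i = j then 1 else 0)" for i j :: "'n bits"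
  proof -
    have "(2 :: real) ^ LENGTH('n) = real CARD('n bits)" by (simp add: card_bits)
    then show ?thesis by (auto simp: character_square character_orthogonal)
  qed
  have prod: "ket_x x $ i * ket_x y $ j = complex_of_real (character x i * character y j / 2 ^ LENGTH('n))"
    for x y i j :: "'n bits"
    unfolding ket_x_nth of_real_mult[symmetric] by simp
  have real: "cnj (ket_x x $ i) = ket_x x $ i" for x i :: "'n bits"
    by (simp add: ket_x_nth)
  show "cdot (ket_x i) (ket_x j) = (if i = j then 1 else 0)" for i j :: "'n bits"
  proof -
    have "cdot (ket_x i) (ket_x j) = complex_of_real ((\<Sum>x\<in>UNIV. character x i * character x j) / 2 ^ LENGTH('n))"
      by (simp only: cdot_def real prod of_real_sum[symmetric] sum_divide_distrib
          character_commute[of i] character_commute[of j])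
    then show ?thesis unfolding sum by simp
  qed
  show "(\<Sum>i\<in>UNIV. outer (ket_x i)) = (idm :: 'n bits op)"
  proof -
    have "(\<Sum>x\<in>UNIV. outer (ket_x x)) $ i $ j = complex_of_real ((\<Sum>x\<in>UNIV. character x i * character x j) / 2 ^ LENGTH('n))"
      for i j :: "'n bits"
    proof -
      have "(\<Sum>x\<in>UNIV. outer (ket_x x)) $ i $ j = (\<Sum>x\<in>UNIV. ket_x x $ i * ket_x x $ j)"
        by (simp add: outer_def real)
      then show ?thesis
        by (simp only: prod of_real_sum[symmetric] sum_divide_distrib)
    qed
    then show ?thesis
      unfolding sum by (simp add: Finite_Cartesian_Product.vec_eq_iff Finite_Cartesian_Product.mat_def)
  qed
qed

section \<open>Suprema of guessing values and fidelities\<close>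

text \<open>\<open>t0\<close> makes the supremum positive, so that its logarithm is meaningful, and
  nonpositive members of \<open>V\<close> lie below every power of 2.\<close>

lemma powr_Sup_log:
  assumes bdd: "bdd_above V" and t0: "t0 \<in> V" "0 < t0"
  shows "2 powr (Sup {log 2 t | t. t \<in> V \<and> 0 < t}) = Sup V"
proof -
  have pos: "0 < Sup V"
    using t0 cSup_upper[OF t0(1) bdd] by linarith
  have "Sup {log 2 t | t. t \<in> V \<and> 0 < t} = log 2 (Sup V)"
  proof (rule cSup_eq)
    fix u assume "u \<in> {log 2 t | t. t \<in> V \<and> 0 < t}"
    then obtain t where "u = log 2 t" "t \<in> V" "0 < t" by blast
    then show "u \<le> log 2 (Sup V)" using cSup_upper[OF _ bdd] pos by simp
  next
    fix y assume y: "\<And>u. u \<in> {log 2 t | t. t \<in> V \<and> 0 < t} \<Longrightarrow> u \<le> y"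
    have "t \<le> 2 powr y" if "t \<in> V" for t
    proof (cases "0 < t")
      case True
      then have "log 2 t \<le> y" using y that by blast
      with True show ?thesis by (subst (asm) log_le_iff) simp_all
    next
      case False
      then show ?thesis using powr_ge_zero[of 2 y] by linarith
    qed
    then have "Sup V \<le> 2 powr y" using t0 by (intro cSup_least) auto
    with pos show "log 2 (Sup V) \<le> y" by (subst log_le_iff) simp_all
  qed
  with pos show ?thesis by simp
qed

lemma log_values:
  "{log 2 t | t \<sigma>. P \<sigma> \<and> 0 < t \<and> t = h \<sigma>} = {log 2 t | t. t \<in> {h \<sigma> | \<sigma>. P \<sigma>} \<and> 0 < t}"
  by blast

lemma Inf_diff_eq:
  fixes S :: "real set"
  assumes "S \<noteq> {}" "bdd_above S"
  shows "Inf {a - s | s. s \<in> S} = a - Sup S"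
proof (rule cInf_eq)
  fix u assume "u \<in> {a - s | s. s \<in> S}"
  then show "a - Sup S \<le> u" using cSup_upper[OF _ assms(2)] by auto
next
  fix y assume y: "\<And>u. u \<in> {a - s | s. s \<in> S} \<Longrightarrow> y \<le> u"
  have "Sup S \<le> a - y"
    using assms(1)
  proof (rule cSup_least)
    fix s assume "s \<in> S"
    then have "y \<le> a - s" using y by blast
    then show "s \<le> a - y" by simp
  qed
  then show "y \<le> a - Sup S" by simp
qed

context dual_pair_state
begin

definition best_guess :: real where
  "best_guess = Sup {guess_value M | M. \<forall>s. povm (M s)}"

lemma guess_value_le:
  assumes "\<forall>s. povm (M s)"
  shows "guess_value M \<le> (\<Sum>x\<in>UNIV. (norm (\<Phi>' x))\<^sup>2)"
  unfolding guess_value_def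
proof (rule sum_mono)
  fix x
  have "idm = (\<Sum>y\<in>UNIV. M (g x) y)"
    using assms by (simp add: povm_def)
  also have "\<dots> = M (g x) x + (\<Sum>y\<in>UNIV - {x}. M (g x) y)"
    by (rule sum.remove) simp_all
  finally have one: "idm = M (g x) x + (\<Sum>y\<in>UNIV - {x}. M (g x) y)" .
  have "(norm (\<Phi>' x))\<^sup>2 = \<Phi>' x \<bullet> (idm ** \<Phi>' x)"
    by (simp add: power2_norm_eq_inner)
  then have "(norm (\<Phi>' x))\<^sup>2 = \<Phi>' x \<bullet> (M (g x) x ** \<Phi>' x) + \<Phi>' x \<bullet> ((\<Sum>y\<in>UNIV - {x}. M (g x) y) ** \<Phi>' x)"
    unfolding one mm.add_left inner_add_right .
  moreover have "0 \<le> \<Phi>' x \<bullet> ((\<Sum>y\<in>UNIV - {x}. M (g x) y) ** \<Phi>' x)"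
    using assms by (intro psd_inner_conj_nonneg psd_sum) (simp add: povm_def)
  ultimately show "\<Phi>' x \<bullet> (M (g x) x ** \<Phi>' x) \<le> (norm (\<Phi>' x))\<^sup>2" by simp
qed

lemma guess_values_nonempty: "{guess_value M | M. \<forall>s. povm (M s)} \<noteq> {}"
proof -
  have "guess_value (\<lambda>_ _. (1 / real CARD('x)) *\<^sub>R idm) \<in> {guess_value M | M. \<forall>s. povm (M s)}"
    by (intro CollectI exI[of _ "\<lambda>_ _. (1 / real CARD('x)) *\<^sub>R idm"] conjI allI povm_uniform) (rule refl)
  then show ?thesis by blast
qed

lemma guess_values_bdd: "bdd_above {guess_value M | M. \<forall>s. povm (M s)}"
  by (rule bdd_aboveI[of _ "\<Sum>x\<in>UNIV. (norm (\<Phi>' x))\<^sup>2"]) (auto intro: guess_value_le)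

lemma guess_value_le_best: "\<forall>s. povm (M s) \<Longrightarrow> guess_value M \<le> best_guess"
  unfolding best_guess_def by (rule cSup_upper[OF _ guess_values_bdd]) blast

lemma fidelity_value_le_best:
  assumes "normalized_state \<sigma>" shows "(fidelity_value \<sigma>)\<^sup>2 \<le> c * best_guess"
proof -
  obtain M where "\<And>s. povm (M s)" "(fidelity_value \<sigma>)\<^sup>2 \<le> c * guess_value M"
    using fidelity_le_guess[OF assms] by blast
  moreover have "c * guess_value M \<le> c * best_guess"
    using c_pos calculation(1) by (intro mult_left_mono guess_value_le_best) simp_all
  ultimately show ?thesis by linarith
qed

text \<open>The uniform guess already has positive success, which allows taking logarithms.\<close>

lemma best_guess_pos:
  assumes "0 < (\<Sum>x\<in>UNIV. (norm (\<Phi>' x))\<^sup>2)" shows "0 < best_guess"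
proof -
  have "0 < (1 / real CARD('x)) * (\<Sum>x\<in>UNIV. (norm (\<Phi>' x))\<^sup>2)"
    using assms by (simp add: zero_less_card_finite)
  also have "\<dots> = guess_value (\<lambda>_ _. (1 / real CARD('x)) *\<^sub>R idm)"
    by (simp add: guess_value_def mm.scaleR_left power2_norm_eq_inner sum_divide_distrib)
  also have "\<dots> \<le> best_guess"
    by (intro guess_value_le_best allI povm_uniform)
  finally show ?thesis .
qed

text \<open>The duality in exponential form, matching the expression that \<open>H_max_block\<close>
  produces: converting states into POVMs and back bounds each supremum by the other.\<close>

lemma powr_Sup_log_fidelity:
  assumes "0 < (\<Sum>x\<in>UNIV. (norm (\<Phi>' x))\<^sup>2)"
  shows "2 powr (Sup {log 2 t | t \<sigma>. normalized_state \<sigma> \<and> 0 < t \<and>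
    t = (\<Sum>k\<in>UNIV. fidelity (\<Sum>z\<in>f -` {k}. hc (\<Phi> z) ** \<Phi> z) \<sigma>)\<^sup>2}) = c * best_guess"
proof -
  define V where "V = {(fidelity_value \<sigma>)\<^sup>2 | \<sigma>. normalized_state \<sigma>}"
  have bdd: "bdd_above V"
    by (rule bdd_aboveI[of _ "c * best_guess"]) (use fidelity_value_le_best in \<open>auto simp: V_def\<close>)
  have ne: "V \<noteq> {}" using normalized_state_exists by (auto simp: V_def)
  have "best_guess \<le> Sup V / c"
    unfolding best_guess_def
  proof (rule cSup_least[OF guess_values_nonempty])
    fix v assume "v \<in> {guess_value M | M. \<forall>s. povm (M s)}"
    then obtain M where M: "v = guess_value M" "\<And>s. povm (M s)" by blast
    obtain \<sigma> where \<sigma>: "normalized_state \<sigma>" "c * v \<le> (fidelity_value \<sigma>)\<^sup>2"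
      unfolding M(1) by (rule guess_le_fidelity[OF M(2)])
    have "(fidelity_value \<sigma>)\<^sup>2 \<le> Sup V"
      using \<sigma>(1) by (intro cSup_upper bdd) (auto simp: V_def)
    with \<sigma>(2) have "c * v \<le> Sup V" by simp
    then show "v \<le> Sup V / c" using c_pos by (simp add: field_simps)
  qed
  then have ge: "c * best_guess \<le> Sup V" using c_pos by (simp add: field_simps)
  moreover have "Sup V \<le> c * best_guess"
    using fidelity_value_le_best by (intro cSup_least ne) (auto simp: V_def)
  ultimately have Sup: "Sup V = c * best_guess" by simp
  have pos: "0 < c * best_guess"
    using c_pos best_guess_pos[OF assms] by simp
  have "\<exists>t\<in>V. 0 < t"
  proof (rule ccontr)
    assume "\<not> (\<exists>t\<in>V. 0 < t)"
    then have "t \<le> 0" if "t \<in> V" for t using that by force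
    then have "Sup V \<le> 0" by (intro cSup_least ne)
    then show False using pos Sup by simp
  qed
  then obtain t0 where t0: "t0 \<in> V" "0 < t0" by blast
  have log_V: "{log 2 t | t \<sigma>. normalized_state \<sigma> \<and> 0 < t \<and>
    t = (\<Sum>k\<in>UNIV. fidelity (\<Sum>z\<in>f -` {k}. hc (\<Phi> z) ** \<Phi> z) \<sigma>)\<^sup>2} = {log 2 t | t. t \<in> V \<and> 0 < t}"
    unfolding V_def fidelity_value_def by (rule log_values)
  show ?thesis
    unfolding log_V powr_Sup_log[OF bdd t0] by (rule Sup)
qed

end

section \<open>Components of a tripartite pure state\<close>

lemma linear_transpose: "linear (transpose :: complex^'a::finite^'b::finite \<Rightarrow> _)"
  by (rule linearI) (simp_all add: transpose_def Finite_Cartesian_Product.vec_eq_iff)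

lemma hc_transpose: "hc (transpose A) = transpose (hc A)"
  by (simp add: hc_def transpose_def Finite_Cartesian_Product.vec_eq_iff)

lemma psd_transpose: assumes "psd M" shows "psd (transpose M)"
proof -
  have eq: "transpose M = hc (transpose (op_sqrt M)) ** transpose (op_sqrt M)"
    using op_sqrt_square[OF assms]
    by (simp add: hc_transpose hc_op_sqrt assms matrix_transpose_mul[symmetric])
  show ?thesis by (subst eq) (rule psd_hc_mult)
qed

lemma trace_transpose: "trace (transpose A) = trace A"
  by (simp add: trace_def transpose_def)

lemma transpose_one: "transpose idm = idm"
  by (rule transpose_mat)

lemma povm_transpose: assumes "povm M" shows "povm (\<lambda>i. transpose (M i))"
  using assms linear_sum[OF linear_transpose, of M UNIV]
  by (simp add: povm_def psd_transpose transpose_one)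

lemma Re_trace_transpose_state:
  fixes A :: "complex^'e::finite^'b::finite"
  shows "Re (trace (transpose (A ** hc A) ** M)) = A \<bullet> (transpose M ** A)"
proof -
  have "transpose (A ** hc A) ** M = transpose (transpose M ** A ** hc A)"
    by (simp add: matrix_transpose_mul Finite_Cartesian_Product.transpose_transpose matrix_mul_assoc)
  then have "Re (trace (transpose (A ** hc A) ** M)) = (transpose M ** A ** hc A) \<bullet> idm"
    by (simp add: trace_transpose inner_one_left inner_commute[of _ idm])
  also have "\<dots> = A \<bullet> (transpose M ** A)"
    by (subst inner_mult_right) (simp add: inner_commute)
  finally show ?thesis .
qed

text \<open>Component \<open>(b, e)\<close> of \<open>amplitude_z \<psi> z\<close> is the conjugate of \<open>\<langle>z, b, e|\<psi>\<rangle>\<close>, so that \<open>\<rho>\<^sup>z\<^sub>E\<close> is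
  \<open>hc \<Phi> ** \<Phi>\<close> without a transposition; the transposition then appears on \<open>B\<close>.\<close>

definition amplitude_z :: "complex^('n::len0 bits \<times> 'b::finite \<times> 'e::finite) \<Rightarrow> 'n bits \<Rightarrow> complex^'e^'b" where
  "amplitude_z \<psi> z = (\<chi> b e. cnj (\<psi> $ (z, b, e)))"

definition amplitude_x :: "complex^('n::len0 bits \<times> 'b::finite \<times> 'e::finite) \<Rightarrow> 'n bits \<Rightarrow> complex^'e^'b" where
  "amplitude_x \<psi> x = (1 / sqrt (2 ^ LENGTH('n))) *\<^sub>R (\<Sum>z\<in>UNIV. character x z *\<^sub>R amplitude_z \<psi> z)"

lemma amplitude_x_nth: "amplitude_x \<psi> x $ b $ e = (\<Sum>z\<in>UNIV. ket_x x $ z * cnj (\<psi> $ (z, b, e)))"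
  by (simp add: amplitude_x_def amplitude_z_def ket_x_nth scaleR_conv_of_real[where 'a = complex]
      sum_distrib_left sum_divide_distrib)

lemma cnj_ket_x: "cnj (ket_x x $ z) = ket_x x $ z"
  by (simp add: ket_x_nth)

lemma marginal_AE_components:
  "hc (ket_tensor (ket_z z)) ** marginal_AE (outer \<psi>) ** ket_tensor (ket_z z') = hc (amplitude_z \<psi> z) ** amplitude_z \<psi> z'"
proof -
  have "(hc (ket_tensor (ket_z z)) ** marginal_AE (outer \<psi>) ** ket_tensor (ket_z z')) $ c $ d
      = (hc (amplitude_z \<psi> z) ** amplitude_z \<psi> z') $ c $ d" for c d
    unfolding ket_tensor_sandwich_nth
    by (simp add: ket_z_def axis_def marginal_AE_def outer_def amplitude_z_def hc_def
        matrix_matrix_mult_def if_distrib[of cnj] if_distrib[of "\<lambda>x. x * _"]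
        if_distrib[of "\<lambda>x. _ * x"] cong: if_cong)
  then show ?thesis by (simp add: Finite_Cartesian_Product.vec_eq_iff)
qed

lemma marginal_AB_components:
  "hc (ket_tensor (ket_x x)) ** marginal_AB (outer \<psi>) ** ket_tensor (ket_x x')
    = transpose (amplitude_x \<psi> x' ** hc (amplitude_x \<psi> x))"
proof -
  have "(hc (ket_tensor (ket_x x)) ** marginal_AB (outer \<psi>) ** ket_tensor (ket_x x')) $ b $ b'
      = (amplitude_x \<psi> x' ** hc (amplitude_x \<psi> x)) $ b' $ b" for b b'
  proof -
    have "(hc (ket_tensor (ket_x x)) ** marginal_AB (outer \<psi>) ** ket_tensor (ket_x x')) $ b $ b'
        = (\<Sum>a\<in>UNIV. \<Sum>a'\<in>UNIV. \<Sum>e\<in>UNIV. (ket_x x' $ a' * cnj (\<psi> $ (a', b', e))) * (ket_x x $ a * \<psi> $ (a, b, e)))"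
      by (simp add: ket_tensor_sandwich_nth marginal_AB_def outer_def cnj_ket_x sum_distrib_left sum_distrib_right mult_ac)
    also have "\<dots> = (\<Sum>a'\<in>UNIV. \<Sum>a\<in>UNIV. \<Sum>e\<in>UNIV. (ket_x x' $ a' * cnj (\<psi> $ (a', b', e))) * (ket_x x $ a * \<psi> $ (a, b, e)))"
      by (rule sum.swap)
    also have "\<dots> = (\<Sum>a'\<in>UNIV. \<Sum>e\<in>UNIV. \<Sum>a\<in>UNIV. (ket_x x' $ a' * cnj (\<psi> $ (a', b', e))) * (ket_x x $ a * \<psi> $ (a, b, e)))"
      by (intro sum.cong refl sum.swap)
    also have "\<dots> = (\<Sum>e\<in>UNIV. \<Sum>a'\<in>UNIV. \<Sum>a\<in>UNIV. (ket_x x' $ a' * cnj (\<psi> $ (a', b', e))) * (ket_x x $ a * \<psi> $ (a, b, e)))"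
      by (rule sum.swap)
    also have "\<dots> = (amplitude_x \<psi> x' ** hc (amplitude_x \<psi> x)) $ b' $ b"
      by (simp add: matrix_matrix_mult_def hc_def amplitude_x_nth sum_product cnj_ket_x)
    finally show ?thesis .
  qed
  then show ?thesis
    by (simp add: Finite_Cartesian_Product.vec_eq_iff transpose_def)
qed

lemma (in basis) measured_fixed_off_diagonal:
  assumes "M = measured ket M" "i \<noteq> j"
  shows "hc (ket_tensor (ket i)) ** M ** ket_tensor (ket j) = 0"
  using sandwich_block[of i "\<lambda>i. conditional (ket i) M" j] assms by (simp add: measured_eq_block[symmetric])

text \<open>A state fixed by a measurement has no off-diagonal blocks in the measured basis, and by
  the component formulas these blocks are the products stated here, up to transposition in the
  second case.\<close>

lemma standard_form_amplitudes:
  assumes "standard_form (outer \<psi>)"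
  shows "(\<forall>z z'. z \<noteq> z' \<longrightarrow> hc (amplitude_z \<psi> z) ** amplitude_z \<psi> z' = 0) \<or>
    (\<forall>x x'. x \<noteq> x' \<longrightarrow> amplitude_x \<psi> x ** hc (amplitude_x \<psi> x') = 0)"
  using assms unfolding standard_form_def
proof (elim conjE disjE)
  assume "marginal_AE (outer \<psi>) = measured ket_z (marginal_AE (outer \<psi>))"
  from basis.measured_fixed_off_diagonal[OF ket_z_basis this] show ?thesis
    unfolding marginal_AE_components by blast
next
  assume "marginal_AB (outer \<psi>) = measured ket_x (marginal_AB (outer \<psi>))"
  from basis.measured_fixed_off_diagonal[OF ket_x_basis this]
  have zero: "transpose (amplitude_x \<psi> x' ** hc (amplitude_x \<psi> x)) = 0" if "x \<noteq> x'" for x x'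
    unfolding marginal_AB_components using that by blast
  have "amplitude_x \<psi> x' ** hc (amplitude_x \<psi> x) = 0" if "x \<noteq> x'" for x x'
  proof -
    have "transpose (transpose (amplitude_x \<psi> x' ** hc (amplitude_x \<psi> x))) = transpose 0"
      by (rule arg_cong[OF zero[OF that]])
    then show ?thesis
      by (simp only: Finite_Cartesian_Product.transpose_transpose linear_0[OF linear_transpose])
  qed
  then show ?thesis by metis
qed

section \<open>Duality of the indices and of the entropies\<close>

lemma measured_AE_block:
  "measured ket_z (marginal_AE (outer \<psi>)) = basis.block ket_z (\<lambda>z. hc (amplitude_z \<psi> z) ** amplitude_z \<psi> z)"
  unfolding basis.measured_eq_block[OF ket_z_basis] conditional_eq marginal_AE_components ..

lemma measured_AB_block:
  "measured ket_x (marginal_AB (outer \<psi>))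
    = basis.block ket_x (\<lambda>x. transpose (amplitude_x \<psi> x ** hc (amplitude_x \<psi> x)))"
  unfolding basis.measured_eq_block[OF ket_x_basis] conditional_eq marginal_AB_components ..

lemma dual_pair_amplitudes:
  fixes \<psi> :: "complex^('n::len0 bits \<times> 'b::finite \<times> 'e::finite)" and f :: "'n bits \<Rightarrow> 'k::finite"
    and g :: "'n bits \<Rightarrow> 's::finite"
  assumes "dual_pair character f g" "standard_form (outer \<psi>)"
  shows "dual_pair_state character f g (amplitude_z \<psi>) (amplitude_x \<psi>)"
proof -
  interpret dual_pair character f g by (rule assms(1))
  have "N = 2 ^ LENGTH('n)"
    using card_z by (simp add: card_bits)
  then have "amplitude_x \<psi> x = (1 / sqrt N) *\<^sub>R (\<Sum>z\<in>UNIV. character x z *\<^sub>R amplitude_z \<psi> z)" for x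
    by (simp add: amplitude_x_def)
  then show ?thesis
    by (intro dual_pair_state.intro assms(1) dual_pair_state_axioms.intro standard_form_amplitudes[OF assms(2)])
qed

text \<open>The roles of \<open>B\<close> and \<open>E\<close> and of the bases are exchanged.
  Transposition turns orthogonal ranges into orthogonal supports, so the two alternatives of the
  standard form change places.\<close>

lemma dual_pair_amplitudes_transposed:
  fixes \<psi> :: "complex^('n::len0 bits \<times> 'b::finite \<times> 'e::finite)"
  assumes "standard_form (outer \<psi>)"
  shows "dual_pair_state character id (\<lambda>_. ()) (\<lambda>x. transpose (amplitude_x \<psi> x)) (\<lambda>z. transpose (amplitude_z \<psi> z))"
proof -
  interpret dual_pair_state character id "\<lambda>_. ()" "amplitude_z \<psi>" "amplitude_x \<psi>"
    by (rule dual_pair_amplitudes[OF trivial_dual_pair assms])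
  show ?thesis
  proof (intro dual_pair_state.intro trivial_dual_pair dual_pair_state_axioms.intro)
    fix z
    show "transpose (amplitude_z \<psi> z)
        = (1 / sqrt N) *\<^sub>R (\<Sum>x\<in>UNIV. character z x *\<^sub>R transpose (amplitude_x \<psi> x))"
      by (subst fourier_inverse)
        (simp add: linear_scale[OF linear_transpose] linear_sum[OF linear_transpose] character_commute[of z])
  next
    have t: "hc (transpose A) ** transpose B = transpose (B ** hc A)" for A B :: "complex^'e^'b"
      by (simp add: hc_transpose matrix_transpose_mul)
    have t': "transpose A ** hc (transpose B) = transpose (hc B ** A)" for A B :: "complex^'e^'b"
      by (simp add: hc_transpose matrix_transpose_mul)
    show "(\<forall>x x'. x \<noteq> x' \<longrightarrow> hc (transpose (amplitude_x \<psi> x)) ** transpose (amplitude_x \<psi> x') = 0) \<or>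
        (\<forall>z z'. z \<noteq> z' \<longrightarrow> transpose (amplitude_z \<psi> z) ** hc (transpose (amplitude_z \<psi> z')) = 0)"
      using standard unfolding t t'
    proof
      assume "\<forall>z z'. z \<noteq> z' \<longrightarrow> hc (amplitude_z \<psi> z) ** amplitude_z \<psi> z' = 0"
      then show "(\<forall>x x'. x \<noteq> x' \<longrightarrow> transpose (amplitude_x \<psi> x' ** hc (amplitude_x \<psi> x)) = 0) \<or>
          (\<forall>z z'. z \<noteq> z' \<longrightarrow> transpose (hc (amplitude_z \<psi> z') ** amplitude_z \<psi> z) = 0)"
        by (simp add: linear_0[OF linear_transpose])
    next
      assume "\<forall>x x'. x \<noteq> x' \<longrightarrow> amplitude_x \<psi> x ** hc (amplitude_x \<psi> x') = 0"
      then show "(\<forall>x x'. x \<noteq> x' \<longrightarrow> transpose (amplitude_x \<psi> x' ** hc (amplitude_x \<psi> x)) = 0) \<or>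
          (\<forall>z z'. z \<noteq> z' \<longrightarrow> transpose (hc (amplitude_z \<psi> z') ** amplitude_z \<psi> z) = 0)"
        by (simp add: linear_0[OF linear_transpose])
    qed
  qed
qed

lemma Q_PA_eq_best_guess:
  fixes \<psi> :: "complex^('n::len0 bits \<times> 'b::finite \<times> 'e::finite)"
    and f :: "'n bits \<Rightarrow> 'm::len0 bits" and g :: "'n bits \<Rightarrow> 's::finite"
  assumes dp: "dual_pair character f g" and standard: "standard_form (outer \<psi>)"
    and pos: "0 < Re (trace (measured ket_x (marginal_AB (outer \<psi>))))"
  shows "Q_PA f (measured ket_z (marginal_AE (outer \<psi>)))
    = Re (trace (measured ket_z (marginal_AE (outer \<psi>)))) - dual_pair_state.best_guess g (amplitude_x \<psi>)"
proof -
  interpret dual_pair_state character f g "amplitude_z \<psi>" "amplitude_x \<psi>"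
    by (rule dual_pair_amplitudes[OF dp standard])
  define R where "R k = (\<Sum>z\<in>f -` {k}. hc (amplitude_z \<psi> z) ** amplitude_z \<psi> z)" for k
  have "hashed_state f (measured ket_z (marginal_AE (outer \<psi>))) = basis.block ket_z R"
    unfolding hashed_state_def measured_AE_block basis.conditional_block[OF ket_z_basis]
      basis.block_tensor[OF ket_z_basis] R_def ..
  moreover have "psd (R k)" for k
    unfolding R_def by (intro psd_sum psd_hc_mult)
  ultimately have H: "H_max (hashed_state f (measured ket_z (marginal_AE (outer \<psi>))))
      = Sup {log 2 t | t \<sigma>. normalized_state \<sigma> \<and> 0 < t \<and> t = (\<Sum>k\<in>UNIV. fidelity (R k) \<sigma>)\<^sup>2}"
    using basis.H_max_block[OF ket_z_basis, of R] by simp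
  have total: "0 < (\<Sum>x\<in>UNIV. (norm (amplitude_x \<psi> x))\<^sup>2)"
    using pos unfolding measured_AB_block basis.Re_trace_block[OF ket_x_basis] trace_transpose
    by (simp add: norm_sq_eq_trace_hc)
  have "2 powr (H_max (hashed_state f (measured ket_z (marginal_AE (outer \<psi>))))) = c * best_guess"
    unfolding H R_def by (rule powr_Sup_log_fidelity[OF total])
  \<comment> \<open>The alphabet size of the key is exactly the \<open>c\<close> of the duality, so
    subtracting \<open>LENGTH('m)\<close> in the exponent removes it.\<close>
  moreover have "c = 2 powr real LENGTH('m)"
    by (simp add: c_def card_bits powr_realpow)
  ultimately show ?thesis
    unfolding Q_PA_def by (simp add: powr_diff)
qed

text \<open>Failure is the total trace minus success. Transposing every POVM element permutes the
  POVMs and compensates the transposition in the state on \<open>B\<close>.\<close>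

lemma Q_DC_eq_best_guess:
  fixes \<psi> :: "complex^('n::len0 bits \<times> 'b::finite \<times> 'e::finite)"
    and f :: "'n bits \<Rightarrow> 'k::finite" and g :: "'n bits \<Rightarrow> 'l::len0 bits"
  assumes dp: "dual_pair character f g" and standard: "standard_form (outer \<psi>)"
  shows "Q_DC g (measured ket_x (marginal_AB (outer \<psi>)))
    = Re (trace (measured ket_x (marginal_AB (outer \<psi>)))) - dual_pair_state.best_guess g (amplitude_x \<psi>)"
proof -
  interpret dual_pair_state character f g "amplitude_z \<psi>" "amplitude_x \<psi>"
    by (rule dual_pair_amplitudes[OF dp standard])
  define R where "R x = transpose (amplitude_x \<psi> x ** hc (amplitude_x \<psi> x))" for x
  define \<tau> where "\<tau> = Re (trace (measured ket_x (marginal_AB (outer \<psi>))))"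
  have \<tau>: "\<tau> = (\<Sum>x\<in>UNIV. Re (trace (R x)))"
    unfolding \<tau>_def measured_AB_block basis.Re_trace_block[OF ket_x_basis] R_def ..
  have cond: "conditional (ket_x x) (measured ket_x (marginal_AB (outer \<psi>))) = R x" for x
    unfolding measured_AB_block basis.conditional_block[OF ket_x_basis] R_def ..
  have val: "(\<Sum>x\<in>UNIV. \<Sum>e\<in>{e. e \<noteq> x}. Re (trace (R x ** M (g x) e)))
      = \<tau> - guess_value (\<lambda>s e. transpose (M s e))" if M: "\<forall>s. povm (M s)" for M
  proof -
    have "(\<Sum>e\<in>{e. e \<noteq> x}. Re (trace (R x ** M (g x) e)))
        = Re (trace (R x)) - amplitude_x \<psi> x \<bullet> (transpose (M (g x) x) ** amplitude_x \<psi> x)" for x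
    proof -
      have "(\<Sum>e\<in>UNIV. Re (trace (R x ** M (g x) e))) = Re (trace (R x ** (\<Sum>e\<in>UNIV. M (g x) e)))"
        by (simp add: mm.sum_right Re_trace_sum)
      also have "\<dots> = Re (trace (R x))" using M by (simp add: povm_def)
      finally have all: "(\<Sum>e\<in>UNIV. Re (trace (R x ** M (g x) e))) = Re (trace (R x))" .
      have "{e. e \<noteq> x} = UNIV - {x}" by auto
      then have "(\<Sum>e\<in>{e. e \<noteq> x}. Re (trace (R x ** M (g x) e))) = Re (trace (R x)) - Re (trace (R x ** M (g x) x))"
        by (simp add: sum_diff1 all)
      then show ?thesis unfolding R_def Re_trace_transpose_state .
    qed
    then show ?thesis by (simp add: guess_value_def \<tau> sum_subtractf)
  qed
  have "{\<Sum>x\<in>UNIV. \<Sum>e\<in>{e. e \<noteq> x}. Re (trace (R x ** M (g x) e)) | M. \<forall>s. povm (M s)}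
      = {\<tau> - v | v. v \<in> {guess_value M | M. \<forall>s. povm (M s)}}" (is "?L = ?R")
  proof (intro subset_antisym subsetI)
    fix u assume "u \<in> ?L"
    then obtain M where M: "\<forall>s. povm (M s)"
      "u = (\<Sum>x\<in>UNIV. \<Sum>e\<in>{e. e \<noteq> x}. Re (trace (R x ** M (g x) e)))" by blast
    have "\<forall>s. povm (\<lambda>e. transpose (M s e))" using M(1) povm_transpose by blast
    moreover have "u = \<tau> - guess_value (\<lambda>s e. transpose (M s e))" using M val by simp
    ultimately show "u \<in> ?R" by blast
  next
    fix u assume "u \<in> ?R"
    then obtain M where M: "\<forall>s. povm (M s)" "u = \<tau> - guess_value M" by blast
    have M': "\<forall>s. povm (\<lambda>e. transpose (M s e))" using M(1) povm_transpose by blast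
    have "u = (\<Sum>x\<in>UNIV. \<Sum>e\<in>{e. e \<noteq> x}. Re (trace (R x ** transpose (M (g x) e))))"
      unfolding val[OF M'] by (simp add: M(2))
    with M' show "u \<in> ?L"
      by (intro CollectI exI[of _ "\<lambda>s e. transpose (M s e)"] conjI)
  qed
  then have "Q_DC g (measured ket_x (marginal_AB (outer \<psi>))) = Inf {\<tau> - v | v. v \<in> {guess_value M | M. \<forall>s. povm (M s)}}"
    unfolding Q_DC_def cond by simp
  also have "\<dots> = \<tau> - best_guess"
    unfolding best_guess_def by (rule Inf_diff_eq[OF guess_values_nonempty guess_values_bdd])
  finally show ?thesis unfolding \<tau>_def .
qed

text \<open>In characteristic 2 the output \<open>x + e\<close> is 0 exactly if
  \<open>e = x\<close>, so both decoders fail on the same outcomes.\<close>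

lemma Q_EC_eq_Q_DC: "Q_EC g \<rho> = Q_DC g \<rho>" for g :: "'n::len0 bits \<Rightarrow> 'l::len0 bits"
proof -
  have "{e. x + e \<noteq> 0} = {e. e \<noteq> x}" for x :: "'n bits"
    by (auto simp: bits_add_eq_zero_iff)
  then show ?thesis unfolding Q_EC_def Q_DC_def by simp
qed

text \<open>For the transposed components the duality expresses the max-entropy by the probability
  of guessing \<open>z\<close> from \<open>E\<close>, which semidefinite duality identifies with the
  quantity in the min-entropy. \<open>LENGTH('n)\<close> is the logarithm of
  \<open>c\<close>.\<close>

lemma H_min_H_max_duality:
  fixes \<psi> :: "complex^('n::len0 bits \<times> 'b::finite \<times> 'e::finite)"
  assumes standard: "standard_form (outer \<psi>)"
    and pos: "0 < Re (trace (measured ket_z (marginal_AE (outer \<psi>))))"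
  shows "H_min (measured ket_z (marginal_AE (outer \<psi>)))
    = real LENGTH('n) - H_max (measured ket_x (marginal_AB (outer \<psi>)))"
proof -
  interpret dual_pair_state character id "\<lambda>_. ()" "\<lambda>x. transpose (amplitude_x \<psi> x)" "\<lambda>z. transpose (amplitude_z \<psi> z)"
    by (rule dual_pair_amplitudes_transposed[OF standard])
  define R where "R z = hc (amplitude_z \<psi> z) ** amplitude_z \<psi> z" for z
  have psdR: "psd (R z)" for z unfolding R_def by (rule psd_hc_mult)
  have R: "R z = transpose (transpose (amplitude_z \<psi> z) ** hc (transpose (amplitude_z \<psi> z)))" for z
    by (simp add: R_def matrix_transpose_mul hc_transpose Finite_Cartesian_Product.transpose_transpose)
  have total: "0 < (\<Sum>z\<in>UNIV. (norm (transpose (amplitude_z \<psi> z)))\<^sup>2)"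
  proof -
    have "(norm (transpose (amplitude_z \<psi> z)))\<^sup>2 = Re (trace (R z))" for z
      unfolding R trace_transpose by (rule norm_sq_eq_trace_hc)
    then show ?thesis
      using pos unfolding measured_AE_block basis.Re_trace_block[OF ket_z_basis] R_def by simp
  qed
  have val: "guess_value (\<lambda>s z. transpose (M z)) = (\<Sum>z\<in>UNIV. R z \<bullet> M z)" for M
  proof -
    have "transpose (amplitude_z \<psi> z) \<bullet> (transpose (M z) ** transpose (amplitude_z \<psi> z)) = R z \<bullet> M z" for z
      unfolding Re_trace_transpose_state[symmetric] R[symmetric]
      by (simp add: inner_eq_trace psd_hermitian[OF psdR])
    then show ?thesis by (simp add: guess_value_def)
  qed
  have sets: "{\<Sum>z\<in>UNIV. R z \<bullet> M z | M. povm M} = {guess_value M | M. \<forall>s. povm (M s)}" (is "?L = ?R")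
  proof (intro subset_antisym subsetI)
    fix u assume "u \<in> ?L"
    then obtain M where M: "povm M" "u = (\<Sum>z\<in>UNIV. R z \<bullet> M z)" by blast
    then show "u \<in> ?R"
      unfolding val[symmetric] using povm_transpose[OF M(1)] by blast
  next
    fix u assume "u \<in> ?R"
    then obtain M where M: "\<forall>s. povm (M s)" "u = guess_value M" by blast
    have "u = guess_value (\<lambda>s z. transpose (transpose (M () z)))"
      unfolding Finite_Cartesian_Product.transpose_transpose M(2) by (simp add: guess_value_def)
    then have "u = (\<Sum>z\<in>UNIV. R z \<bullet> transpose (M () z))" unfolding val .
    moreover have "povm (\<lambda>z. transpose (M () z))" using M(1) povm_transpose by blast
    ultimately show "u \<in> ?L"
      by (intro CollectI exI[of _ "\<lambda>z. transpose (M () z)"] conjI)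
  qed
  have "Inf {Re (trace \<sigma>) | \<sigma>. psd \<sigma> \<and> (\<forall>z. psd (\<sigma> - R z))} = best_guess"
    unfolding guess_duality[OF psdR] sets best_guess_def ..
  then have Hmin: "H_min (measured ket_z (marginal_AE (outer \<psi>))) = - log 2 best_guess"
    unfolding measured_AE_block basis.H_min_block[OF ket_z_basis] R_def by simp
  define S where "S x = transpose (amplitude_x \<psi> x ** hc (amplitude_x \<psi> x))" for x
  have S: "S x = (\<Sum>x\<in>id -` {x}. hc (transpose (amplitude_x \<psi> x)) ** transpose (amplitude_x \<psi> x))" for x
    by (simp add: S_def matrix_transpose_mul hc_transpose vimage_def)
  have psdS: "psd (S x)" for x unfolding S by (intro psd_sum psd_hc_mult)
  have "H_max (measured ket_x (marginal_AB (outer \<psi>)))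
      = Sup {log 2 t | t \<sigma>. normalized_state \<sigma> \<and> 0 < t \<and> t = (\<Sum>x\<in>UNIV. fidelity (S x) \<sigma>)\<^sup>2}"
    unfolding measured_AB_block S_def[symmetric] by (rule basis.H_max_block[OF ket_x_basis psdS])
  then have "2 powr H_max (measured ket_x (marginal_AB (outer \<psi>))) = c * best_guess"
    unfolding S using powr_Sup_log_fidelity[OF total] by simp
  from arg_cong[OF this, of "log 2"]
  have "H_max (measured ket_x (marginal_AB (outer \<psi>))) = log 2 (c * best_guess)"
    by simp
  also have "\<dots> = real LENGTH('n) + log 2 best_guess"
    using best_guess_pos[OF total] c_pos by (simp add: log_mult c_def card_bits log_nat_power)
  finally show ?thesis using Hmin by simp
qed

text \<open>Injectivity of both enumerations lets the two expectations be written as sums over the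
  same indices.\<close>

lemma expectation_dual:
  fixes F :: "'f pmf" and G :: "'g pmf" and h :: "'f \<Rightarrow> real" and h' :: "'g \<Rightarrow> real" and N :: nat
  assumes "inj_on f {..<N}" "inj_on g {..<N}" "set_pmf F \<subseteq> f ` {..<N}" "set_pmf G \<subseteq> g ` {..<N}"
    and "\<And>i. i < N \<Longrightarrow> pmf F (f i) = pmf G (g i)" "\<And>i. i < N \<Longrightarrow> h (f i) = h' (g i)"
  shows "measure_pmf.expectation F h = measure_pmf.expectation G h'"
proof -
  have "measure_pmf.expectation F h = (\<Sum>a\<in>f ` {..<N}. h a * pmf F a)"
    using assms(3) by (intro integral_measure_pmf_real) auto
  also have "\<dots> = (\<Sum>i<N. h (f i) * pmf F (f i))"
    using assms(1) by (simp add: sum.reindex)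
  also have "\<dots> = (\<Sum>i<N. h' (g i) * pmf G (g i))"
    using assms(5,6) by (intro sum.cong) auto
  also have "\<dots> = (\<Sum>a\<in>g ` {..<N}. h' a * pmf G a)"
    using assms(2) by (simp add: sum.reindex)
  also have "\<dots> = measure_pmf.expectation G h'"
    using assms(4) by (intro integral_measure_pmf_real[symmetric]) auto
  finally show ?thesis .
qed

theorem theorem2:
  fixes F :: "('n::len0 bits \<Rightarrow> 'm::len0 bits) pmf"
    and G :: "('n bits \<Rightarrow> 'l::len0 bits) pmf"
    and r :: "real \<Rightarrow> real"
    and \<rho>Z :: "('n bits \<times> 'e::finite) op"
    and \<rho>X :: "('n bits \<times> 'b::finite) op"
  assumes "LENGTH('m) \<le> LENGTH('n)"
    and "LENGTH('l) = LENGTH('n) - LENGTH('m)"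
    and "dual_random_functions F G"
    and "normalized_state \<rho>Z" and "normalized_state \<rho>X"
    and "corresponding \<rho>Z \<rho>X"
  shows "((measure_pmf.expectation F (\<lambda>f. Q_PA f \<rho>Z) \<le> r (H_min \<rho>Z))
           \<longleftrightarrow>
          (measure_pmf.expectation G (\<lambda>g. Q_EC g \<rho>X) \<le> r (real LENGTH('n) - H_max \<rho>X)))
         \<and>
         ((measure_pmf.expectation G (\<lambda>g. Q_EC g \<rho>X) \<le> r (real LENGTH('n) - H_max \<rho>X))
           \<longleftrightarrow>
          (measure_pmf.expectation G (\<lambda>g. Q_DC g \<rho>X) \<le> r (real LENGTH('n) - H_max \<rho>X)))"
proof -
  obtain \<psi> :: "complex^('n bits \<times> 'b \<times> 'e)" where \<psi>: "standard_form (outer \<psi>)"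
    and \<rho>: "\<rho>Z = measured ket_z (marginal_AE (outer \<psi>))" "\<rho>X = measured ket_x (marginal_AB (outer \<psi>))"
    using assms(6) unfolding corresponding_def standard_form_def pure_def by blast
  have trace: "Re (trace \<rho>Z) = 1" "Re (trace \<rho>X) = 1"
    using assms(4,5) by (simp_all add: normalized_state_def)
  have H: "H_min \<rho>Z = real LENGTH('n) - H_max \<rho>X"
    unfolding \<rho> by (rule H_min_H_max_duality[OF \<psi>]) (simp add: \<rho>(1)[symmetric] trace)
  \<comment> \<open>Both states have trace 1, so the two indices subtract the same
    \<open>best_guess\<close> from the same number.\<close>
  have Q: "Q_PA f \<rho>Z = Q_DC g \<rho>X" if "dual_functions f g" for f :: "'n bits \<Rightarrow> 'm bits" and g :: "'n bits \<Rightarrow> 'l bits"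
  proof -
    have dp: "dual_pair character f g"
      by (rule dual_functions_dual_pair[OF that assms(1,2)])
    show ?thesis
      using Q_PA_eq_best_guess[OF dp \<psi>] Q_DC_eq_best_guess[OF dp \<psi>]
      unfolding \<rho>[symmetric] by (simp add: trace)
  qed
  obtain N :: nat and f g where "inj_on f {..<N}" "inj_on g {..<N}" "set_pmf F \<subseteq> f ` {..<N}"
    "set_pmf G \<subseteq> g ` {..<N}" and fg: "\<forall>i<N. dual_functions (f i) (g i) \<and> pmf F (f i) = pmf G (g i)"
    using assms(3) unfolding dual_random_functions_def by blast
  then have "measure_pmf.expectation F (\<lambda>f. Q_PA f \<rho>Z) = measure_pmf.expectation G (\<lambda>g. Q_DC g \<rho>X)"
    by (intro expectation_dual[of f N g]) (auto intro: Q)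
  then show ?thesis by (simp add: H Q_EC_eq_Q_DC)
qed

end
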